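(* Let $\mu$ be a probability measure on $\mathbb Z^d$, let $\mathcal C$ be an open convex cone in $\mathbb R^d$ with vertex at the origin, let $E=\overline{\mathcal C}\cap\mathbb Z^d$ where $\overline{\mathcal C}$ is the closure of $\mathcal C$ in $\mathbb R^d$, and let $(X(t))$ be the substochastic random walk on $E$ with transition probabilities $p(x,y)=\mu(y-x)$, $x,y\in E$. Assume that: (1) $(X(t))$ is transient on $E$, and there are $\kappa>0$ and a finite set $\mathcal E_0\subset\mathbb Z^d$ such that $\mu(x)>0$ for all $x\in\mathcal E_0$ and for any $x\neq y$, $x,y\in E$, there is a sequence $x_0,x_1,\dots,x_n\in E$ with $x_0=x$, $x_n=y$, $n\le\kappa|y-x|$ and $x_j-x_{j-1}\in\mathcal E_0$ for all $j\in\{1,\dots,n\}$; (2) the jump generating function $R:\mathbb R^d\to\mathbb R\cup\{+\infty\}$, $R(\alpha)=\sum_{x\in\mathbb Z^d}\mu(x)e^{\langle\alpha,x\rangle}$, satisfies $R(\alpha)>R(0)=1$ for any $\alpha\in\mathbb R^d\setminus\{0\}$. Then any harmonic function $h$ of $(X(t))$ is superharmonic for the ladder height process $(H_n)$, satisfies $$h(x+u)=h(x)+\mathbb E_{x+u}\bigl(h(X(\eta_u)),\ \eta_u<\infty\bigr),\qquad\forall x,u\in E,$$ and $$h=h(0)V+\tilde h,\qquad \tilde h(x)=\lim_{n\to\infty}\mathbb E_x\bigl(h(X(t_n)),\ t_n<\infty\bigr)\ge0,$$ where $\tilde h$ satisfies $P_H\tilde h=\tilde h$ (i.e. is harmonic,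 possibly zero, for $(H_n)$). If moreover $\mathbb E_x(\tau_\vartheta)=+\infty$ (for all $x\in E$), then for any harmonic function $h$ of $(X(t))$ one has $\tilde h=0$ and $h$ is proportional to $V$. Otherwise, the function $\tilde h$ is non-trivial (not identically zero).
   Context: $(X(t))$ is the homogeneous random walk on $\mathbb Z^d$ with step distribution $\mu$ killed upon its first exit from $E$: it jumps from $x\in E$ to an absorbing state $\vartheta$ with probability $1-\sum_{y\in E}\mu(y-x)$, and $\tau_\vartheta=\inf\{n>0:X(n)=\vartheta\}$. Transient on $E$: $G(x,y)=\sum_{t\ge0}\mathbb P_x(X(t)=y)<\infty$, $x,y\in E$. For $u\in E$, $\eta_u=\inf\{t>0:X(t)\notin E+u\}$. The expectation $\mathbb E_x(\tau_\vartheta)$ is either finite for all $x\in E$ or infinite for all $x\in E$. A harmonic function of $(X(t))$ is a non-zero $h:E\to[0,\infty)$ with $\sum_{y\in E}p(x,y)h(y)=h(x)$; it is extended by $h(\vartheta)=0$. The ladder height process $(H_n)$ is the Markov chain on $E\cup\{\vartheta\}$ with $p_H(x,y)=\sum_{z\in E}G(0,z)\,a_x(z,y)$ for $x,y\in E$, where $a_x(z,y)=\mu(y-z-x)$ if $y\in E\setminus(E+x)$ and $a_x(z,y)=0$ if $y\in E+x$; $p_H(x,\vartheta)=1-\sum_{y\in E}p_H(x,y)$; and $\vartheta$ absorbing. $P_H\varphi(x)=\sum_{y\in E}p_H(x,y)\varphi(y)$; superharmonic for $(H_n)$ means $P_Hh\le h$. $V(x)=\mathbb E_x(\mathcal T_\vartheta)$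 with $\mathcal T_\vartheta=\inf\{n>0:H_n=\vartheta\}$. The random times $t_n$ are: $t_0=0$ and $t_{k+1}=\inf\{n>t_k:X(n)\notin E+X(t_k)\}$ if $t_k<\infty$ (with $t_{k+1}=+\infty$ if $X(t_k)=\vartheta$), $t_{k+1}=+\infty$ otherwise; in distribution $H_k=X(t_k)$ if $t_k<\infty$ and $H_k=\vartheta$ otherwise. *)

theory Defs
  imports "HOL-Probability.Probability"
begin

text \<open>
  The law of the chain with kernel \<open>K\<close> started at \<open>s\<close>, as a measure on paths \<open>nat \<Rightarrow> 's\<close>. It is
  realised through i.i.d. random maps: at each time step an independent successor is drawn for
  every state, according to \<open>K\<close>, and the chain moves to the successor drawn for its current state.
  Lemma \<open>nn_integral_path_measure\<close> below is the Markov property, which determines the law.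
\<close>

primrec trajectory :: "'s \<Rightarrow> ('s \<Rightarrow> 's) stream \<Rightarrow> nat \<Rightarrow> 's" where
  "trajectory s \<omega> 0 = s"
| "trajectory s \<omega> (Suc n) = (\<omega> !! n) (trajectory s \<omega> n)"

definition path_measure :: "('s::countable \<Rightarrow> 's pmf) \<Rightarrow> 's \<Rightarrow> (nat \<Rightarrow> 's) measure" where
  "path_measure K s =
     distr (stream_space (\<Pi>\<^sub>M s\<in>UNIV. measure_pmf (K s)))
           (\<Pi>\<^sub>M n\<in>UNIV. count_space UNIV) (trajectory s)"

lemma trajectory_SCons: "trajectory s (f ## \<omega>) = case_nat s (trajectory (f s) \<omega>)"
proof
  fix n
  have *: "trajectory s (f ## \<omega>) (Suc n) = trajectory (f s) \<omega> n" for n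
    by (induction n) auto
  show "trajectory s (f ## \<omega>) n = case_nat s (trajectory (f s) \<omega>) n"
    using * by (cases n) auto
qed

lemma measurable_trajectory [measurable]:
  fixes K :: "'s::countable \<Rightarrow> 's pmf"
  shows "trajectory s \<in> stream_space (\<Pi>\<^sub>M s\<in>UNIV. measure_pmf (K s)) \<rightarrow>\<^sub>M
           (\<Pi>\<^sub>M n\<in>UNIV. count_space UNIV)"
proof (rule measurable_PiM_single')
  fix n
  let ?M = "\<Pi>\<^sub>M s\<in>UNIV. measure_pmf (K s)"
  have comp: "(\<lambda>f. f t) \<in> ?M \<rightarrow>\<^sub>M count_space UNIV" for t
    using measurable_component_singleton[of t UNIV "\<lambda>s. measure_pmf (K s)"] by simp
  have "(\<lambda>\<omega>. trajectory s \<omega> n) \<in> stream_space ?M \<rightarrow>\<^sub>M count_space UNIV"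
  proof (induction n)
    case (Suc n)
    have "(\<lambda>\<omega>. (\<omega> !! n) t) \<in> stream_space ?M \<rightarrow>\<^sub>M count_space UNIV" for t
      using measurable_compose[OF measurable_snth comp] .
    then show ?case
      using measurable_compose_countable[OF _ Suc, of "\<lambda>t \<omega>. (\<omega> !! n) t"] by simp
  qed simp
  then show "(\<lambda>\<omega>. trajectory s \<omega> n) \<in> stream_space ?M \<rightarrow>\<^sub>M count_space UNIV" .
qed simp

lemma prob_space_path_measure: "prob_space (path_measure K s)"
proof -
  interpret P: product_prob_space "\<lambda>s. measure_pmf (K s)" UNIV
    by unfold_locales
  have "prob_space (stream_space (\<Pi>\<^sub>M s\<in>UNIV. measure_pmf (K s)))"
    by (intro prob_space.prob_space_stream_space P.prob_space_axioms)
  then show ?thesis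
    unfolding path_measure_def by (rule prob_space.prob_space_distr) simp
qed

lemma nn_integral_path_measure:
  fixes K :: "'s::countable \<Rightarrow> 's pmf"
  assumes [measurable]: "F \<in> borel_measurable (\<Pi>\<^sub>M n\<in>UNIV. count_space UNIV)"
  shows "(\<integral>\<^sup>+Z. F Z \<partial>path_measure K s) =
         (\<integral>\<^sup>+t. (\<integral>\<^sup>+Z. F (case_nat s Z) \<partial>path_measure K t) \<partial>measure_pmf (K s))"
proof -
  let ?M = "\<Pi>\<^sub>M s\<in>UNIV. measure_pmf (K s)"
  interpret P: product_prob_space "\<lambda>s. measure_pmf (K s)" UNIV
    by unfold_locales
  have [measurable]: "(\<lambda>Z. case_nat s Z) \<in> (\<Pi>\<^sub>M n\<in>UNIV. count_space UNIV) \<rightarrow>\<^sub>M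
      (\<Pi>\<^sub>M n\<in>(UNIV::nat set). count_space (UNIV::'s set))"
  proof (rule measurable_PiM_single')
    fix n :: nat
    show "(\<lambda>Z. case_nat s Z n) \<in> (\<Pi>\<^sub>M n\<in>(UNIV::nat set). count_space (UNIV::'s set)) \<rightarrow>\<^sub>M count_space UNIV"
      by (cases n) auto
  qed simp
  have "(\<integral>\<^sup>+Z. F Z \<partial>path_measure K s) = (\<integral>\<^sup>+\<omega>. F (trajectory s \<omega>) \<partial>stream_space ?M)"
    unfolding path_measure_def by (rule nn_integral_distr) auto
  also have "\<dots> = (\<integral>\<^sup>+f. \<integral>\<^sup>+\<omega>. F (trajectory s (f ## \<omega>)) \<partial>stream_space ?M \<partial>?M)"
    by (rule P.nn_integral_stream_space) simp
  also have "\<dots> = (\<integral>\<^sup>+f. (\<lambda>t. \<integral>\<^sup>+Z. F (case_nat s Z) \<partial>path_measure K t) (f s) \<partial>?M)"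
    unfolding path_measure_def trajectory_SCons by (subst nn_integral_distr) auto
  also have "\<dots> = (\<integral>\<^sup>+t. (\<integral>\<^sup>+Z. F (case_nat s Z) \<partial>path_measure K t)
                     \<partial>distr ?M (measure_pmf (K s)) (\<lambda>f. f s))"
    by (subst nn_integral_distr) auto
  also have "distr ?M (measure_pmf (K s)) (\<lambda>f. f s) = measure_pmf (K s)"
    by (rule P.PiM_component) simp
  finally show ?thesis .
qed

text \<open>
  The kernel on \<open>E \<union> {\<vartheta>}\<close>, with \<open>\<vartheta> = None\<close> absorbing, whose restriction to \<open>E\<close> is the
  substochastic matrix \<open>q\<close> and which jumps to \<open>\<vartheta>\<close> with the missing mass.
  States outside \<open>E\<close> are never entered; they are sent to \<open>\<vartheta>\<close>.
\<close>

definition killed_kernel :: "'s set \<Rightarrow> ('s \<Rightarrow> 's \<Rightarrow> ennreal) \<Rightarrow> 's option \<Rightarrow> 's option pmf" where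
  "killed_kernel E q a =
     (case a of
        None \<Rightarrow> return_pmf None
      | Some x \<Rightarrow>
          if x \<in> E then
            embed_pmf (\<lambda>b. case b of
                None \<Rightarrow> enn2real (1 - (\<integral>\<^sup>+y. q x y \<partial>count_space E))
              | Some y \<Rightarrow> if y \<in> E then enn2real (q x y) else 0)
          else return_pmf None)"

text \<open>\<^term>\<open>embed_pmf\<close> is only meaningful for a genuine distribution, i.e. for row sums at most 1.\<close>

lemma pmf_killed_kernel:
  assumes x: "x \<in> E" and le: "(\<integral>\<^sup>+y. q x y \<partial>count_space E) \<le> 1"
  shows "pmf (killed_kernel E q (Some x)) b =
    (case b of None \<Rightarrow> enn2real (1 - (\<integral>\<^sup>+y. q x y \<partial>count_space E))
       | Some y \<Rightarrow> if y \<in> E then enn2real (q x y) else 0)" (is "_ = ?f b")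
proof -
  have fin: "q x y < \<top>" if "y \<in> E" for y
    using nn_integral_ge_point[OF that, of "q x"] le by (simp add: le_less_trans top.not_eq_extremum
        order.strict_trans1[of _ 1])
  have U: "(UNIV :: 'a option set) = insert None (Some ` UNIV)"
    by (auto simp: UNIV_option_conv)
  have S: "(\<integral>\<^sup>+b. ennreal (?f b) \<partial>count_space (range Some)) = (\<integral>\<^sup>+y. q x y \<partial>count_space E)"
  proof -
    have "(\<integral>\<^sup>+b. ennreal (?f b) \<partial>count_space (range Some)) = (\<integral>\<^sup>+y. ennreal (?f (Some y)) \<partial>count_space UNIV)"
      by (rule nn_integral_bij_count_space[symmetric]) (auto simp: bij_betw_def)
    also have "\<dots> = (\<integral>\<^sup>+y. q x y * indicator E y \<partial>count_space UNIV)"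
      using fin by (intro nn_integral_cong) (auto simp: ennreal_enn2real indicator_def)
    also have "\<dots> = (\<integral>\<^sup>+y. q x y \<partial>count_space E)"
      by (simp add: nn_integral_count_space_indicator)
    finally show ?thesis .
  qed
  have "(\<integral>\<^sup>+b. ennreal (?f b) \<partial>count_space UNIV)
        = (\<integral>\<^sup>+b. ennreal (?f b) \<partial>count_space {None}) + (\<integral>\<^sup>+b. ennreal (?f b) \<partial>count_space (range Some))"
    unfolding U by (subst nn_integral_count_space_indicator, simp,
        subst nn_integral_count_space_indicator, simp,
        subst nn_integral_count_space_indicator, simp,
        subst nn_integral_add[symmetric]) (auto intro!: nn_integral_cong split: split_indicator)
  also have "\<dots> = (1 - (\<integral>\<^sup>+y. q x y \<partial>count_space E)) + (\<integral>\<^sup>+y. q x y \<partial>count_space E)"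
    unfolding S by (simp add: nn_integral_count_space_finite less_top[symmetric] ennreal_enn2real)
  also have "\<dots> = 1" using le by (simp add: diff_add_cancel_ennreal)
  finally have "(\<integral>\<^sup>+b. ennreal (?f b) \<partial>count_space UNIV) = 1" .
  then have "pmf (embed_pmf ?f) b = ?f b"
    by (intro pmf_embed_pmf) (auto split: option.split)
  with x show ?thesis by (simp add: killed_kernel_def)
qed

definition real_vec :: "int ^ 'd \<Rightarrow> real ^ 'd" where
  "real_vec x = (\<chi> i. real_of_int (x $ i))"

text \<open>
  The library predicate \<^const>\<open>cone\<close> forces the vertex to belong to the set, which an open cone
  other than the whole space does not satisfy.
\<close>

definition open_convex_cone :: "(real ^ 'd) set \<Rightarrow> bool" where
  "open_convex_cone C \<longleftrightarrow> open C \<and> convex C \<and> (\<forall>v\<in>C. \<forall>c>0. c *\<^sub>R v \<in> C)"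

definition lattice_cone :: "(real ^ 'd) set \<Rightarrow> (int ^ 'd) set" where
  "lattice_cone C = {x. real_vec x \<in> closure C}"

definition translate :: "(int ^ 'd) set \<Rightarrow> int ^ 'd \<Rightarrow> (int ^ 'd) set" where
  "translate E u = (\<lambda>z. z + u) ` E"

definition jump_gf :: "(int ^ 'd) pmf \<Rightarrow> real ^ 'd \<Rightarrow> ennreal" where
  "jump_gf \<mu> \<alpha> = (\<integral>\<^sup>+x. ennreal (pmf \<mu> x * exp (\<alpha> \<bullet> real_vec x)) \<partial>count_space UNIV)"

definition walk_trans :: "(int ^ 'd) pmf \<Rightarrow> int ^ 'd \<Rightarrow> int ^ 'd \<Rightarrow> ennreal" where
  "walk_trans \<mu> x y = ennreal (pmf \<mu> (y - x))"

definition walk_law ::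
  "(int ^ 'd) set \<Rightarrow> (int ^ 'd) pmf \<Rightarrow> int ^ 'd \<Rightarrow> (nat \<Rightarrow> (int ^ 'd) option) measure" where
  "walk_law E \<mu> x = path_measure (killed_kernel E (walk_trans \<mu>)) (Some x)"

definition green :: "(int ^ 'd) set \<Rightarrow> (int ^ 'd) pmf \<Rightarrow> int ^ 'd \<Rightarrow> int ^ 'd \<Rightarrow> ennreal" where
  "green E \<mu> x y = (\<Sum>t. emeasure (walk_law E \<mu> x) {X \<in> space (walk_law E \<mu> x). X t = Some y})"

definition transient_on :: "(int ^ 'd) set \<Rightarrow> (int ^ 'd) pmf \<Rightarrow> bool" where
  "transient_on E \<mu> \<longleftrightarrow> (\<forall>x\<in>E. \<forall>y\<in>E. green E \<mu> x y < \<infinity>)"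

definition communication_condition :: "(int ^ 'd) set \<Rightarrow> (int ^ 'd) pmf \<Rightarrow> bool" where
  "communication_condition E \<mu> \<longleftrightarrow>
     (\<exists>\<kappa>>0. \<exists>E0. finite E0 \<and> (\<forall>x\<in>E0. pmf \<mu> x > 0) \<and>
        (\<forall>x\<in>E. \<forall>y\<in>E. x \<noteq> y \<longrightarrow>
           (\<exists>n w. w 0 = x \<and> w n = y \<and> (\<forall>j\<le>n. w j \<in> E) \<and>
                  real n \<le> \<kappa> * norm (real_vec (y - x)) \<and>
                  (\<forall>j\<in>{1..n}. w j - w (j - 1) \<in> E0))))"

definition harmonic_on :: "(int ^ 'd) set \<Rightarrow> (int ^ 'd) pmf \<Rightarrow> (int ^ 'd \<Rightarrow> real) \<Rightarrow> bool" where
  "harmonic_on E \<mu> h \<longleftrightarrow>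
     (\<forall>x\<in>E. h x \<ge> 0) \<and> (\<exists>x\<in>E. h x \<noteq> 0) \<and>
     (\<forall>x\<in>E. (\<integral>\<^sup>+y. walk_trans \<mu> x y * ennreal (h y) \<partial>count_space E) = ennreal (h x))"

definition first_after :: "nat \<Rightarrow> (nat \<Rightarrow> bool) \<Rightarrow> enat" where
  "first_after m P = Inf (enat ` {n. n > m \<and> P n})"

definition absorption_time :: "(nat \<Rightarrow> 's option) \<Rightarrow> enat" where
  "absorption_time Z = first_after 0 (\<lambda>n. Z n = None)"

definition exit_time :: "(int ^ 'd) set \<Rightarrow> int ^ 'd \<Rightarrow> (nat \<Rightarrow> (int ^ 'd) option) \<Rightarrow> enat" where
  "exit_time E u X = first_after 0 (\<lambda>n. X n \<notin> Some ` translate E u)"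

primrec ladder_time ::
  "(int ^ 'd) set \<Rightarrow> (nat \<Rightarrow> (int ^ 'd) option) \<Rightarrow> nat \<Rightarrow> enat" where
  "ladder_time E X 0 = 0"
| "ladder_time E X (Suc k) =
     (case ladder_time E X k of
        enat m \<Rightarrow>
          (case X m of
             Some x \<Rightarrow> first_after m (\<lambda>n. X n \<notin> Some ` translate E x)
           | None \<Rightarrow> \<infinity>)
      | \<infinity> \<Rightarrow> \<infinity>)"

text \<open>The variable \<open>h(X(T)) 1{T < \<infinity>}\<close>, with \<open>h\<close> extended by \<open>h(\<vartheta>) = 0\<close>.\<close>

definition value_at :: "('s \<Rightarrow> real) \<Rightarrow> (nat \<Rightarrow> 's option) \<Rightarrow> enat \<Rightarrow> ennreal" where
  "value_at h X T =
     (case T of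
        enat n \<Rightarrow> (case X n of Some y \<Rightarrow> ennreal (h y) | None \<Rightarrow> 0)
      | \<infinity> \<Rightarrow> 0)"

definition mean_killing_time :: "(int ^ 'd) set \<Rightarrow> (int ^ 'd) pmf \<Rightarrow> int ^ 'd \<Rightarrow> ennreal" where
  "mean_killing_time E \<mu> x = (\<integral>\<^sup>+X. ennreal_of_enat (absorption_time X) \<partial>walk_law E \<mu> x)"

definition ladder_jump ::
  "(int ^ 'd) set \<Rightarrow> (int ^ 'd) pmf \<Rightarrow> int ^ 'd \<Rightarrow> int ^ 'd \<Rightarrow> int ^ 'd \<Rightarrow> ennreal" where
  "ladder_jump E \<mu> x z y = (if y \<in> E - translate E x then ennreal (pmf \<mu> (y - z - x)) else 0)"

definition ladder_trans ::
  "(int ^ 'd) set \<Rightarrow> (int ^ 'd) pmf \<Rightarrow> int ^ 'd \<Rightarrow> int ^ 'd \<Rightarrow> ennreal" where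
  "ladder_trans E \<mu> x y = (\<integral>\<^sup>+z. green E \<mu> 0 z * ladder_jump E \<mu> x z y \<partial>count_space E)"

definition ladder_op ::
  "(int ^ 'd) set \<Rightarrow> (int ^ 'd) pmf \<Rightarrow> (int ^ 'd \<Rightarrow> real) \<Rightarrow> int ^ 'd \<Rightarrow> ennreal" where
  "ladder_op E \<mu> \<phi> x = (\<integral>\<^sup>+y. ladder_trans E \<mu> x y * ennreal (\<phi> y) \<partial>count_space E)"

definition ladder_law ::
  "(int ^ 'd) set \<Rightarrow> (int ^ 'd) pmf \<Rightarrow> int ^ 'd \<Rightarrow> (nat \<Rightarrow> (int ^ 'd) option) measure" where
  "ladder_law E \<mu> x = path_measure (killed_kernel E (ladder_trans E \<mu>)) (Some x)"

definition ladder_V :: "(int ^ 'd) set \<Rightarrow> (int ^ 'd) pmf \<Rightarrow> int ^ 'd \<Rightarrow> ennreal" where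
  "ladder_V E \<mu> x = (\<integral>\<^sup>+H. ennreal_of_enat (absorption_time H) \<partial>ladder_law E \<mu> x)"

end

theory Submission
  imports Defs
begin

text \<open>
  Let \<open>P\<close> be the transition operator of the killed walk and \<open>P\<^sub>H\<close> that of the ladder process. For \<open>u\<close>
  in \<open>E\<close> and \<open>h\<close> harmonic, \<open>h(\<cdot> + u)\<close> is superharmonic; its potential part is the exit term
  \<open>E\<^sub>x\<^sub>+\<^sub>u (h(X(\<eta>\<^sub>u)), \<eta>\<^sub>u < \<infinity>)\<close> and its harmonic part is \<open>T\<^sub>u h = lim P\<^sup>n (h(\<cdot> + u))\<close>. Everything rests on
  \<open>T\<^sub>u = id\<close>, which is obtained without Choquet theory. Paths from \<open>0\<close> to \<open>n u\<close> and back give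
  \<open>e\<^sup>-\<^sup>\<epsilon>\<^sup>n \<le> T\<^sub>u\<^sup>n \<le> e\<^sup>\<epsilon>\<^sup>n\<close> along powers of two, because hitting probabilities decay subexponentially: otherwise
  Hahn--Banach yields \<open>\<alpha> \<noteq> 0\<close> with \<open>\<mu>\<^sup>*\<^sup>n(v) \<le> e\<^sup>-\<^sup>\<alpha>\<^sup>v\<close> for all \<open>v\<close> and \<open>n\<close>, hence \<open>R(\<alpha>) \<le> 1\<close>. As \<open>T\<^sub>u\<close> and
  \<open>C - T\<^sub>u\<close> are positive operators, square roots may be taken in these bounds.

  With \<open>x = 0\<close> the shift identity reads \<open>h = h(0) + P\<^sub>H h\<close>, and iteration gives \<open>h = h(0) V + h'\<close>. The truncated
  lifetimes \<open>f\<^sub>N(x) = E\<^sub>x(min(\<tau>, N))\<close> obey the same decomposition up to a shift of \<open>N\<close>. If \<open>E\<^sub>0(\<tau>) = \<infinity>\<close>, then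
  \<open>f\<^sub>N/f\<^sub>N(0)\<close> converges to \<open>V\<close>, so that \<open>V \<le> P V\<close>, and \<open>h'\<close> is superharmonic for \<open>P\<close> and vanishes at \<open>0\<close>, hence
  everywhere. If \<open>E\<^sub>0(\<tau>) < \<infinity>\<close>, then \<open>V\<close> is bounded by a multiple of the potential \<open>E\<^sub>x(\<tau>)\<close>, and no non-zero
  harmonic function has such a bound.
\<close>

section \<open>Kernel operators\<close>

text \<open>Values in \<open>ennreal\<close> make every sum meaningful; summing over
  \<open>E\<close> alone amounts to extending functions by 0 at the cemetery.\<close>

definition kop :: "'s set \<Rightarrow> ('s \<Rightarrow> 's \<Rightarrow> ennreal) \<Rightarrow> ('s \<Rightarrow> ennreal) \<Rightarrow> 's \<Rightarrow> ennreal" where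
  "kop E q f x = (\<integral>\<^sup>+y. q x y * f y \<partial>count_space E)"

lemma kop_mono: "(\<And>y. y \<in> E \<Longrightarrow> f y \<le> g y) \<Longrightarrow> kop E q f x \<le> kop E q g x"
  unfolding kop_def by (intro nn_integral_mono mult_left_mono) auto

lemma kop_cong: "(\<And>y. y \<in> E \<Longrightarrow> f y = g y) \<Longrightarrow> kop E q f x = kop E q g x"
  unfolding kop_def by (intro nn_integral_cong) auto

lemma kop_add: "kop E q (\<lambda>y. f y + g y) x = kop E q f x + kop E q g x"
  unfolding kop_def by (simp add: distrib_left nn_integral_add)

lemma kop_cmult: "kop E q (\<lambda>y. c * f y) x = c * kop E q f x"
  unfolding kop_def by (simp add: mult.left_commute[of _ c] nn_integral_cmult)

lemma kop_0 [simp]: "kop E q (\<lambda>_. 0) x = 0"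
  unfolding kop_def by simp

lemma kop_sum: "kop E q (\<lambda>y. \<Sum>i\<in>I. f i y) x = (\<Sum>i\<in>I. kop E q (f i) x)"
  by (induction I rule: infinite_finite_induct) (auto simp: kop_add)

lemma kop_suminf: "kop E q (\<lambda>y. \<Sum>n. f n y) x = (\<Sum>n. kop E q (f n) x)"
  unfolding kop_def by (simp add: nn_integral_suminf[symmetric])

lemma kop_nn_integral:
  fixes q :: "'s :: countable \<Rightarrow> 's \<Rightarrow> ennreal"
  shows "kop E q (\<lambda>y. \<integral>\<^sup>+z. f z y \<partial>count_space B) x = (\<integral>\<^sup>+z. kop E q (f z) x \<partial>count_space (B :: 's set))"
proof -
  interpret pair_sigma_finite "count_space B" "count_space E"
    by (intro pair_sigma_finite.intro sigma_finite_measure_count_space_countable) auto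
  have [measurable]: "(\<lambda>(z, y). q x y * f z y) \<in> borel_measurable (count_space B \<Otimes>\<^sub>M count_space E)"
    by (simp add: pair_measure_countable)
  have "kop E q (\<lambda>y. \<integral>\<^sup>+z. f z y \<partial>count_space B) x
      = (\<integral>\<^sup>+y. \<integral>\<^sup>+z. q x y * f z y \<partial>count_space B \<partial>count_space E)"
    unfolding kop_def by (simp add: nn_integral_cmult)
  also have "\<dots> = (\<integral>\<^sup>+z. kop E q (f z) x \<partial>count_space B)"
    unfolding kop_def by (rule Fubini') simp
  finally show ?thesis .
qed

lemma kop_ge_point: "y \<in> E \<Longrightarrow> q x y * f y \<le> kop E q f x"
  unfolding kop_def by (rule nn_integral_ge_point)

lemma kop_SUP:
  assumes "\<And>y. y \<in> E \<Longrightarrow> incseq (\<lambda>n. f n y)"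
  shows "kop E q (\<lambda>y. SUP n. f n y) x = (SUP n. kop E q (f n) x)"
proof -
  have "kop E q (\<lambda>y. SUP n. f n y) x = (\<integral>\<^sup>+y. (SUP n. q x y * f n y) \<partial>count_space E)"
    unfolding kop_def by (simp add: SUP_mult_left_ennreal)
  also have "\<dots> = (SUP n. kop E q (f n) x)"
    unfolding kop_def
    by (intro nn_integral_monotone_convergence_SUP_AE)
       (use assms in \<open>auto simp: AE_count_space incseq_def intro!: mult_left_mono\<close>)
  finally show ?thesis .
qed

text \<open>Decreasing limits need a finite first term as majorant. Finiteness of \<open>q\<close>
  enters pointwise, because multiplication by \<top> is not continuous at 0.\<close>

lemma kop_INF:
  assumes dec: "\<And>y. y \<in> E \<Longrightarrow> decseq (\<lambda>n. f n y)" and fin: "kop E q (f 0) x < \<infinity>"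
    and q: "\<And>y. y \<in> E \<Longrightarrow> q x y < \<infinity>"
  shows "kop E q (\<lambda>y. INF n. f n y) x = (INF n. kop E q (f n) x)"
proof -
  have "kop E q (\<lambda>y. INF n. f n y) x = (\<integral>\<^sup>+y. (INF n. q x y * f n y) \<partial>count_space E)"
    unfolding kop_def
  proof (intro nn_integral_cong)
    fix y assume "y \<in> space (count_space E)"
    then have y: "y \<in> E" by simp
    have "(\<lambda>n. q x y * f n y) \<longlonglongrightarrow> q x y * (INF n. f n y)"
      using q[OF y] by (intro ennreal_tendsto_cmult LIMSEQ_INF dec y) auto
    moreover have "(\<lambda>n. q x y * f n y) \<longlonglongrightarrow> (INF n. q x y * f n y)"
      using dec[OF y] by (intro LIMSEQ_INF) (auto simp: decseq_def intro!: mult_left_mono)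
    ultimately show "q x y * (INF n. f n y) = (INF n. q x y * f n y)"
      by (rule LIMSEQ_unique)
  qed
  also have "\<dots> = (INF n. kop E q (f n) x)"
    unfolding kop_def
    by (intro nn_integral_monotone_convergence_INF_AE')
       (use assms in \<open>auto simp: AE_count_space decseq_def kop_def intro!: mult_left_mono\<close>)
  finally show ?thesis .
qed

lemma pow_mono:
  "(\<And>y. y \<in> E \<Longrightarrow> f y \<le> g y) \<Longrightarrow> x \<in> E \<Longrightarrow> (kop E q ^^ n) f x \<le> (kop E q ^^ n) g x"
  by (induction n arbitrary: x) (auto intro!: kop_mono)

lemma pow_cong:
  "(\<And>y. y \<in> E \<Longrightarrow> f y = g y) \<Longrightarrow> x \<in> E \<Longrightarrow> (kop E q ^^ n) f x = (kop E q ^^ n) g x"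
  by (intro antisym pow_mono) auto

lemma pow_add: "(kop E q ^^ n) (\<lambda>y. f y + g y) x = (kop E q ^^ n) f x + (kop E q ^^ n) g x"
  by (induction n arbitrary: x) (auto simp: kop_add[symmetric] intro: kop_cong)

lemma pow_cmult: "(kop E q ^^ n) (\<lambda>y. c * f y) x = c * (kop E q ^^ n) f x"
  by (induction n arbitrary: x) (auto simp: kop_cmult[symmetric] intro: kop_cong)

lemma pow_Suc_right: "(kop E q ^^ Suc n) f x = (kop E q ^^ n) (kop E q f) x"
  by (simp add: funpow_swap1)

lemma pow_plus: "(kop E q ^^ (m + n)) f x = (kop E q ^^ m) ((kop E q ^^ n) f) x"
  by (simp add: funpow_add)

lemma pow_SUP:
  assumes "\<And>y. y \<in> E \<Longrightarrow> incseq (\<lambda>n. f n y)" "x \<in> E"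
  shows "(kop E q ^^ m) (\<lambda>y. SUP n. f n y) x = (SUP n. (kop E q ^^ m) (f n) x)"
  using assms(2)
proof (induction m arbitrary: x)
  case (Suc m)
  have "(kop E q ^^ Suc m) (\<lambda>y. SUP n. f n y) x = kop E q (\<lambda>y. SUP n. (kop E q ^^ m) (f n) y) x"
    using Suc by (auto intro!: kop_cong)
  also have "\<dots> = (SUP n. (kop E q ^^ Suc m) (f n) x)"
    by (subst kop_SUP) (use assms(1) in \<open>auto simp: incseq_def intro!: pow_mono\<close>)
  finally show ?case .
qed auto

text \<open>The n-step kernel is \<open>(kop E q ^^ n) (indicator {z}) x\<close>; summed over n it
  becomes the Green function.\<close>

lemma pow_expand:
  fixes q :: "'s :: countable \<Rightarrow> 's \<Rightarrow> ennreal"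
  assumes "x \<in> E"
  shows "(kop E q ^^ n) f x = (\<integral>\<^sup>+z. (kop E q ^^ n) (indicator {z}) x * f z \<partial>count_space E)"
  using assms
proof (induction n arbitrary: x)
  case 0
  have "(\<integral>\<^sup>+z. indicator {z} x * f z \<partial>count_space E) = (\<integral>\<^sup>+z. f x * indicator {x} z \<partial>count_space E)"
    by (intro nn_integral_cong) (auto simp: indicator_def)
  then show ?case using 0 by simp
next
  case (Suc n)
  have "(kop E q ^^ Suc n) f x = kop E q (\<lambda>y. \<integral>\<^sup>+z. (kop E q ^^ n) (indicator {z}) y * f z \<partial>count_space E) x"
    using Suc by (auto intro!: kop_cong)
  also have "\<dots> = (\<integral>\<^sup>+z. (kop E q ^^ Suc n) (indicator {z}) x * f z \<partial>count_space E)"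
    by (subst kop_nn_integral) (simp add: kop_cmult mult.commute[of _ "f _"])
  finally show ?case .
qed

section \<open>Superharmonic functions and potentials\<close>

lemma superharmonic_pow_le:
  assumes "\<And>x. x \<in> E \<Longrightarrow> kop E q f x \<le> f x" "x \<in> E"
  shows "(kop E q ^^ n) f x \<le> f x"
  using assms(2)
proof (induction n arbitrary: x)
  case (Suc n)
  have "(kop E q ^^ Suc n) f x \<le> kop E q f x"
    using Suc by (auto intro!: kop_mono)
  then show ?case using assms(1)[OF Suc.prems] by simp
qed auto

lemma harmonic_pow:
  assumes "\<And>x. x \<in> E \<Longrightarrow> kop E q f x = f x" "x \<in> E"
  shows "(kop E q ^^ n) f x = f x"
  using assms(2)
proof (induction n arbitrary: x)
  case (Suc n)
  have "(kop E q ^^ Suc n) f x = kop E q f x"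
    using Suc by (auto intro!: kop_cong)
  then show ?case using assms(1)[OF Suc.prems] by simp
qed auto

lemma superharmonic_decseq:
  assumes "\<And>x. x \<in> E \<Longrightarrow> kop E q f x \<le> f x" "x \<in> E"
  shows "decseq (\<lambda>n. (kop E q ^^ n) f x)"
  unfolding decseq_Suc_iff pow_Suc_right using assms by (auto intro!: pow_mono)

text \<open>Iterating the equation N times separates the potential of \<open>g\<close> from a
  remainder that becomes harmonic in the limit.\<close>

lemma potential_decomp:
  assumes "\<And>x. x \<in> E \<Longrightarrow> f x = g x + kop E q f x" "x \<in> E"
  shows "f x = (\<Sum>n<N. (kop E q ^^ n) g x) + (kop E q ^^ N) f x"
proof (induction N)
  case (Suc N)
  have "(kop E q ^^ N) f x = (kop E q ^^ N) (\<lambda>x. g x + kop E q f x) x"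
    using assms by (intro pow_cong) auto
  then show ?case using Suc by (simp add: pow_add pow_Suc_right add.assoc del: funpow.simps)
qed simp

text \<open>Every supersolution dominates the potential of \<open>g\<close>: iterate and discard the
  nonnegative remainder.\<close>

lemma potential_le:
  assumes "\<And>x. x \<in> E \<Longrightarrow> g x + kop E q f x \<le> f x" "x \<in> E"
  shows "(\<Sum>n. (kop E q ^^ n) g x) \<le> f x"
proof (rule suminf_le_const)
  have "(\<Sum>n<N. (kop E q ^^ n) g x) + (kop E q ^^ N) f x \<le> f x" for N
  proof (induction N)
    case (Suc N)
    have "(kop E q ^^ N) (\<lambda>x. g x + kop E q f x) x \<le> (kop E q ^^ N) f x"
      using assms by (intro pow_mono) auto
    with Suc show ?case
      by (simp add: pow_add pow_Suc_right add.assoc del: funpow.simps)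
         (meson add_left_mono order_trans)
  qed simp
  then show "(\<Sum>n<N. (kop E q ^^ n) g x) \<le> f x" for N
    using order_trans[OF add_increasing2[OF zero_le order_refl]] by blast
qed (rule summableI)

section \<open>Path functionals of a killed chain\<close>

abbreviation paths :: "(nat \<Rightarrow> 's) measure" where
  "paths \<equiv> \<Pi>\<^sub>M n\<in>UNIV. count_space UNIV"

lemma sets_path_measure [measurable_cong]: "sets (path_measure K s) = sets paths"
  unfolding path_measure_def by simp

lemma space_path_measure [simp]: "space (path_measure K s) = UNIV"
  unfolding path_measure_def by (simp add: space_PiM)

lemma measurable_case_nat_paths [measurable]:
  "case_nat s \<in> (paths :: (nat \<Rightarrow> 's) measure) \<rightarrow>\<^sub>M paths"
proof (rule measurable_PiM_single')
  fix n :: nat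
  show "(\<lambda>Z. case_nat s Z n) \<in> (paths :: (nat \<Rightarrow> 's) measure) \<rightarrow>\<^sub>M count_space UNIV"
    by (cases n) auto
qed simp

lemma measurable_shift_paths:
  "(\<lambda>Z k. Z (n + k)) \<in> (paths :: (nat \<Rightarrow> 's) measure) \<rightarrow>\<^sub>M paths"
  by (rule measurable_PiM_single') simp_all

text \<open>After one Markov step the integrands are evaluated only at paths
  \<open>case_nat s Z\<close>, so what they do elsewhere is irrelevant.\<close>

lemma nn_integral_path_initial:
  fixes K :: "'s::countable \<Rightarrow> 's pmf"
  assumes [measurable]: "F \<in> borel_measurable paths" "G \<in> borel_measurable paths"
    and eq: "\<And>Z. Z 0 = s \<Longrightarrow> F Z = G Z"
  shows "(\<integral>\<^sup>+Z. F Z \<partial>path_measure K s) = (\<integral>\<^sup>+Z. G Z \<partial>path_measure K s)"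
  by (subst (1 2) nn_integral_path_measure) (simp_all add: eq)

lemma nn_integral_path_const:
  fixes K :: "'s::countable \<Rightarrow> 's pmf"
  assumes [measurable]: "F \<in> borel_measurable paths" and eq: "\<And>Z. Z 0 = s \<Longrightarrow> F Z = c"
  shows "(\<integral>\<^sup>+Z. F Z \<partial>path_measure K s) = c"
proof -
  interpret prob_space "path_measure K s" by (rule prob_space_path_measure)
  have "(\<integral>\<^sup>+Z. F Z \<partial>path_measure K s) = (\<integral>\<^sup>+Z. c \<partial>path_measure K s)"
    by (intro nn_integral_path_initial) (auto simp: eq)
  then show ?thesis using emeasure_space_1 by simp
qed

text \<open>The condition \<open>G None = 0\<close> is the extension by zero at the cemetery; the
  row bound makes \<open>embed_pmf\<close> produce the intended masses.\<close>

lemma nn_integral_killed_kernel: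
  assumes x: "x \<in> E" and row: "kop E q (\<lambda>_. 1) x \<le> 1" and G: "G None = 0"
  shows "(\<integral>\<^sup>+b. G b \<partial>measure_pmf (killed_kernel E q (Some x))) = kop E q (\<lambda>y. G (Some y)) x"
proof -
  have row': "(\<integral>\<^sup>+y. q x y \<partial>count_space E) \<le> 1"
    using row by (simp add: kop_def)
  have fin: "q x y < \<top>" if "y \<in> E" for y
    using nn_integral_ge_point[OF that, of "q x"] row'
    by (meson ennreal_one_less_top order.strict_trans1 order_trans)
  have bij: "bij_betw Some UNIV (range Some :: 'a option set)"
    by (auto simp: bij_betw_def)
  let ?k = "killed_kernel E q (Some x)"
  have "(\<integral>\<^sup>+b. G b \<partial>measure_pmf ?k) = (\<integral>\<^sup>+b. ennreal (pmf ?k b) * G b * indicator (range Some) b \<partial>count_space UNIV)"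
    unfolding nn_integral_measure_pmf
  proof (intro nn_integral_cong)
    fix b show "ennreal (pmf ?k b) * G b = ennreal (pmf ?k b) * G b * indicator (range Some) b"
      by (cases b) (auto simp: G)
  qed
  also have "\<dots> = (\<integral>\<^sup>+b. ennreal (pmf ?k b) * G b \<partial>count_space (range Some))"
    by (rule nn_integral_count_space_indicator[symmetric]) simp
  also have "\<dots> = (\<integral>\<^sup>+y. ennreal (pmf ?k (Some y)) * G (Some y) \<partial>count_space UNIV)"
    by (rule nn_integral_bij_count_space[OF bij, symmetric])
  also have "\<dots> = (\<integral>\<^sup>+y. q x y * G (Some y) * indicator E y \<partial>count_space UNIV)"
    by (intro nn_integral_cong)
       (use fin in \<open>auto simp: pmf_killed_kernel[where E = E and q = q and x = x, OF x row'] indicator_def ennreal_enn2real\<close>)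
  also have "\<dots> = kop E q (\<lambda>y. G (Some y)) x"
    unfolding kop_def by (rule nn_integral_count_space_indicator[symmetric]) simp
  finally show ?thesis .
qed

locale substochastic =
  fixes E :: "'s::countable set" and q :: "'s \<Rightarrow> 's \<Rightarrow> ennreal"
  assumes row: "\<And>x. x \<in> E \<Longrightarrow> kop E q (\<lambda>_. 1) x \<le> 1"
begin

abbreviation law :: "'s option \<Rightarrow> (nat \<Rightarrow> 's option) measure" where
  "law \<equiv> path_measure (killed_kernel E q)"

lemma law_None:
  assumes [measurable]: "F \<in> borel_measurable paths"
  shows "(\<integral>\<^sup>+Z. F Z \<partial>law None) = (\<integral>\<^sup>+Z. F (case_nat None Z) \<partial>law None)"
  by (subst nn_integral_path_measure)
     (simp_all add: killed_kernel_def)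

lemma law_Some:
  assumes [measurable]: "F \<in> borel_measurable paths" and x: "x \<in> E"
    and None: "(\<integral>\<^sup>+Z. F (case_nat (Some x) Z) \<partial>law None) = 0"
  shows "(\<integral>\<^sup>+Z. F Z \<partial>law (Some x)) = kop E q (\<lambda>y. \<integral>\<^sup>+Z. F (case_nat (Some x) Z) \<partial>law (Some y)) x"
  by (subst nn_integral_path_measure) (auto intro!: nn_integral_killed_kernel x row None)

lemma nn_integral_law_at:
  fixes f :: "'s \<Rightarrow> ennreal"
  defines "F \<equiv> \<lambda>a. case a of None \<Rightarrow> 0 | Some y \<Rightarrow> f y"
  shows "x \<in> E \<Longrightarrow> (\<integral>\<^sup>+Z. F (Z n) \<partial>law (Some x)) = (kop E q ^^ n) f x"
    and "(\<integral>\<^sup>+Z. F (Z n) \<partial>law None) = 0"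
proof -
  have None: "(\<integral>\<^sup>+Z. F (Z n) \<partial>law None) = 0" for n
  proof (induction n)
    case 0
    show ?case by (rule nn_integral_path_const) (auto simp: F_def)
  next
    case (Suc n)
    then show ?case by (subst law_None) auto
  qed
  show "(\<integral>\<^sup>+Z. F (Z n) \<partial>law None) = 0" by (rule None)
  show "x \<in> E \<Longrightarrow> (\<integral>\<^sup>+Z. F (Z n) \<partial>law (Some x)) = (kop E q ^^ n) f x"
  proof (induction n arbitrary: x)
    case 0
    show ?case by (rule nn_integral_path_const) (auto simp: F_def)
  next
    case (Suc n)
    then show ?case by (subst law_Some) (auto simp: None intro!: kop_cong)
  qed
qed

lemma nn_integral_law_survival:
  assumes x: "x \<in> E"
  shows "(\<integral>\<^sup>+Z. indicator {Z. \<forall>m\<in>{1..n}. Z m \<noteq> None} Z \<partial>law (Some x)) = (kop E q ^^ n) (\<lambda>_. 1) x"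
proof -
  \<comment> \<open>Testing time 0 as well makes the one-step recursion exact, and changes nothing
    for paths that start in \<open>Some x\<close>.\<close>
  define F :: "nat \<Rightarrow> (nat \<Rightarrow> 's option) \<Rightarrow> ennreal" where
    "F n Z = (if \<forall>m\<le>n. Z m \<noteq> None then 1 else 0)" for n Z
  have [measurable]: "F n \<in> borel_measurable paths" for n
    unfolding F_def by measurable
  have F_Suc: "F (Suc n) (case_nat a Z) = (if a = None then 0 else F n Z)" for n a Z
    by (auto simp: F_def All_less_Suc2 simp flip: less_Suc_eq_le)
  have None: "(\<integral>\<^sup>+Z. F n Z \<partial>law None) = 0" for n
    by (rule nn_integral_path_const) (auto simp: F_def)
  have *: "x \<in> E \<Longrightarrow> (\<integral>\<^sup>+Z. F n Z \<partial>law (Some x)) = (kop E q ^^ n) (\<lambda>_. 1) x" for n x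
  proof (induction n arbitrary: x)
    case 0
    show ?case by (rule nn_integral_path_const) (auto simp: F_def)
  next
    case (Suc n)
    then show ?case by (subst law_Some) (auto simp: F_Suc None intro!: kop_cong)
  qed
  have "(\<integral>\<^sup>+Z. indicator {Z. \<forall>m\<in>{1..n}. Z m \<noteq> None} Z \<partial>law (Some x)) = (\<integral>\<^sup>+Z. F n Z \<partial>law (Some x))"
  proof (rule nn_integral_path_initial)
    show "(\<lambda>Z. indicator {Z. \<forall>m\<in>{1..n}. Z m \<noteq> None} Z) \<in> borel_measurable (paths :: (nat \<Rightarrow> 's option) measure)"
      unfolding indicator_def by measurable
    fix Z :: "nat \<Rightarrow> 's option" assume "Z 0 = Some x"
    then have "(\<forall>m\<in>{1..n}. Z m \<noteq> None) \<longleftrightarrow> (\<forall>m\<le>n. Z m \<noteq> None)"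
      by (metis atLeastAtMost_iff less_one not_le option.distinct(1))
    then show "indicator {Z. \<forall>m\<in>{1..n}. Z m \<noteq> None} Z = F n Z"
      by (auto simp: F_def indicator_def)
  qed simp
  with * x show ?thesis by simp
qed

end

section \<open>First passage times and restarted paths\<close>

lemma enat_less_first_after_iff:
  "enat n < first_after m P \<longleftrightarrow> (\<forall>k\<in>{m<..n}. \<not> P k)"
proof -
  have "enat n < first_after m P \<longleftrightarrow> (\<forall>k. k > m \<and> P k \<longrightarrow> n < k)"
  proof
    assume *: "\<forall>k. k > m \<and> P k \<longrightarrow> n < k"
    then have "enat (Suc n) \<le> first_after m P"
      unfolding first_after_def by (intro Inf_greatest) (auto simp: Suc_le_eq)
    then show "enat n < first_after m P"
      by (metis Suc_ile_eq)
  next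
    assume *: "enat n < first_after m P"
    show "\<forall>k. k > m \<and> P k \<longrightarrow> n < k"
    proof (intro allI impI)
      fix k assume "m < k \<and> P k"
      then have "first_after m P \<le> enat k"
        unfolding first_after_def by (intro Inf_lower) auto
      with * have "enat n < enat k" by (rule less_le_trans)
      then show "n < k" by simp
    qed
  qed
  then show ?thesis by (auto simp: not_less[symmetric])
qed

lemma first_after_eq_enat_iff:
  "first_after m P = enat n \<longleftrightarrow> m < n \<and> P n \<and> (\<forall>k\<in>{m<..<n}. \<not> P k)"
proof -
  have *: "first_after m P = enat n \<longleftrightarrow> \<not> enat n < first_after m P \<and> (\<forall>k<n. enat k < first_after m P)"
  proof (cases "first_after m P")
    case (enat j)
    then show ?thesis by auto (meson linorder_neqE_nat less_irrefl)
  qed auto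
  show ?thesis
    unfolding * enat_less_first_after_iff
    by (auto simp: le_less)
qed

lemma first_after_eq_infinity_iff: "first_after m P = \<infinity> \<longleftrightarrow> (\<forall>k>m. \<not> P k)"
proof -
  have "first_after m P = \<infinity> \<longleftrightarrow> (\<forall>n. enat n < first_after m P)"
    by (cases "first_after m P") auto
  then show ?thesis
    unfolding enat_less_first_after_iff by (metis greaterThanAtMost_iff order_refl)
qed

text \<open>Tail-sum formula: it turns a mean lifetime into a sum of survival probabilities.\<close>

lemma ennreal_of_enat_suminf:
  "ennreal_of_enat T = (\<Sum>n. if enat n < T then 1 else 0)"
proof (cases T)
  case (enat m)
  have "(\<Sum>n. if enat n < T then 1 else 0 :: ennreal) = (\<Sum>n\<in>{..<m}. if enat n < T then 1 else 0)"
    by (rule suminf_finite) (auto simp: enat)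
  also have "\<dots> = of_nat m" by (simp add: enat)
  finally show ?thesis using enat by simp
next
  case infinity
  then show ?thesis by (simp add: nn_integral_count_space_nat[symmetric])
qed

context substochastic
begin

lemma nn_integral_absorption_time:
  assumes x: "x \<in> E"
  shows "(\<integral>\<^sup>+Z. ennreal_of_enat (absorption_time Z) \<partial>law (Some x)) = (\<Sum>n. (kop E q ^^ n) (\<lambda>_. 1) x)"
proof -
  have "ennreal_of_enat (absorption_time Z) = (\<Sum>n. indicator {Z. \<forall>m\<in>{1..n}. Z m \<noteq> None} Z)" for Z :: "nat \<Rightarrow> 's option"
    unfolding ennreal_of_enat_suminf absorption_time_def enat_less_first_after_iff
    by (intro suminf_cong) (auto simp: indicator_def Suc_le_eq)
  then have "(\<integral>\<^sup>+Z. ennreal_of_enat (absorption_time Z) \<partial>law (Some x))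
      = (\<integral>\<^sup>+Z. (\<Sum>n. indicator {Z. \<forall>m\<in>{1..n}. Z m \<noteq> None} Z) \<partial>law (Some x))"
    by simp
  also have "\<dots> = (\<Sum>n. \<integral>\<^sup>+Z. indicator {Z. \<forall>m\<in>{1..n}. Z m \<noteq> None} Z \<partial>law (Some x))"
  proof (rule nn_integral_suminf)
    fix n :: nat
    have "(\<lambda>Z. indicator {Z. \<forall>m\<in>{1..n}. Z m \<noteq> None} Z :: ennreal) \<in> borel_measurable (paths :: (nat \<Rightarrow> 's option) measure)"
      unfolding indicator_def by measurable
    then show "(\<lambda>Z. indicator {Z. \<forall>m\<in>{1..n}. Z m \<noteq> None} Z :: ennreal) \<in> borel_measurable (law (Some x))"
      by (simp add: measurable_cong_sets[OF sets_path_measure refl])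
  qed
  finally show ?thesis using x by (simp only: nn_integral_law_survival)
qed

end

text \<open>A functional of the path restarted at its exit from \<open>D\<close>. Time 0 is not
  inspected, so the path may begin anywhere.\<close>

definition at_exit :: "'s set \<Rightarrow> ((nat \<Rightarrow> 's option) \<Rightarrow> ennreal) \<Rightarrow> (nat \<Rightarrow> 's option) \<Rightarrow> ennreal" where
  "at_exit D \<Theta> Z = (case first_after 0 (\<lambda>n. Z n \<notin> Some ` D) of enat n \<Rightarrow> \<Theta> (\<lambda>k. Z (n + k)) | \<infinity> \<Rightarrow> 0)"

text \<open>Here time 0 is inspected, which gives a clean one-step recursion; the shift by one in
  \<open>at_exit_eq\<close> bridges the two conventions.\<close>

definition at_hit :: "'s set \<Rightarrow> ((nat \<Rightarrow> 's option) \<Rightarrow> ennreal) \<Rightarrow> nat \<Rightarrow> (nat \<Rightarrow> 's option) \<Rightarrow> ennreal" where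
  "at_hit D \<Theta> n Z = (if (\<forall>m<n. Z m \<in> Some ` D) \<and> Z n \<notin> Some ` D then \<Theta> (\<lambda>k. Z (n + k)) else 0)"

lemma measurable_at_hit [measurable]:
  fixes D :: "'s :: countable set"
  assumes "\<Theta> \<in> borel_measurable paths"
  shows "at_hit D \<Theta> n \<in> borel_measurable paths"
  unfolding at_hit_def
proof (rule measurable_If)
  show "(\<lambda>Z. \<Theta> (\<lambda>k. Z (n + k))) \<in> borel_measurable paths"
    by (rule measurable_compose[OF measurable_shift_paths assms])
  have [measurable]: "Measurable.pred (paths :: (nat \<Rightarrow> 's option) measure) (\<lambda>Z. Z m \<in> Some ` D)" for m
    by (rule measurable_compose[OF measurable_component_singleton]) auto
  show "{Z \<in> space paths. (\<forall>m<n. Z m \<in> Some ` D) \<and> Z n \<notin> Some ` D} \<in> sets (paths :: (nat \<Rightarrow> 's option) measure)"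
    by measurable
qed simp

lemma at_hit_0: "at_hit D \<Theta> 0 Z = (if Z 0 \<in> Some ` D then 0 else \<Theta> Z)"
  by (simp add: at_hit_def)

lemma at_hit_Suc:
  "at_hit D \<Theta> (Suc n) (case_nat (Some y) Z) = (if y \<in> D then at_hit D \<Theta> n Z else 0)"
  "at_hit D \<Theta> (Suc n) (case_nat None Z) = 0"
  by (auto simp: at_hit_def All_less_Suc2)

lemma at_exit_eq: "at_exit D \<Theta> Z = (\<Sum>n. at_hit D \<Theta> n (\<lambda>k. Z (Suc k)))"
proof -
  let ?T = "first_after 0 (\<lambda>n. Z n \<notin> Some ` D)"
  have *: "at_hit D \<Theta> n (\<lambda>k. Z (Suc k)) = (if ?T = enat (Suc n) then \<Theta> (\<lambda>k. Z (Suc n + k)) else 0)" for n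
  proof -
    have "{0<..<Suc n} = Suc ` {..<n}"
      by (auto simp: image_iff gr0_conv_Suc)
    then have "(\<forall>k\<in>{0<..<Suc n}. Z k \<in> Some ` D) \<longleftrightarrow> (\<forall>m<n. Z (Suc m) \<in> Some ` D)"
      by auto
    then show ?thesis
      by (auto simp: at_hit_def first_after_eq_enat_iff)
  qed
  show ?thesis
  proof (cases ?T)
    case infinity
    then show ?thesis unfolding * by (simp add: at_exit_def)
  next
    case (enat j)
    then obtain i where i: "j = Suc i"
      using first_after_eq_enat_iff[of 0 "\<lambda>n. Z n \<notin> Some ` D" j] by (cases j) auto
    have "(\<Sum>n. at_hit D \<Theta> n (\<lambda>k. Z (Suc k))) = (\<Sum>n. if n = i then \<Theta> (\<lambda>k. Z (Suc n + k)) else 0)"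
      unfolding * enat i by (intro suminf_cong) auto
    also have "\<dots> = \<Theta> (\<lambda>k. Z (Suc i + k))"
      using sums_single[of i "\<lambda>n. \<Theta> (\<lambda>k. Z (Suc n + k))"] by (simp add: sums_iff)
    finally show ?thesis by (simp add: at_exit_def enat i)
  qed
qed

lemma measurable_at_exit [measurable]:
  fixes D :: "'s :: countable set"
  assumes [measurable]: "\<Theta> \<in> borel_measurable paths"
  shows "at_exit D \<Theta> \<in> borel_measurable paths"
proof -
  have [measurable]: "(\<lambda>Z k. Z (Suc k)) \<in> (paths :: (nat \<Rightarrow> 's option) measure) \<rightarrow>\<^sub>M paths"
    using measurable_shift_paths[of 1] by simp
  show ?thesis
    unfolding at_exit_eq[abs_def] by measurable
qed

context substochastic
begin

text \<open>First-step recursion for the mean of \<open>f\<close> at the first position outside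
  \<open>D\<close>, on the event that this position is reached at time n.\<close>

definition stopped :: "'s set \<Rightarrow> ('s \<Rightarrow> ennreal) \<Rightarrow> nat \<Rightarrow> 's \<Rightarrow> ennreal" where
  "stopped D f n = ((\<lambda>\<psi> y. if y \<in> D then kop E q \<psi> y else 0) ^^ n) (\<lambda>y. if y \<in> D then 0 else f y)"

lemma nn_integral_at_hit:
  assumes [measurable]: "\<Theta> \<in> borel_measurable paths"
    and None: "(\<integral>\<^sup>+Z. \<Theta> Z \<partial>law None) = 0"
  shows "y \<in> E \<Longrightarrow> (\<integral>\<^sup>+Z. at_hit D \<Theta> n Z \<partial>law (Some y)) = stopped D (\<lambda>y. \<integral>\<^sup>+Z. \<Theta> Z \<partial>law (Some y)) n y"
    and "(\<integral>\<^sup>+Z. at_hit D \<Theta> n Z \<partial>law None) = 0"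
proof -
  have init: "(\<integral>\<^sup>+Z. at_hit D \<Theta> 0 Z \<partial>law a) = (if a \<in> Some ` D then 0 else \<integral>\<^sup>+Z. \<Theta> Z \<partial>law a)" for a
  proof (cases "a \<in> Some ` D")
    case True
    then have "(\<integral>\<^sup>+Z. at_hit D \<Theta> 0 Z \<partial>law a) = 0"
      by (intro nn_integral_path_const) (auto simp: at_hit_0)
    with True show ?thesis by simp
  next
    case False
    then have "(\<integral>\<^sup>+Z. at_hit D \<Theta> 0 Z \<partial>law a) = (\<integral>\<^sup>+Z. \<Theta> Z \<partial>law a)"
      by (intro nn_integral_path_initial) (auto simp: at_hit_0)
    with False show ?thesis by simp
  qed
  have N: "(\<integral>\<^sup>+Z. at_hit D \<Theta> n Z \<partial>law None) = 0" for n
  proof (cases n)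
    case 0
    then show ?thesis by (simp add: init None image_iff)
  next
    case (Suc n)
    then show ?thesis by (subst law_None) (auto simp: at_hit_Suc image_iff)
  qed
  show "(\<integral>\<^sup>+Z. at_hit D \<Theta> n Z \<partial>law None) = 0" by (rule N)
  show "y \<in> E \<Longrightarrow> (\<integral>\<^sup>+Z. at_hit D \<Theta> n Z \<partial>law (Some y)) = stopped D (\<lambda>y. \<integral>\<^sup>+Z. \<Theta> Z \<partial>law (Some y)) n y"
  proof (induction n arbitrary: y)
    case 0
    show ?case by (auto simp: init stopped_def)
  next
    case (Suc n)
    then show ?case
      by (cases "y \<in> D"; subst law_Some) (auto simp: at_hit_Suc N stopped_def intro!: kop_cong)
  qed
qed

text \<open>Strong Markov property at the exit: \<Theta> enters only through its mean after the
  restart, and a restart at the cemetery contributes nothing. The outer \<open>kop\<close> is the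
  first step, taken from a starting point that is not tested.\<close>

lemma nn_integral_at_exit:
  assumes [measurable]: "\<Theta> \<in> borel_measurable paths"
    and None: "(\<integral>\<^sup>+Z. \<Theta> Z \<partial>law None) = 0" and x: "x \<in> E"
  shows "(\<integral>\<^sup>+Z. at_exit D \<Theta> Z \<partial>law (Some x)) = (\<Sum>n. kop E q (stopped D (\<lambda>y. \<integral>\<^sup>+Z. \<Theta> Z \<partial>law (Some y)) n) x)"
proof -
  have *: "at_exit D \<Theta> (case_nat a Z) = (\<Sum>n. at_hit D \<Theta> n Z)" for a Z
    by (simp add: at_exit_eq)
  have "(\<integral>\<^sup>+Z. at_exit D \<Theta> Z \<partial>law (Some x)) = kop E q (\<lambda>y. \<Sum>n. \<integral>\<^sup>+Z. at_hit D \<Theta> n Z \<partial>law (Some y)) x"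
    using x by (subst law_Some) (auto simp: * nn_integral_suminf nn_integral_at_hit None intro!: kop_cong)
  also have "\<dots> = kop E q (\<lambda>y. \<Sum>n. stopped D (\<lambda>y. \<integral>\<^sup>+Z. \<Theta> Z \<partial>law (Some y)) n y) x"
    by (intro kop_cong) (simp add: nn_integral_at_hit None)
  finally show ?thesis by (simp add: kop_suminf)
qed

end

section \<open>Ladder times and the shift on paths\<close>

lemma first_after_shift: "first_after (m + k) P = enat m + first_after k (\<lambda>n. P (m + n))"
proof (cases "first_after k (\<lambda>n. P (m + n))")
  case (enat j)
  then have *: "k < j" "P (m + j)" "\<forall>i\<in>{k<..<j}. \<not> P (m + i)"
    by (auto simp: first_after_eq_enat_iff)
  have "\<not> P i" if "m + k < i" "i < m + j" for i
  proof -
    have "i - m \<in> {k<..<j}" "m + (i - m) = i" using that by auto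
    with *(3) show ?thesis by metis
  qed
  with * have "first_after (m + k) P = enat (m + j)"
    by (auto simp: first_after_eq_enat_iff)
  with enat show ?thesis by simp
next
  case infinity
  have "\<not> P i" if "m + k < i" for i
    using infinity[unfolded first_after_eq_infinity_iff, rule_format, of "i - m"] that by simp
  then have "first_after (m + k) P = \<infinity>"
    by (auto simp: first_after_eq_infinity_iff)
  with infinity show ?thesis by simp
qed

lemma value_at_shift: "value_at h X (enat m + T) = value_at h (\<lambda>k. X (m + k)) T"
  by (cases T) (auto simp: value_at_def)

lemma ladder_time_None: "X 0 = None \<Longrightarrow> ladder_time E X (Suc n) = \<infinity>"
  by (induction n) (auto simp: zero_enat_def)

text \<open>The definition peels off the last ladder epoch, whereas the Markov property needs the
  first one peeled off.\<close>

lemma ladder_time_Suc_shift: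
  assumes "X 0 = Some x" "first_after 0 (\<lambda>n. X n \<notin> Some ` translate E x) = T"
  shows "ladder_time E X (Suc n) = (case T of enat m \<Rightarrow> enat m + ladder_time E (\<lambda>k. X (m + k)) n | \<infinity> \<Rightarrow> \<infinity>)"
proof (cases T)
  case (enat m)
  have "ladder_time E X (Suc n) = enat m + ladder_time E (\<lambda>k. X (m + k)) n"
  proof (induction n)
    case 0
    then show ?case using assms enat by (simp add: zero_enat_def)
  next
    case (Suc n)
    show ?case
      by (subst ladder_time.simps(2), subst Suc)
         (auto split: enat.split option.split simp: first_after_shift)
  qed
  with enat show ?thesis by simp
next
  case infinity
  have "ladder_time E X (Suc n) = \<infinity>"
    by (induction n) (use infinity assms in \<open>auto simp: zero_enat_def\<close>)
  with infinity show ?thesis by simp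
qed

definition ladder_value :: "(int ^ 'd) set \<Rightarrow> (int ^ 'd \<Rightarrow> real) \<Rightarrow> nat \<Rightarrow> (nat \<Rightarrow> (int ^ 'd) option) \<Rightarrow> ennreal" where
  "ladder_value E h n X = value_at h X (ladder_time E X n)"

lemma ladder_value_0: "ladder_value E h 0 X = (case X 0 of None \<Rightarrow> 0 | Some x \<Rightarrow> ennreal (h x))"
  by (simp add: ladder_value_def value_at_def zero_enat_def)

lemma ladder_value_None: "X 0 = None \<Longrightarrow> ladder_value E h n X = 0"
  by (cases n) (simp_all add: ladder_value_0, simp add: ladder_value_def ladder_time_None value_at_def del: ladder_time.simps)

lemma ladder_value_Suc:
  assumes "X 0 = Some x"
  shows "ladder_value E h (Suc n) X = at_exit (translate E x) (ladder_value E h n) X"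
  unfolding ladder_value_def at_exit_def
  by (subst ladder_time_Suc_shift[where E = E and X = X and x = x, OF assms refl])
     (auto split: enat.split simp: value_at_shift, simp add: value_at_def)

lemma measurable_ladder_value [measurable]:
  fixes E :: "(int ^ 'd) set"
  shows "ladder_value E h n \<in> borel_measurable paths"
proof (induction n)
  case 0
  have [measurable]: "(\<lambda>a. case a of None \<Rightarrow> 0 | Some x \<Rightarrow> ennreal (h x)) \<in> borel_measurable (count_space UNIV)"
    by simp
  show ?case unfolding ladder_value_0[abs_def] by measurable
next
  case (Suc n)
  note [measurable] = this
  \<comment> \<open>The exit domain depends on the starting point, so measurability is checked for
    each of the countably many values of \<open>X 0\<close>.\<close>
  have eq: "ladder_value E h (Suc n) X
      = (case X 0 of None \<Rightarrow> 0 | Some x \<Rightarrow> at_exit (translate E x) (ladder_value E h n) X)" for X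
    by (cases "X 0") (simp_all add: ladder_value_None ladder_value_Suc)
  have "(\<lambda>X. case X 0 of None \<Rightarrow> 0 | Some x \<Rightarrow> at_exit (translate E x) (ladder_value E h n) X)
      \<in> borel_measurable (paths :: (nat \<Rightarrow> (int ^ 'd) option) measure)"
  proof (rule measurable_compose_countable[where g = "\<lambda>X. X 0" and
        f = "\<lambda>a X. case a of None \<Rightarrow> 0 | Some x \<Rightarrow> at_exit (translate E x) (ladder_value E h n) X"])
    fix a :: "(int ^ 'd) option"
    show "(\<lambda>X. case a of None \<Rightarrow> 0 | Some x \<Rightarrow> at_exit (translate E x) (ladder_value E h n) X)
        \<in> borel_measurable paths"
      by (cases a) auto
  qed measurable
  then show ?case unfolding eq[abs_def] by simp
qed

section \<open>The killed walk and its ladder process\<close>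

lemma walk_row_le: "kop E (walk_trans \<mu>) (\<lambda>_. 1) x \<le> 1"
proof -
  have "kop E (walk_trans \<mu>) (\<lambda>_. 1) x = (\<integral>\<^sup>+y. ennreal (pmf \<mu> (y - x)) * indicator E y \<partial>count_space UNIV)"
    by (simp add: kop_def walk_trans_def nn_integral_count_space_indicator)
  also have "\<dots> \<le> (\<integral>\<^sup>+y. ennreal (pmf \<mu> (y - x)) \<partial>count_space UNIV)"
    by (intro nn_integral_mono) (auto simp: indicator_def)
  also have "\<dots> = (\<integral>\<^sup>+y. ennreal (pmf \<mu> y) \<partial>count_space UNIV)"
    by (rule nn_integral_bij_count_space) (auto intro!: bij_betwI[where g = "\<lambda>y. y + x"])
  also have "\<dots> = 1"
    by (simp add: nn_integral_pmf)
  finally show ?thesis .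
qed

text \<open>In a submonoid, E + u is a copy of \<open>E\<close> inside \<open>E\<close>; the shift
  arguments rest on this.\<close>

locale semigroup_walk =
  fixes E :: "(int ^ 'd) set" and \<mu> :: "(int ^ 'd) pmf"
  assumes zero_mem [simp, intro]: "0 \<in> E"
    and add_mem [simp, intro]: "\<And>x y. x \<in> E \<Longrightarrow> y \<in> E \<Longrightarrow> x + y \<in> E"
begin

sublocale substochastic E "walk_trans \<mu>"
  by unfold_locales (rule walk_row_le)

abbreviation P :: "(int ^ 'd \<Rightarrow> ennreal) \<Rightarrow> int ^ 'd \<Rightarrow> ennreal" where
  "P \<equiv> kop E (walk_trans \<mu>)"

abbreviation PH :: "(int ^ 'd \<Rightarrow> ennreal) \<Rightarrow> int ^ 'd \<Rightarrow> ennreal" where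
  "PH \<equiv> kop E (ladder_trans E \<mu>)"

text \<open>Weight of one step from z + u that leaves E + u but stays in \<open>E\<close>.
  Coordinates are shifted by u so that the walk inside E + u becomes the killed walk on
  \<open>E\<close>.\<close>

definition outflow :: "int ^ 'd \<Rightarrow> (int ^ 'd \<Rightarrow> ennreal) \<Rightarrow> int ^ 'd \<Rightarrow> ennreal" where
  "outflow u f z = P (\<lambda>y. if y \<in> translate E u then 0 else f y) (z + u)"

lemma translate_subset: "u \<in> E \<Longrightarrow> translate E u \<subseteq> E"
  by (auto simp: translate_def)

lemma kop_translate:
  assumes u: "u \<in> E"
  shows "P (\<lambda>y. if y \<in> translate E u then f y else 0) (z + u) = P (\<lambda>y. f (y + u)) z"
proof -
  have "P (\<lambda>y. if y \<in> translate E u then f y else 0) (z + u)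
      = (\<integral>\<^sup>+y. ennreal (pmf \<mu> (y - (z + u))) * f y * indicator (translate E u) y \<partial>count_space E)"
    unfolding kop_def walk_trans_def by (intro nn_integral_cong) auto
  also have "\<dots> = (\<integral>\<^sup>+y. ennreal (pmf \<mu> (y - (z + u))) * f y * indicator (translate E u) y \<partial>count_space UNIV)"
    using translate_subset[OF u]
    by (subst nn_integral_count_space_indicator[of E]) (auto intro!: nn_integral_cong simp: indicator_def)
  also have "\<dots> = (\<integral>\<^sup>+y. ennreal (pmf \<mu> (y - (z + u))) * f y \<partial>count_space (translate E u))"
    by (rule nn_integral_count_space_indicator[symmetric]) simp
  also have "\<dots> = (\<integral>\<^sup>+y. ennreal (pmf \<mu> ((y + u) - (z + u))) * f (y + u) \<partial>count_space E)"
    by (rule nn_integral_bij_count_space[symmetric]) (auto simp: translate_def bij_betw_def inj_on_def)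
  also have "\<dots> = P (\<lambda>y. f (y + u)) z"
    by (simp add: kop_def walk_trans_def)
  finally show ?thesis .
qed

text \<open>By translation invariance, a step from z + u that stays in E + u is a step on
  \<open>E\<close> from z; the others form the outflow. The later shift recursions start from this
  splitting.\<close>

lemma P_split:
  assumes u: "u \<in> E"
  shows "P f (z + u) = outflow u f z + P (\<lambda>y. f (y + u)) z"
proof -
  have "P f (z + u) = P (\<lambda>y. (if y \<in> translate E u then 0 else f y) + (if y \<in> translate E u then f y else 0)) (z + u)"
    by (intro kop_cong) auto
  then show ?thesis
    by (simp add: kop_add outflow_def kop_translate[OF u])
qed

text \<open>Translating a path by u keeps it inside \<open>E\<close>, while the walk from z + u may
  have further paths at its disposal.\<close>

lemma P_pow_shift_le:
  assumes u: "u \<in> E" and z: "z \<in> E"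
  shows "(P ^^ n) (\<lambda>y. f (y + u)) z \<le> (P ^^ n) f (z + u)"
  using z
proof (induction n arbitrary: z)
  case (Suc n)
  have "(P ^^ Suc n) (\<lambda>y. f (y + u)) z \<le> P (\<lambda>y. (P ^^ n) f (y + u)) z"
    using Suc by (auto intro!: kop_mono)
  also have "\<dots> \<le> (P ^^ Suc n) f (z + u)"
    by (simp add: P_split[OF u])
  finally show ?case .
qed simp

lemma green_eq:
  assumes x: "x \<in> E"
  shows "green E \<mu> x y = (\<Sum>n. (P ^^ n) (indicator {y}) x)"
  unfolding green_def
proof (rule suminf_cong)
  fix n
  have "(\<lambda>X. X n) \<in> law (Some x) \<rightarrow>\<^sub>M count_space UNIV"
    unfolding measurable_cong_sets[OF sets_path_measure refl] by measurable
  then have [measurable]: "{X \<in> space (law (Some x)). X n = Some y} \<in> sets (law (Some x))"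
    by (rule measurable_sets_Collect) auto
  have "emeasure (walk_law E \<mu> x) {X \<in> space (walk_law E \<mu> x). X n = Some y}
      = (\<integral>\<^sup>+X. indicator {X \<in> space (law (Some x)). X n = Some y} X \<partial>law (Some x))"
    unfolding walk_law_def by (rule nn_integral_indicator[symmetric]) measurable
  also have "\<dots> = (\<integral>\<^sup>+X. (case X n of None \<Rightarrow> 0 | Some z \<Rightarrow> indicator {y} z) \<partial>law (Some x))"
    by (intro nn_integral_cong) (auto split: option.split simp: indicator_def)
  finally show "emeasure (walk_law E \<mu> x) {X \<in> space (walk_law E \<mu> x). X n = Some y} = (P ^^ n) (indicator {y}) x"
    using nn_integral_law_at(1)[OF x] by simp
qed

lemma mean_killing_time_eq: "x \<in> E \<Longrightarrow> mean_killing_time E \<mu> x = (\<Sum>n. (P ^^ n) (\<lambda>_. 1) x)"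
  unfolding mean_killing_time_def walk_law_def by (rule nn_integral_absorption_time)

text \<open>\<open>green E \<mu> 0 z\<close> counts the visits to z + u before leaving E + u of the
  walk from u, so z + u is the last position before the exit. Summing over time instead gives the
  potential of the outflow.\<close>

lemma PH_eq: "PH f u = (\<Sum>n. (P ^^ n) (outflow u f) 0)"
proof -
  have "PH f u = (\<integral>\<^sup>+y. \<integral>\<^sup>+z. green E \<mu> 0 z * (ladder_jump E \<mu> u z y * f y) \<partial>count_space E \<partial>count_space E)"
    unfolding kop_def ladder_trans_def
    by (intro nn_integral_cong) (simp add: nn_integral_multc[symmetric] mult.assoc)
  also have "\<dots> = kop E (\<lambda>_ _. 1) (\<lambda>y. \<integral>\<^sup>+z. green E \<mu> 0 z * (ladder_jump E \<mu> u z y * f y) \<partial>count_space E) 0"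
    by (simp add: kop_def)
  also have "\<dots> = (\<integral>\<^sup>+z. \<integral>\<^sup>+y. green E \<mu> 0 z * (ladder_jump E \<mu> u z y * f y) \<partial>count_space E \<partial>count_space E)"
    by (subst kop_nn_integral) (simp add: kop_def)
  also have "\<dots> = (\<integral>\<^sup>+z. green E \<mu> 0 z * outflow u f z \<partial>count_space E)"
    unfolding outflow_def kop_def
    by (intro nn_integral_cong)
       (auto simp: nn_integral_cmult ladder_jump_def walk_trans_def diff_diff_eq
          intro!: arg_cong[where f = "\<lambda>x. _ * x"] nn_integral_cong)
  also have "\<dots> = (\<integral>\<^sup>+z. (\<Sum>n. (P ^^ n) (indicator {z}) 0 * outflow u f z) \<partial>count_space E)"
    by (simp add: green_eq)
  also have "\<dots> = (\<Sum>n. \<integral>\<^sup>+z. (P ^^ n) (indicator {z}) 0 * outflow u f z \<partial>count_space E)"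
    by (rule nn_integral_suminf) simp
  also have "\<dots> = (\<Sum>n. (P ^^ n) (outflow u f) 0)"
    by (simp add: pow_expand[symmetric])
  finally show ?thesis .
qed

lemma ladder_op_eq: "ladder_op E \<mu> f = PH (\<lambda>y. ennreal (f y))"
  by (auto simp: ladder_op_def kop_def)

text \<open>The walk from z + u inside E + u is the walk on \<open>E\<close> from z. The extra
  \<open>P\<close> is the forced first step of a strictly positive exit time.\<close>

lemma P_stopped:
  assumes u: "u \<in> E" and z: "z \<in> E"
  shows "P (stopped (translate E u) f n) (z + u) = (P ^^ n) (outflow u f) z"
  using z
proof (induction n arbitrary: z)
  case 0
  show ?case by (simp add: stopped_def outflow_def)
next
  case (Suc n)
  have "P (stopped (translate E u) f (Suc n)) (z + u)
      = P (\<lambda>y. if y \<in> translate E u then P (stopped (translate E u) f n) y else 0) (z + u)"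
    unfolding stopped_def by simp
  also have "\<dots> = P (\<lambda>y. P (stopped (translate E u) f n) (y + u)) z"
    by (rule kop_translate[OF u])
  also have "\<dots> = P ((P ^^ n) (outflow u f)) z"
    by (intro kop_cong Suc.IH)
  finally show ?case by simp
qed

lemma nn_integral_exit:
  assumes "\<Theta> \<in> borel_measurable paths" "(\<integral>\<^sup>+Z. \<Theta> Z \<partial>law None) = 0"
    and u: "u \<in> E" and x: "x \<in> E"
  shows "(\<integral>\<^sup>+Z. at_exit (translate E u) \<Theta> Z \<partial>law (Some (x + u)))
       = (\<Sum>n. (P ^^ n) (outflow u (\<lambda>y. \<integral>\<^sup>+Z. \<Theta> Z \<partial>law (Some y))) x)"
  using assms by (simp add: nn_integral_at_exit P_stopped)

lemma outflow_cong: "(\<And>y. y \<in> E \<Longrightarrow> f y = g y) \<Longrightarrow> outflow u f z = outflow u g z"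
  unfolding outflow_def by (intro kop_cong) auto

lemma outflow_mono: "(\<And>y. y \<in> E \<Longrightarrow> f y \<le> g y) \<Longrightarrow> outflow u f z \<le> outflow u g z"
  unfolding outflow_def by (intro kop_mono) auto

text \<open>Restarting at each ladder epoch shows that the walk seen at ladder times moves according
  to \<open>PH\<close>.\<close>

lemma nn_integral_ladder_value:
  "x \<in> E \<Longrightarrow> (\<integral>\<^sup>+X. ladder_value E h n X \<partial>law (Some x)) = (PH ^^ n) (\<lambda>y. ennreal (h y)) x"
  "(\<integral>\<^sup>+X. ladder_value E h n X \<partial>law None) = 0"
proof -
  have None: "(\<integral>\<^sup>+X. ladder_value E h n X \<partial>law None) = 0" for n
    by (rule nn_integral_path_const) (auto simp: ladder_value_None)
  show "(\<integral>\<^sup>+X. ladder_value E h n X \<partial>law None) = 0" by (rule None)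
  show "x \<in> E \<Longrightarrow> (\<integral>\<^sup>+X. ladder_value E h n X \<partial>law (Some x)) = (PH ^^ n) (\<lambda>y. ennreal (h y)) x"
  proof (induction n arbitrary: x)
    case 0
    show ?case by (rule nn_integral_path_const) (auto simp: ladder_value_0)
  next
    case (Suc n)
    \<comment> \<open>With x as the shift and 0 as the starting point, the exit formula is exactly
      the series in \<open>PH_eq\<close>.\<close>
    have "(\<integral>\<^sup>+X. ladder_value E h (Suc n) X \<partial>law (Some x))
        = (\<integral>\<^sup>+X. at_exit (translate E x) (ladder_value E h n) X \<partial>law (Some (0 + x)))"
      by (subst add_0_left, rule nn_integral_path_initial) (auto simp: ladder_value_Suc)
    also have "\<dots> = PH (\<lambda>y. \<integral>\<^sup>+X. ladder_value E h n X \<partial>law (Some y)) x"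
      using Suc.prems by (subst nn_integral_exit) (auto simp: None PH_eq)
    also have "\<dots> = (PH ^^ Suc n) (\<lambda>y. ennreal (h y)) x"
      using Suc by (auto intro!: kop_cong)
    finally show ?case .
  qed
qed

lemma nn_integral_exit_time:
  assumes u: "u \<in> E" and x: "x \<in> E"
  shows "(\<integral>\<^sup>+X. value_at h X (exit_time E u X) \<partial>walk_law E \<mu> (x + u)) = (\<Sum>n. (P ^^ n) (outflow u (\<lambda>y. ennreal (h y))) x)"
proof -
  have "value_at h X (exit_time E u X) = at_exit (translate E u) (ladder_value E h 0) X" for X
    by (auto simp: at_exit_def value_at_def ladder_value_0 exit_time_def split: enat.split)
  then have "(\<integral>\<^sup>+X. value_at h X (exit_time E u X) \<partial>walk_law E \<mu> (x + u))
      = (\<Sum>n. (P ^^ n) (outflow u (\<lambda>y. \<integral>\<^sup>+Z. ladder_value E h 0 Z \<partial>law (Some y))) x)"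
    using assms by (simp add: walk_law_def nn_integral_exit nn_integral_ladder_value(2))
  also have "\<dots> = (\<Sum>n. (P ^^ n) (outflow u (\<lambda>y. ennreal (h y))) x)"
    using x by (intro suminf_cong pow_cong outflow_cong) (simp_all add: nn_integral_ladder_value)
  finally show ?thesis .
qed

lemma sub_shift:
  assumes u: "u \<in> E" and f: "\<And>x. x \<in> E \<Longrightarrow> P f x \<le> f x" and x: "x \<in> E"
  shows "outflow u f x + P (\<lambda>y. f (y + u)) x \<le> f (x + u)"
  using f[of "x + u"] u x by (simp add: P_split)

text \<open>\<open>PH f u\<close> is the potential at 0 of the outflow, and f(\<cdot> + u) is a
  supersolution with that source. The case f = 1 shows that the ladder kernel is
  substochastic.\<close>

lemma PH_superharmonic:
  assumes u: "u \<in> E" and f: "\<And>x. x \<in> E \<Longrightarrow> P f x \<le> f x"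
  shows "PH f u \<le> f u"
  unfolding PH_eq using potential_le[of E "outflow u f" "walk_trans \<mu>" "\<lambda>y. f (y + u)" 0] sub_shift[OF u f]
  by simp

sublocale ladder: substochastic E "ladder_trans E \<mu>"
  by unfold_locales (intro PH_superharmonic walk_row_le)

lemma ladder_V_eq: "x \<in> E \<Longrightarrow> ladder_V E \<mu> x = (\<Sum>n. (PH ^^ n) (\<lambda>_. 1) x)"
  unfolding ladder_V_def ladder_law_def by (rule ladder.nn_integral_absorption_time)

end

section \<open>Harmonic minorants of shifts\<close>

text \<open>
  The arrays \<open>m\<close> below are \<open>m i j = (T\<^sup>i S\<^sup>j f)(x)\<close> for positive operators with \<open>T + S = C\<close>. Since
  \<open>T\<^sup>N + s\<close> then has a positive inverse, the sign of \<open>(T\<^sup>N + s)(T\<^sup>N - s)\<close> determines that of \<open>T\<^sup>N - s\<close>.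
\<close>

lemma binary_moments_pow:
  fixes m :: "nat \<Rightarrow> nat \<Rightarrow> real"
  assumes rec: "\<And>i j. m (Suc i) j + m i (Suc j) = C * m i j"
  shows "C ^ N * m i j = m (i + N) j + (\<Sum>r<N. C ^ (N - Suc r) * m (i + r) (Suc j))"
proof (induction N)
  case (Suc N)
  have "C * (\<Sum>r<N. C ^ (N - Suc r) * m (i + r) (Suc j)) = (\<Sum>r<N. C ^ (N - r) * m (i + r) (Suc j))"
    unfolding sum_distrib_left
  proof (intro sum.cong refl)
    fix r assume "r \<in> {..<N}"
    then have "N - r = Suc (N - Suc r)" by auto
    then show "C * (C ^ (N - Suc r) * m (i + r) (Suc j)) = C ^ (N - r) * m (i + r) (Suc j)" by simp
  qed
  then have "C ^ Suc N * m i j = C * m (i + N) j + (\<Sum>r<N. C ^ (N - r) * m (i + r) (Suc j))"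
    using Suc by (simp add: algebra_simps)
  then show ?case using rec[of "i + N" j] by simp
qed simp

lemma binary_moments_root:
  fixes m :: "nat \<Rightarrow> nat \<Rightarrow> real"
  assumes rec: "\<And>i j. m (Suc i) j + m i (Suc j) = C * m i j" and nonneg: "\<And>i j. m i j \<ge> 0"
    and C: "C > 0" and s: "s > 0" and \<sigma>: "\<bar>\<sigma>\<bar> = 1"
    and sq: "\<And>i j. \<sigma> * (m (i + 2 * N) j - s\<^sup>2 * m i j) \<ge> 0"
  shows "\<sigma> * (m (i + N) j - s * m i j) \<ge> 0"
proof -
  define g where "g i j = \<sigma> * (m (i + N) j - s * m i j)" for i j
  \<comment> \<open>The operator \<open>C ^ N - T ^ N\<close> is positive and dominated by
    \<open>C ^ N\<close>, so \<open>T ^ N + s = (C ^ N + s) - (C ^ N - T ^ N)\<close> is inverted by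
    a Neumann series of ratio \<theta>.\<close>
  define \<theta> where "\<theta> = C ^ N / (C ^ N + s)"
  have CN: "C ^ N > 0" using C by simp
  have \<theta>: "0 \<le> \<theta>" "\<theta> < 1" using CN s by (auto simp: \<theta>_def)
  have g_rec: "g (Suc i) j + g i (Suc j) = C * g i j" for i j
    using rec[of i j] rec[of "i + N" j] unfolding g_def by simp (smt (verit) distrib_left mult.left_commute right_diff_distrib)
  have g_sq: "g (i + N) j + s * g i j \<ge> 0" for i j
  proof -
    have "i + 2 * N = i + N + N" by simp
    then show ?thesis
      using sq[of i j] by (simp only: g_def) (simp add: algebra_simps power2_eq_square)
  qed
  have m_le: "m (i + N) j \<le> C ^ N * m i j" for i j
  proof -
    have "(\<Sum>r<N. C ^ (N - Suc r) * m (i + r) (Suc j)) \<ge> 0"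
      using C nonneg by (intro sum_nonneg) auto
    then show ?thesis using binary_moments_pow[where m = m and C = C and N = N and i = i and j = j, OF rec] by simp
  qed
  \<comment> \<open>Each round of the Neumann iteration improves the lower bound on \<open>g\<close>
    by the factor \<theta>.\<close>
  have bound: "g i j \<ge> - ((C ^ N + s) * \<theta> ^ k * m i j)" for i j k
  proof (induction k arbitrary: i j)
    case 0
    have "\<bar>m (i + N) j - s * m i j\<bar> \<le> C ^ N * m i j + s * m i j"
      using m_le[of i j] nonneg[of "i + N" j] nonneg[of i j] s by (smt (verit) mult_nonneg_nonneg)
    moreover have "\<bar>g i j\<bar> = \<bar>m (i + N) j - s * m i j\<bar>"
      using \<sigma> by (simp add: g_def abs_mult)
    ultimately show ?case by (simp add: algebra_simps)
  next
    case (Suc k)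
    let ?B = "(C ^ N + s) * \<theta> ^ k"
    \<comment> \<open>The sum is \<open>C ^ N - T ^ N\<close> applied to \<open>g\<close>, written
      through S, so the induction hypothesis applies at \<open>Suc j\<close>.\<close>
    have "(C ^ N + s) * g i j = (g (i + N) j + s * g i j) + (\<Sum>r<N. C ^ (N - Suc r) * g (i + r) (Suc j))"
      using binary_moments_pow[where m = g and C = C and N = N and i = i and j = j, OF g_rec] by (simp add: algebra_simps)
    also have "\<dots> \<ge> 0 + (\<Sum>r<N. C ^ (N - Suc r) * - (?B * m (i + r) (Suc j)))"
      using C g_sq Suc.IH by (intro add_mono sum_mono mult_left_mono) auto
    also have "0 + (\<Sum>r<N. C ^ (N - Suc r) * - (?B * m (i + r) (Suc j)))
        = - ?B * (C ^ N * m i j - m (i + N) j)"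
      unfolding binary_moments_pow[where m = m and C = C and N = N and i = i and j = j, OF rec]
      by (simp add: sum_distrib_left sum_negf mult_ac)
    also have "\<dots> \<ge> - ?B * (C ^ N * m i j)"
      using nonneg CN s \<theta>(1) by (simp add: mult_left_mono)
    finally have *: "- ?B * (C ^ N * m i j) \<le> (C ^ N + s) * g i j" .
    have "(C ^ N + s) * - ((C ^ N + s) * \<theta> ^ Suc k * m i j) = - ?B * ((C ^ N + s) * \<theta>) * m i j"
      by simp
    also have "(C ^ N + s) * \<theta> = C ^ N"
      using CN s by (simp add: \<theta>_def)
    finally have "(C ^ N + s) * - ((C ^ N + s) * \<theta> ^ Suc k * m i j) \<le> (C ^ N + s) * g i j"
      using * by (simp only: mult.assoc)
    then show ?case
      using CN s by (simp only: mult_le_cancel_left_pos add_pos_pos)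
  qed
  have "(\<lambda>k. - ((C ^ N + s) * \<theta> ^ k * m i j)) \<longlonglongrightarrow> - ((C ^ N + s) * 0 * m i j)"
    using \<theta> by (intro tendsto_intros LIMSEQ_realpow_zero) auto
  then have "- ((C ^ N + s) * 0 * m i j) \<le> g i j"
    by (rule LIMSEQ_le_const2) (use bound in auto)
  then show ?thesis by (simp add: g_def)
qed

text \<open>Taking square roots k times descends from the power \<open>2 ^ k\<close> to the first
  power. The sign \<sigma> treats lower bounds (1) and upper bounds (-1) together.\<close>

lemma binary_moments_root_pow2:
  fixes m :: "nat \<Rightarrow> nat \<Rightarrow> real"
  assumes rec: "\<And>i j. m (Suc i) j + m i (Suc j) = C * m i j" and nonneg: "\<And>i j. m i j \<ge> 0"
    and C: "C > 0" and \<sigma>: "\<bar>\<sigma>\<bar> = 1"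
    and pow: "\<And>i j. \<sigma> * (m (i + 2 ^ k) j - exp (t * 2 ^ k) * m i j) \<ge> 0"
  shows "\<sigma> * (m (Suc i) j - exp t * m i j) \<ge> 0"
  using pow
proof (induction k arbitrary: i j)
  case 0
  from this[of i j] show ?case by simp
next
  case (Suc k)
  have "exp (t * 2 ^ Suc k) = (exp (t * 2 ^ k))\<^sup>2"
    by (simp add: exp_double[symmetric] mult_ac)
  then have "\<sigma> * (m (i + 2 ^ k) j - exp (t * 2 ^ k) * m i j) \<ge> 0" for i j
    using Suc.prems by (intro binary_moments_root[where m = m and C = C and s = "exp (t * 2 ^ k)" and \<sigma> = \<sigma>, OF rec nonneg C _ \<sigma>]) auto
  then show ?case by (rule Suc.IH)
qed

primrec nmul :: "nat \<Rightarrow> 'a::monoid_add \<Rightarrow> 'a" where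
  "nmul 0 u = 0"
| "nmul (Suc n) u = nmul n u + u"

lemma nmul_add: "nmul (m + n) u = nmul m u + nmul n u"
  by (induction n) (auto simp: add.assoc)

context semigroup_walk
begin

lemma nmul_mem [simp, intro]: "u \<in> E \<Longrightarrow> nmul n u \<in> E"
  by (induction n) auto

definition reach :: "ennreal \<Rightarrow> int ^ 'd \<Rightarrow> int ^ 'd \<Rightarrow> bool" where
  "reach c a b \<longleftrightarrow> (\<exists>n. c \<le> (P ^^ n) (indicator {b}) a)"

text \<open>Harnack inequality: \<open>f a\<close> dominates an n-step mean of \<open>f\<close> in
  which b carries weight at least c.\<close>

lemma reach_superharmonic:
  assumes "reach c a b" and f: "\<And>x. x \<in> E \<Longrightarrow> P f x \<le> f x" and a: "a \<in> E"
  shows "c * f b \<le> f a"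
proof -
  obtain n where "c \<le> (P ^^ n) (indicator {b}) a"
    using assms by (auto simp: reach_def)
  then have "f b * c \<le> f b * (P ^^ n) (indicator {b}) a"
    by (rule mult_left_mono) simp
  also have "\<dots> = (P ^^ n) (\<lambda>y. f b * indicator {b} y) a"
    by (rule pow_cmult[symmetric])
  also have "\<dots> \<le> (P ^^ n) f a"
    by (intro pow_mono a) (auto simp: indicator_def)
  also have "\<dots> \<le> f a"
    by (intro superharmonic_pow_le f a)
  finally show ?thesis by (simp add: mult.commute)
qed

lemma reach_trans:
  assumes "reach c a b" "reach c' b d" and a: "a \<in> E"
  shows "reach (c * c') a d"
proof -
  obtain m n where m: "c \<le> (P ^^ m) (indicator {b}) a" and n: "c' \<le> (P ^^ n) (indicator {d}) b"
    using assms by (auto simp: reach_def)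
  let ?f = "(P ^^ n) (indicator {d})"
  have "c * c' \<le> ?f b * (P ^^ m) (indicator {b}) a"
    unfolding mult.commute[of c] using m n by (intro mult_mono) auto
  also have "\<dots> = (P ^^ m) (\<lambda>y. ?f b * indicator {b} y) a"
    by (rule pow_cmult[symmetric])
  also have "\<dots> \<le> (P ^^ m) ?f a"
    by (intro pow_mono a) (auto simp: indicator_def)
  also have "\<dots> = (P ^^ (m + n)) (indicator {d}) a"
    by (simp add: pow_plus)
  finally show ?thesis unfolding reach_def by blast
qed

lemma reach_shift:
  assumes "reach c a b" and a: "a \<in> E" and x: "x \<in> E"
  shows "reach c (a + x) (b + x)"
proof -
  obtain n where n: "c \<le> (P ^^ n) (indicator {b}) a"
    using assms by (auto simp: reach_def)
  also have "(P ^^ n) (indicator {b}) a = (P ^^ n) (\<lambda>y. indicator {b + x} (y + x)) a"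
    by (intro pow_cong a) (auto simp: indicator_def)
  also have "\<dots> \<le> (P ^^ n) (indicator {b + x}) (a + x)"
    by (rule P_pow_shift_le[OF x a])
  finally show ?thesis unfolding reach_def by blast
qed

text \<open>Unlike \<open>harmonic_on\<close>, this admits the zero function, so the class is stable
  under the operators below.\<close>

definition pos_harmonic :: "(int ^ 'd \<Rightarrow> ennreal) \<Rightarrow> bool" where
  "pos_harmonic f \<longleftrightarrow> (\<forall>x\<in>E. f x < \<top> \<and> P f x = f x)"

text \<open>The operator \<open>T\<^sub>u\<close>: for harmonic \<open>f\<close>, the greatest
  harmonic minorant of the superharmonic function f(\<cdot> + u). The infimum is then a decreasing
  limit.\<close>

definition shift_minorant :: "int ^ 'd \<Rightarrow> (int ^ 'd \<Rightarrow> ennreal) \<Rightarrow> int ^ 'd \<Rightarrow> ennreal" where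
  "shift_minorant u f x = (INF n. (P ^^ n) (\<lambda>y. f (y + u)) x)"

lemma harm_finite: "pos_harmonic f \<Longrightarrow> x \<in> E \<Longrightarrow> f x < \<top>"
  and harm_eq: "pos_harmonic f \<Longrightarrow> x \<in> E \<Longrightarrow> P f x = f x"
  by (auto simp: pos_harmonic_def)

lemma harm_shift:
  assumes "pos_harmonic f" "u \<in> E" "x \<in> E"
  shows "f (x + u) = outflow u f x + P (\<lambda>y. f (y + u)) x"
  using assms harm_eq[of f "x + u"] by (simp add: P_split)

lemma harm_shift_super:
  assumes "pos_harmonic f" "u \<in> E" "x \<in> E"
  shows "P (\<lambda>y. f (y + u)) x \<le> f (x + u)"
  using harm_shift[OF assms] by simp

lemma shift_minorant_decseq:
  assumes "pos_harmonic f" "u \<in> E" "x \<in> E"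
  shows "decseq (\<lambda>n. (P ^^ n) (\<lambda>y. f (y + u)) x)"
  using assms by (intro superharmonic_decseq harm_shift_super)

lemma shift_minorant_LIMSEQ:
  assumes "pos_harmonic f" "u \<in> E" "x \<in> E"
  shows "(\<lambda>n. (P ^^ n) (\<lambda>y. f (y + u)) x) \<longlonglongrightarrow> shift_minorant u f x"
  unfolding shift_minorant_def by (intro LIMSEQ_INF shift_minorant_decseq assms)

lemma shift_minorant_le: "shift_minorant u f x \<le> f (x + u)"
  unfolding shift_minorant_def by (rule INF_lower2[of 0]) auto

text \<open>The decreasing limit passes through \<open>P\<close> because f(\<cdot> + u) is a finite
  majorant.\<close>

lemma shift_minorant_harm:
  assumes f: "pos_harmonic f" and u: "u \<in> E"
  shows "pos_harmonic (shift_minorant u f)"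
  unfolding pos_harmonic_def
proof (intro ballI conjI)
  fix x assume x: "x \<in> E"
  have fin: "f (y + u) < \<top>" if "y \<in> E" for y
    using that u f by (auto intro: harm_finite)
  show "shift_minorant u f x < \<top>"
    using shift_minorant_le fin[OF x] by (rule le_less_trans)
  have "P (shift_minorant u f) x = (INF n. P ((P ^^ n) (\<lambda>y. f (y + u))) x)"
    unfolding shift_minorant_def[abs_def]
  proof (rule kop_INF)
    show "P ((P ^^ 0) (\<lambda>y. f (y + u))) x < \<infinity>"
      using harm_shift_super[OF f u x] fin[OF x] by (auto intro: le_less_trans)
  qed (auto simp: walk_trans_def intro!: shift_minorant_decseq f u)
  also have "\<dots> = shift_minorant u f x"
  proof (rule LIMSEQ_unique)
    have "decseq (\<lambda>n. (P ^^ Suc n) (\<lambda>y. f (y + u)) x)"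
      using shift_minorant_decseq[OF f u x] by (simp add: decseq_Suc_iff del: funpow.simps)
    then show "(\<lambda>n. (P ^^ Suc n) (\<lambda>y. f (y + u)) x) \<longlonglongrightarrow> (INF n. P ((P ^^ n) (\<lambda>y. f (y + u))) x)"
      using LIMSEQ_INF by fastforce
    show "(\<lambda>n. (P ^^ Suc n) (\<lambda>y. f (y + u)) x) \<longlonglongrightarrow> shift_minorant u f x"
      using shift_minorant_LIMSEQ[OF f u x] by (rule LIMSEQ_Suc)
  qed
  finally show "P (shift_minorant u f) x = shift_minorant u f x" .
qed

text \<open>Infima alone are only superadditive; the monotone limit gives equality.\<close>

lemma shift_minorant_add:
  assumes "pos_harmonic f" "pos_harmonic g" "u \<in> E" "x \<in> E"
  shows "shift_minorant u (\<lambda>y. f y + g y) x = shift_minorant u f x + shift_minorant u g x"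
proof (rule LIMSEQ_unique)
  have "pos_harmonic (\<lambda>y. f y + g y)"
    using assms by (auto simp: pos_harmonic_def kop_add)
  then show "(\<lambda>n. (P ^^ n) (\<lambda>y. f (y + u) + g (y + u)) x) \<longlonglongrightarrow> shift_minorant u (\<lambda>y. f y + g y) x"
    using shift_minorant_LIMSEQ assms by fastforce
  show "(\<lambda>n. (P ^^ n) (\<lambda>y. f (y + u) + g (y + u)) x) \<longlonglongrightarrow> shift_minorant u f x + shift_minorant u g x"
    unfolding pow_add by (intro tendsto_add shift_minorant_LIMSEQ assms)
qed

lemma shift_minorant_cmult:
  assumes "pos_harmonic f" "c < \<top>" "u \<in> E" "x \<in> E"
  shows "shift_minorant u (\<lambda>y. c * f y) x = c * shift_minorant u f x"
proof (rule LIMSEQ_unique)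
  have "pos_harmonic (\<lambda>y. c * f y)"
    using assms by (auto simp: pos_harmonic_def kop_cmult ennreal_mult_less_top)
  then show "(\<lambda>n. (P ^^ n) (\<lambda>y. c * f (y + u)) x) \<longlonglongrightarrow> shift_minorant u (\<lambda>y. c * f y) x"
    using shift_minorant_LIMSEQ assms by fastforce
  show "(\<lambda>n. (P ^^ n) (\<lambda>y. c * f (y + u)) x) \<longlonglongrightarrow> c * shift_minorant u f x"
    unfolding pow_cmult by (intro ennreal_tendsto_cmult shift_minorant_LIMSEQ assms)
qed

lemma shift_minorant_cong:
  assumes "\<And>y. y \<in> E \<Longrightarrow> f y = g y" "u \<in> E" "x \<in> E"
  shows "shift_minorant u f x = shift_minorant u g x"
  unfolding shift_minorant_def using assms by (auto intro!: INF_cong pow_cong)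

text \<open>Maximality: a harmonic lower bound of f(\<cdot> + u) is fixed by the powers of
  \<open>P\<close> and survives in the limit.\<close>

lemma shift_minorant_ge:
  assumes g: "pos_harmonic g" and x: "x \<in> E" and le: "\<And>y. y \<in> E \<Longrightarrow> c * g y \<le> f (y + u)"
  shows "c * g x \<le> shift_minorant u f x"
  unfolding shift_minorant_def
proof (rule INF_greatest)
  fix n
  have "c * g x = (P ^^ n) (\<lambda>y. c * g y) x"
    by (rule harmonic_pow[symmetric]) (use g x in \<open>auto simp: kop_cmult pos_harmonic_def\<close>)
  also have "\<dots> \<le> (P ^^ n) (\<lambda>y. f (y + u)) x"
    by (intro pow_mono le x)
  finally show "c * g x \<le> (P ^^ n) (\<lambda>y. f (y + u)) x" .
qed

text \<open>Riesz decomposition of f(\<cdot> + u), with the outflow as source of the potential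
  part.\<close>

lemma shift_minorant_decomp:
  assumes "pos_harmonic f" "u \<in> E" "x \<in> E"
  shows "f (x + u) = (\<Sum>n. (P ^^ n) (outflow u f) x) + shift_minorant u f x"
proof (rule LIMSEQ_unique)
  show "(\<lambda>N. (\<Sum>n<N. (P ^^ n) (outflow u f) x) + (P ^^ N) (\<lambda>y. f (y + u)) x)
      \<longlonglongrightarrow> (\<Sum>n. (P ^^ n) (outflow u f) x) + shift_minorant u f x"
    using assms by (intro tendsto_add shift_minorant_LIMSEQ summable_LIMSEQ summableI)
  show "(\<lambda>N. (\<Sum>n<N. (P ^^ n) (outflow u f) x) + (P ^^ N) (\<lambda>y. f (y + u)) x) \<longlonglongrightarrow> f (x + u)"
    using potential_decomp[of E "\<lambda>y. f (y + u)" "outflow u f" "walk_trans \<mu>" x, OF harm_shift] assms by simp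
qed

lemma shift_minorant_pow_harm: "pos_harmonic f \<Longrightarrow> u \<in> E \<Longrightarrow> pos_harmonic ((shift_minorant u ^^ n) f)"
  by (induction n) (auto intro: shift_minorant_harm)

lemma shift_minorant_pow_le: "x \<in> E \<Longrightarrow> u \<in> E \<Longrightarrow> (shift_minorant u ^^ n) f x \<le> f (x + nmul n u)"
proof (induction n arbitrary: x)
  case (Suc n)
  have "(shift_minorant u ^^ Suc n) f x \<le> (shift_minorant u ^^ n) f (x + u)"
    by (simp add: shift_minorant_le)
  also have "\<dots> \<le> f (x + u + nmul n u)"
    using Suc by simp
  finally show ?case by (simp add: add_ac)
qed simp

text \<open>Paths from y translate to paths from y + u, so \<open>shift_minorant (u + v) f\<close>
  is a harmonic function below the shift by u of \<open>shift_minorant v f\<close>; maximality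
  concludes.\<close>

lemma shift_minorant_compose_ge:
  assumes f: "pos_harmonic f" and u: "u \<in> E" and v: "v \<in> E" and x: "x \<in> E"
  shows "shift_minorant (u + v) f x \<le> shift_minorant u (shift_minorant v f) x"
proof -
  have "1 * shift_minorant (u + v) f x \<le> shift_minorant u (shift_minorant v f) x"
  proof (rule shift_minorant_ge[OF shift_minorant_harm[OF f] x])
    fix y assume y: "y \<in> E"
    show "1 * shift_minorant (u + v) f y \<le> shift_minorant v f (y + u)"
      unfolding shift_minorant_def mult_1
    proof (rule INF_mono)
      fix n
      show "\<exists>m\<in>UNIV. (P ^^ m) (\<lambda>y. f (y + (u + v))) y \<le> (P ^^ n) (\<lambda>y. f (y + v)) (y + u)"
        using P_pow_shift_le[OF u y, of n "\<lambda>y. f (y + v)"] by (auto simp: add.assoc)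
    qed
  qed (use u v in auto)
  then show ?thesis by simp
qed

lemma shift_minorant_pow_ge:
  assumes u: "u \<in> E"
  shows "pos_harmonic f \<Longrightarrow> x \<in> E \<Longrightarrow> shift_minorant (nmul n u) f x \<le> (shift_minorant u ^^ n) f x"
proof (induction n arbitrary: f x)
  case 0
  then show ?case using shift_minorant_le[of 0 f x] by simp
next
  case (Suc n)
  have "shift_minorant (nmul n u + u) f x \<le> shift_minorant (nmul n u) (shift_minorant u f) x"
    using Suc.prems u by (intro shift_minorant_compose_ge) auto
  also have "\<dots> \<le> (shift_minorant u ^^ n) (shift_minorant u f) x"
    using Suc.prems u by (intro Suc.IH shift_minorant_harm)
  finally show ?case by (simp add: funpow_swap1)
qed

text \<open>The n-th power lies below the shift by n u, which the Harnack inequality along a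
  translated path from 0 to n u compares with \<open>f\<close>.\<close>

lemma shift_minorant_pow_upper:
  assumes f: "pos_harmonic f" and u: "u \<in> E" and x: "x \<in> E" and r: "reach c 0 (nmul n u)"
  shows "c * (shift_minorant u ^^ n) f x \<le> f x"
proof -
  have "c * (shift_minorant u ^^ n) f x \<le> c * f (nmul n u + x)"
    using shift_minorant_pow_le[OF x u] by (intro mult_left_mono) (auto simp: add.commute)
  also have "\<dots> \<le> f (0 + x)"
    by (rule reach_superharmonic[OF reach_shift[OF r]]) (use f x in \<open>auto simp: pos_harmonic_def\<close>)
  finally show ?thesis by simp
qed

text \<open>A translated path from n u to 0 puts c f below the shift by n u, hence below its
  greatest harmonic minorant, and that lies below the n-th power.\<close>

lemma shift_minorant_pow_lower:
  assumes f: "pos_harmonic f" and u: "u \<in> E" and x: "x \<in> E" and r: "reach c (nmul n u) 0"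
  shows "c * f x \<le> (shift_minorant u ^^ n) f x"
proof -
  have "c * f x \<le> shift_minorant (nmul n u) f x"
  proof (rule shift_minorant_ge[OF f x])
    fix y assume y: "y \<in> E"
    have "c * f (0 + y) \<le> f (nmul n u + y)"
      by (rule reach_superharmonic[OF reach_shift[OF r]]) (use f u y in \<open>auto simp: pos_harmonic_def\<close>)
    then show "c * f y \<le> f (y + nmul n u)" by (simp add: add.commute)
  qed
  also have "\<dots> \<le> (shift_minorant u ^^ n) f x"
    by (rule shift_minorant_pow_ge[OF u f x])
  finally show ?thesis .
qed

text \<open>Bounds on the power \<open>2 ^ k\<close> become, after k square roots, the bounds
  exp(-\<epsilon>) and exp(\<epsilon>) on the operator itself; then \<epsilon> tends to 0.\<close>

lemma shift_minorant_eq: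
  assumes f: "pos_harmonic f" and u: "u \<in> E" and x: "x \<in> E" and c: "c > 0" "reach (ennreal c) 0 u"
    and up: "\<And>\<epsilon>. \<epsilon> > 0 \<Longrightarrow> \<exists>k. reach (ennreal (exp (- \<epsilon> * 2 ^ k))) 0 (nmul (2 ^ k) u)"
    and low: "\<And>\<epsilon>. \<epsilon> > 0 \<Longrightarrow> \<exists>k. reach (ennreal (exp (- \<epsilon> * 2 ^ k))) (nmul (2 ^ k) u) 0"
  shows "shift_minorant u f x = f x"
proof -
  \<comment> \<open>The Harnack constant of a path from 0 to u makes \<open>C - T\<^sub>u\<close> a
    positive operator.\<close>
  define C where "C = 1 / c"
  have C: "C > 0" using c by (simp add: C_def)
  \<comment> \<open>Truncated subtraction, which is exact on harmonic functions by the bound that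
    follows.\<close>
  define S where "S g y = ennreal C * g y - shift_minorant u g y" for g y
  have shift_minorant_le_C: "shift_minorant u g y \<le> ennreal C * g y" if "pos_harmonic g" "y \<in> E" for g y
  proof -
    have "reach (ennreal c) 0 (nmul 1 u)" using c by simp
    from shift_minorant_pow_upper[OF that(1) u that(2) this]
    have "ennreal C * (ennreal c * shift_minorant u g y) \<le> ennreal C * g y"
      by (intro mult_left_mono) auto
    moreover have "ennreal C * ennreal c = 1"
      using c by (simp add: C_def flip: ennreal_mult)
    ultimately show ?thesis by (simp add: mult.assoc[symmetric])
  qed
  have TS: "shift_minorant u g y + S g y = ennreal C * g y" if "pos_harmonic g" "y \<in> E" for g y
    unfolding S_def using shift_minorant_le_C[OF that] by (rule add_diff_inverse_ennreal)
  have S_harm: "pos_harmonic (S g)" if g: "pos_harmonic g" for g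
    unfolding pos_harmonic_def
  proof (intro ballI conjI)
    fix y assume y: "y \<in> E"
    have fin: "ennreal C * g y < \<top>" using harm_finite[OF g y] by (simp add: ennreal_mult_less_top)
    show "S g y < \<top>" using TS[OF g y] fin by (metis add_increasing le_less_trans order_refl zero_le)
    have "P (shift_minorant u g) y + P (S g) y = P (\<lambda>z. ennreal C * g z) y"
      by (subst kop_add[symmetric]) (intro kop_cong TS[OF g])
    also have "\<dots> = ennreal C * g y" using harm_eq[OF g y] by (simp add: kop_cmult)
    also have "\<dots> = shift_minorant u g y + S g y" using TS[OF g y] by simp
    also have "P (shift_minorant u g) y = shift_minorant u g y" using harm_eq[OF shift_minorant_harm[OF g u] y] .
    finally have "shift_minorant u g y + P (S g) y = shift_minorant u g y + S g y" .
    moreover have "shift_minorant u g y \<noteq> \<top>" using harm_finite[OF shift_minorant_harm[OF g u] y] by simp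
    ultimately show "P (S g) y = S g y" by (simp add: ennreal_add_left_cancel)
  qed
  \<comment> \<open>The bounds on powers must hold for all these mixed iterates, as the root lemma
    works on the entire array.\<close>
  define F where "F i j = (shift_minorant u ^^ i) ((S ^^ j) f)" for i j
  have S_pow_harm: "pos_harmonic ((S ^^ j) f)" for j
    by (induction j) (auto intro: S_harm f)
  have F_harm: "pos_harmonic (F i j)" for i j
    unfolding F_def by (intro shift_minorant_pow_harm S_pow_harm u)
  have F_rec: "F (Suc i) j y + F i (Suc j) y = ennreal C * F i j y" if "y \<in> E" for i j y
    using that
  proof (induction i arbitrary: y)
    case 0
    then show ?case using TS[OF S_pow_harm] by (simp add: F_def)
  next
    case (Suc i)
    have F_Suc: "F (Suc i) j = shift_minorant u (F i j)" for i j by (simp add: F_def)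
    have "F (Suc (Suc i)) j y + F (Suc i) (Suc j) y = shift_minorant u (\<lambda>z. F (Suc i) j z + F i (Suc j) z) y"
      unfolding F_Suc[of "Suc i"] F_Suc[of i "Suc j"] using Suc.prems u F_harm by (intro shift_minorant_add[symmetric])
    also have "\<dots> = shift_minorant u (\<lambda>z. ennreal C * F i j z) y"
      using Suc u by (intro shift_minorant_cong) auto
    also have "\<dots> = ennreal C * F (Suc i) j y"
      unfolding F_Suc using F_harm u Suc.prems by (intro shift_minorant_cmult) auto
    finally show ?case .
  qed
  define m where "m i j = enn2real (F i j x)" for i j
  have F_m: "F i j x = ennreal (m i j)" for i j
    unfolding m_def using harm_finite[OF F_harm x] by (simp add: ennreal_enn2real)
  have m_nonneg: "m i j \<ge> 0" for i j by (simp add: m_def)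
  have m_rec: "m (Suc i) j + m i (Suc j) = C * m i j" for i j
    using F_rec[OF x, of i j] C m_nonneg unfolding F_m
    by (simp flip: ennreal_plus ennreal_mult)
  have F_pow: "F (i + n) j = (shift_minorant u ^^ n) (F i j)" for i j n
    unfolding F_def by (simp add: funpow_add add.commute[of i])
  have low': "1 * (m (Suc i) j - exp (- \<epsilon>) * m i j) \<ge> 0" if "\<epsilon> > 0" for \<epsilon> i j
  proof -
    obtain k where k: "reach (ennreal (exp (- \<epsilon> * 2 ^ k))) (nmul (2 ^ k) u) 0"
      using low[OF \<open>\<epsilon> > 0\<close>] by auto
    have "1 * (m (i + 2 ^ k) j - exp (- \<epsilon> * 2 ^ k) * m i j) \<ge> 0" for i j
      using shift_minorant_pow_lower[OF F_harm u x k, of i j] m_nonneg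
      by (simp add: F_m flip: F_pow ennreal_mult)
    then show ?thesis
      by (intro binary_moments_root_pow2[where m = m and C = C and k = k, OF m_rec m_nonneg C]) auto
  qed
  have up': "- 1 * (m (Suc i) j - exp \<epsilon> * m i j) \<ge> 0" if "\<epsilon> > 0" for \<epsilon> i j
  proof -
    obtain k where k: "reach (ennreal (exp (- \<epsilon> * 2 ^ k))) 0 (nmul (2 ^ k) u)"
      using up[OF \<open>\<epsilon> > 0\<close>] by auto
    have "- 1 * (m (i + 2 ^ k) j - exp (\<epsilon> * 2 ^ k) * m i j) \<ge> 0" for i j
    proof -
      have "exp (- \<epsilon> * 2 ^ k) * m (i + 2 ^ k) j \<le> m i j"
        using shift_minorant_pow_upper[OF F_harm u x k, of i j] m_nonneg
        by (simp add: F_m flip: F_pow ennreal_mult)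
      then have "exp (\<epsilon> * 2 ^ k) * (exp (- \<epsilon> * 2 ^ k) * m (i + 2 ^ k) j) \<le> exp (\<epsilon> * 2 ^ k) * m i j"
        by (rule mult_left_mono) simp
      then show ?thesis by (simp add: mult.assoc[symmetric] flip: exp_add)
    qed
    then show ?thesis
      by (intro binary_moments_root_pow2[where m = m and C = C and k = k, OF m_rec m_nonneg C]) auto
  qed
  have "((\<lambda>\<epsilon>. exp (- \<epsilon>) * m 0 0) \<longlongrightarrow> exp (- 0) * m 0 0) (at_right 0)"
    by (intro tendsto_intros)
  then have "exp (- 0) * m 0 0 \<le> m 1 0"
    by (rule tendsto_upperbound) (use low'[of _ 0 0] in \<open>auto simp: eventually_at_right_less eventually_at_filter\<close>)
  moreover have "((\<lambda>\<epsilon>. exp \<epsilon> * m 0 0) \<longlongrightarrow> exp 0 * m 0 0) (at_right 0)"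
    by (intro tendsto_intros)
  then have "m 1 0 \<le> exp 0 * m 0 0"
    by (rule tendsto_lowerbound) (use up'[of _ 0 0] in \<open>auto simp: eventually_at_right_less eventually_at_filter\<close>)
  ultimately have "m 1 0 = m 0 0" by simp
  then show ?thesis using F_m[of 1 0] F_m[of 0 0] by (simp add: F_def)
qed

end

section \<open>Subexponential decay of hitting probabilities\<close>

lemma real_vec_add: "real_vec (x + y) = real_vec x + real_vec y"
  and real_vec_diff: "real_vec (x - y) = real_vec x - real_vec y"
  and real_vec_0 [simp]: "real_vec 0 = 0"
  by (simp_all add: real_vec_def vec_eq_iff)

lemma real_vec_nmul: "real_vec (nmul n u) = real n *\<^sub>R real_vec u"
  by (induction n) (auto simp: real_vec_add algebra_simps)

text \<open>Sup-norm boxes exhaust the lattice, and their cardinality grows only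
  polynomially.\<close>

definition cube :: "nat \<Rightarrow> (int ^ 'd) set" where
  "cube N = {z. \<forall>i. \<bar>z $ i\<bar> \<le> int N}"

lemma cube_subset_image: "cube N \<subseteq> vec_lambda ` (Pi\<^sub>E UNIV (\<lambda>_. {- int N..int N}))"
proof
  fix z :: "int ^ 'd" assume "z \<in> cube N"
  then have "vec_nth z \<in> Pi\<^sub>E UNIV (\<lambda>_. {- int N..int N})" "z = vec_lambda (vec_nth z)"
    by (auto simp: cube_def abs_le_iff minus_le_iff)
  then show "z \<in> vec_lambda ` (Pi\<^sub>E UNIV (\<lambda>_. {- int N..int N}))" by blast
qed

lemma finite_cube: "finite (cube N)"
  by (rule finite_subset[OF cube_subset_image]) (auto intro!: finite_imageI finite_PiE)

lemma card_cube: "card (cube N :: (int ^ 'd) set) \<le> (2 * N + 1) ^ CARD('d)"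
proof -
  have "card (cube N :: (int ^ 'd) set) \<le> card (vec_lambda ` (Pi\<^sub>E UNIV (\<lambda>_ :: 'd. {- int N..int N})))"
    by (intro card_mono cube_subset_image finite_imageI finite_PiE) auto
  also have "\<dots> \<le> card (Pi\<^sub>E (UNIV :: 'd set) (\<lambda>_. {- int N..int N}))"
    by (intro card_image_le finite_PiE) auto
  also have "\<dots> = (2 * N + 1) ^ CARD('d)"
    by (simp add: card_PiE nat_add_distrib nat_mult_distrib)
  finally show ?thesis .
qed

lemma cube_mono: "M \<le> N \<Longrightarrow> cube M \<subseteq> cube N"
  using of_nat_mono[of M N, where 'a = int] by (auto simp: cube_def intro: order_trans)

lemma zero_mem_cube [simp]: "0 \<in> cube N"
  by (simp add: cube_def)

lemma ex_mem_cube: "\<exists>N. z \<in> cube N"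
proof -
  have "\<bar>z $ i\<bar> \<le> int (nat (\<Sum>i\<in>UNIV. \<bar>z $ i\<bar>))" for i
    using member_le_sum[of i UNIV "\<lambda>i. \<bar>z $ i\<bar>"] by simp
  then show ?thesis unfolding cube_def by blast
qed

lemma add_mem_cube: "x \<in> cube M \<Longrightarrow> y \<in> cube N \<Longrightarrow> x + y \<in> cube (M + N)"
  by (auto simp: cube_def intro: order_trans[OF abs_triangle_ineq] add_mono)

lemma finite_norm_le: "finite {z :: int ^ 'd. norm (real_vec z) \<le> B}"
proof (rule finite_subset)
  show "{z :: int ^ 'd. norm (real_vec z) \<le> B} \<subseteq> cube (nat \<lceil>B\<rceil>)"
  proof clarsimp
    fix z :: "int ^ 'd" assume B: "norm (real_vec z) \<le> B"
    have "\<bar>z $ i\<bar> \<le> int (nat \<lceil>B\<rceil>)" for i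
    proof -
      have "\<bar>real_of_int (z $ i)\<bar> \<le> B"
        using component_le_norm_cart[of "real_vec z" i] B by (simp add: real_vec_def)
      then show ?thesis by linarith
    qed
    then show "z \<in> cube (nat \<lceil>B\<rceil>)" by (simp add: cube_def)
  qed
qed (rule finite_cube)

text \<open>
  Hahn--Banach for a subadditive function on the lattice. The asymptotic epigraph \<open>K\<close> below is a
  convex cone in \<open>\<real>\<^sup>d \<times> \<real>\<close>, which is separated from a point under the graph.
\<close>

lemma subadditive_support:
  fixes \<phi> :: "int ^ 'd \<Rightarrow> real"
  assumes nonneg: "\<And>v. \<phi> v \<ge> 0" and sub: "\<And>v w. \<phi> (v + w) \<le> \<phi> v + \<phi> w" and zero: "\<phi> 0 = 0"
    and \<epsilon>: "\<epsilon> > 0" and growth: "\<And>k. \<epsilon> * 2 ^ k \<le> \<phi> (nmul (2 ^ k) v0)"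
  shows "\<exists>\<alpha>. \<alpha> \<noteq> 0 \<and> (\<forall>v. \<alpha> \<bullet> real_vec v \<le> \<phi> v)"
proof -
  define K :: "((real ^ 'd) \<times> real) set" where
    "K = {(x, r). \<exists>B. \<forall>s\<ge>0. \<exists>v. norm (real_vec v - s *\<^sub>R x) \<le> B \<and> \<phi> v \<le> r * s + B}"
  have nmul_le: "\<phi> (nmul n v) \<le> real n * \<phi> v" for n v
  proof (induction n)
    case (Suc n)
    then show ?case using sub[of "nmul n v" v] by (simp add: algebra_simps)
  qed (simp add: zero)
  have K_add: "(x + y, r + q) \<in> K" if xr: "(x, r) \<in> K" and yq: "(y, q) \<in> K" for x y r q
  proof -
    obtain B where B: "\<And>s. s \<ge> 0 \<Longrightarrow> \<exists>v. norm (real_vec v - s *\<^sub>R x) \<le> B \<and> \<phi> v \<le> r * s + B"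
      using xr by (auto simp: K_def)
    obtain B' where B': "\<And>s. s \<ge> 0 \<Longrightarrow> \<exists>v. norm (real_vec v - s *\<^sub>R y) \<le> B' \<and> \<phi> v \<le> q * s + B'"
      using yq by (auto simp: K_def)
    have "\<exists>v. norm (real_vec v - s *\<^sub>R (x + y)) \<le> B + B' \<and> \<phi> v \<le> (r + q) * s + (B + B')" if s: "s \<ge> 0" for s
    proof -
      obtain v w where v: "norm (real_vec v - s *\<^sub>R x) \<le> B" "\<phi> v \<le> r * s + B"
        and w: "norm (real_vec w - s *\<^sub>R y) \<le> B'" "\<phi> w \<le> q * s + B'"
        using B[OF s] B'[OF s] by blast
      have "real_vec (v + w) - s *\<^sub>R (x + y) = (real_vec v - s *\<^sub>R x) + (real_vec w - s *\<^sub>R y)"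
        by (simp add: real_vec_add algebra_simps)
      then have "norm (real_vec (v + w) - s *\<^sub>R (x + y)) \<le> B + B'"
        using norm_triangle_ineq[of "real_vec v - s *\<^sub>R x" "real_vec w - s *\<^sub>R y"] v w by simp
      moreover have "\<phi> (v + w) \<le> (r + q) * s + (B + B')"
        using sub[of v w] v w by (simp add: algebra_simps)
      ultimately show ?thesis by blast
    qed
    then show ?thesis by (auto simp: K_def)
  qed
  have K_scale: "(t *\<^sub>R x, t * r) \<in> K" if xr: "(x, r) \<in> K" and t: "t \<ge> 0" for x r t
  proof -
    obtain B where B: "\<And>s. s \<ge> 0 \<Longrightarrow> \<exists>v. norm (real_vec v - s *\<^sub>R x) \<le> B \<and> \<phi> v \<le> r * s + B"
      using xr by (auto simp: K_def)
    have "\<exists>v. norm (real_vec v - s *\<^sub>R (t *\<^sub>R x)) \<le> B \<and> \<phi> v \<le> t * r * s + B" if s: "s \<ge> 0" for s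
      using B[of "s * t"] s t by (simp add: mult_ac)
    then show ?thesis by (auto simp: K_def)
  qed
  have K_up: "(x, r') \<in> K" if xr: "(x, r) \<in> K" and r: "r \<le> r'" for x r r'
  proof -
    obtain B where B: "\<And>s. s \<ge> 0 \<Longrightarrow> \<exists>v. norm (real_vec v - s *\<^sub>R x) \<le> B \<and> \<phi> v \<le> r * s + B"
      using xr by (auto simp: K_def)
    have "\<exists>v. norm (real_vec v - s *\<^sub>R x) \<le> B \<and> \<phi> v \<le> r' * s + B" if s: "s \<ge> 0" for s
      using B[OF s] mult_right_mono[OF r s] by (meson add_right_mono order_trans)
    then show ?thesis by (auto simp: K_def)
  qed
  have K_lattice: "(real_vec v, \<phi> v) \<in> K" for v
  proof -
    have "\<exists>w. norm (real_vec w - s *\<^sub>R real_vec v) \<le> norm (real_vec v) \<and> \<phi> w \<le> \<phi> v * s + norm (real_vec v)"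
      if s: "s \<ge> 0" for s
    proof (intro exI conjI)
      \<comment> \<open>Integer multiples of v follow the ray with an error of at most the norm of
        v.\<close>
      let ?n = "nat \<lfloor>s\<rfloor>"
      have n: "real ?n \<le> s" "s \<le> real ?n + 1" using s by linarith+
      have "real_vec (nmul ?n v) - s *\<^sub>R real_vec v = (real ?n - s) *\<^sub>R real_vec v"
        by (simp add: real_vec_nmul algebra_simps)
      then have "norm (real_vec (nmul ?n v) - s *\<^sub>R real_vec v) = \<bar>real ?n - s\<bar> * norm (real_vec v)"
        by simp
      also have "\<dots> \<le> 1 * norm (real_vec v)"
      proof (rule mult_right_mono)
        show "\<bar>real ?n - s\<bar> \<le> 1" using n by linarith
      qed simp
      finally show "norm (real_vec (nmul ?n v) - s *\<^sub>R real_vec v) \<le> norm (real_vec v)" by simp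
      have "\<phi> (nmul ?n v) \<le> s * \<phi> v"
        using nmul_le[of ?n v] mult_right_mono[OF n(1) nonneg[of v]] by linarith
      then show "\<phi> (nmul ?n v) \<le> \<phi> v * s + norm (real_vec v)"
        by (simp add: mult.commute add_increasing2)
    qed
    then show ?thesis by (auto simp: K_def)
  qed
  \<comment> \<open>The projection of \<open>K\<close> to the space variable is onto, which later
    excludes a vertical hyperplane.\<close>
  have K_total: "\<exists>r. (x, r) \<in> K" for x
  proof -
    have comp: "\<exists>r. (axis i (x $ i), r) \<in> K" for i
    proof -
      have e: "real_vec (axis i 1) = axis i 1" "real_vec (axis i (-1)) = axis i (-1)"
        by (auto simp: real_vec_def axis_def vec_eq_iff)
      show ?thesis
      proof (cases "x $ i \<ge> 0")
        case True
        have "axis i (x $ i) = (x $ i) *\<^sub>R axis i 1" by (auto simp: axis_def vec_eq_iff)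
        then show ?thesis using K_scale[OF K_lattice[of "axis i 1"] True] e by metis
      next
        case False
        have "axis i (x $ i) = (- x $ i) *\<^sub>R axis i (-1)" by (auto simp: axis_def vec_eq_iff)
        then show ?thesis using K_scale[OF K_lattice[of "axis i (-1)"], of "- x $ i"] False e by force
      qed
    qed
    have "\<exists>r. ((\<Sum>i\<in>I. axis i (x $ i)), r) \<in> K" if "finite I" for I
      using that
    proof induction
      case empty
      show ?case using K_lattice[of 0] by auto
    next
      case (insert i I)
      obtain r q where "(axis i (x $ i), r) \<in> K" "((\<Sum>i\<in>I. axis i (x $ i)), q) \<in> K"
        using comp[of i] insert.IH by blast
      from K_add[OF this] insert.hyps show ?case by auto
    qed
    from this[OF finite] have total: "\<exists>r. ((\<Sum>i\<in>UNIV. axis i (x $ i)), r) \<in> K" .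
    have "(\<Sum>i\<in>UNIV. axis i (x $ i)) = x"
    proof (subst vec_eq_iff, intro allI)
      fix j
      have "(\<Sum>i\<in>UNIV. axis i (x $ i)) $ j = (\<Sum>i\<in>UNIV. if i = j then x $ i else 0)"
        unfolding sum_component by (intro sum.cong) (auto simp: axis_def)
      also have "\<dots> = x $ j" by simp
      finally show "(\<Sum>i\<in>UNIV. axis i (x $ i)) $ j = x $ j" .
    qed
    with total show ?thesis by (simp only:)
  qed
  have K_v0: "r \<ge> \<epsilon>" if v0r: "(real_vec v0, r) \<in> K" for r
  proof -
    obtain B where B: "\<And>s. s \<ge> 0 \<Longrightarrow> \<exists>v. norm (real_vec v - s *\<^sub>R real_vec v0) \<le> B \<and> \<phi> v \<le> r * s + B"
      using v0r by (auto simp: K_def)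
    \<comment> \<open>The gap between \<open>nmul (2 ^ k) v0\<close> and its approximation stays in
      this finite set, so it costs a constant, negligible against \<open>2 ^ k\<close>.\<close>
    define Z where "Z = {z :: int ^ 'd. norm (real_vec z) \<le> B}"
    have Z: "finite Z" unfolding Z_def by (rule finite_norm_le)
    have ge: "(\<epsilon> - r) * 2 ^ k \<le> B + (\<Sum>z\<in>Z. \<phi> z)" for k
    proof -
      have "norm (real_vec w - (2 ^ k) *\<^sub>R real_vec v0) = norm (real_vec (nmul (2 ^ k) v0 - w))" for w
        by (simp add: real_vec_diff real_vec_nmul norm_minus_commute)
      with B[of "2 ^ k"] obtain w where w: "nmul (2 ^ k) v0 - w \<in> Z" "\<phi> w \<le> r * 2 ^ k + B"
        by (auto simp: Z_def)
      have "\<epsilon> * 2 ^ k \<le> \<phi> ((nmul (2 ^ k) v0 - w) + w)" using growth by simp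
      also have "\<dots> \<le> (\<Sum>z\<in>Z. \<phi> z) + \<phi> w"
        using sub[of "nmul (2 ^ k) v0 - w" w] member_le_sum[where f = \<phi>, OF w(1) nonneg Z] by linarith
      finally show ?thesis using w(2) by (simp add: algebra_simps)
    qed
    show ?thesis
    proof (rule ccontr)
      assume "\<not> r \<ge> \<epsilon>"
      then have pos: "\<epsilon> - r > 0" by simp
      obtain k where "(B + (\<Sum>z\<in>Z. \<phi> z)) / (\<epsilon> - r) < 2 ^ k"
        using real_arch_pow[of 2] by auto
      then show False using ge[of k] pos by (simp add: field_simps)
    qed
  qed
  have convex: "convex K"
  proof (rule convexI)
    fix a b u v assume "a \<in> K" "b \<in> K" "0 \<le> (u :: real)" "0 \<le> (v :: real)"
    then show "u *\<^sub>R a + v *\<^sub>R b \<in> K"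
      using K_add[OF K_scale[of "fst a" "snd a" u] K_scale[of "fst b" "snd b" v]]
      by (cases a; cases b) auto
  qed
  \<comment> \<open>Half of \<epsilon> puts the point strictly below every admissible height over
    \<open>v0\<close>.\<close>
  have notin: "K \<inter> {(real_vec v0, \<epsilon> / 2)} = {}" using K_v0[of "\<epsilon> / 2"] \<epsilon> by auto
  obtain ab b where ab: "ab \<noteq> 0" "\<forall>p\<in>K. ab \<bullet> p \<le> b" "\<forall>p\<in>{(real_vec v0, \<epsilon> / 2)}. ab \<bullet> p \<ge> b"
    using separating_hyperplane_sets[OF convex convex_singleton _ _ notin] K_lattice by blast
  obtain a \<beta> where ab_eq: "ab = (a, \<beta>)" by (cases ab)
  \<comment> \<open>A linear functional bounded above on a cone is nonpositive there.\<close>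
  have K_neg: "a \<bullet> x + \<beta> * r \<le> 0" if xr: "(x, r) \<in> K" for x r
  proof (rule ccontr)
    assume "\<not> ?thesis"
    then have pos: "a \<bullet> x + \<beta> * r > 0" by simp
    have "t * (a \<bullet> x + \<beta> * r) \<le> b" if "t \<ge> 0" for t
      using ab(2) K_scale[OF xr that] by (force simp: ab_eq algebra_simps)
    from this[of "(\<bar>b\<bar> + 1) / (a \<bullet> x + \<beta> * r)"] pos show False
      by (simp add: abs_if split: if_splits)
  qed
  have "b \<ge> 0" using ab(2) K_lattice[of 0] zero by (force simp: ab_eq)
  then have v0: "a \<bullet> real_vec v0 + \<beta> * (\<epsilon> / 2) \<ge> 0"
    using ab(3) by (simp add: ab_eq)
  have "\<beta> \<le> 0"
    using K_neg[OF K_up[OF K_lattice[of 0], of 1]] by (simp add: zero)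
  moreover have "\<beta> \<noteq> 0"
  proof
    assume "\<beta> = 0"
    then have "a \<bullet> a \<le> 0" using K_total[of a] K_neg[of a] by auto
    then have "a = 0" by (metis inner_eq_zero_iff inner_ge_zero order_antisym)
    with \<open>\<beta> = 0\<close> ab(1) show False by (simp add: ab_eq zero_prod_def)
  qed
  ultimately have \<beta>: "\<beta> < 0" by simp
  \<comment> \<open>Dividing by the negative vertical coefficient yields a linear minorant of
    \<phi>; its value at \<open>v0\<close> is at least \<epsilon> / 2, so it is non-zero.\<close>
  define \<alpha> where "\<alpha> = (1 / - \<beta>) *\<^sub>R a"
  have "\<alpha> \<bullet> real_vec v \<le> \<phi> v" for v
    using K_neg[OF K_lattice[of v]] \<beta> by (simp add: \<alpha>_def field_simps)
  moreover have "\<alpha> \<noteq> 0"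
    using v0 \<beta> \<epsilon> by (auto simp: \<alpha>_def) (smt (verit) inner_zero_left mult_neg_pos half_gt_zero)
  ultimately show ?thesis by blast
qed

text \<open>A d-th root makes the bound linear in n, which no geometric growth obeys. For d = 0 the
  case n = 1 suffices.\<close>

lemma poly_bounded_pow_le_one:
  fixes R :: real
  assumes bound: "\<And>n. R ^ n \<le> (real C * real n + 1) ^ d" and R: "R \<ge> 0"
  shows "R \<le> 1"
proof (cases "d = 0")
  case True
  then show ?thesis using bound[of 1] by simp
next
  case d: False
  show ?thesis
  proof (rule ccontr)
    assume "\<not> R \<le> 1"
    then have R1: "R > 1" by simp
    define b where "b = root d R"
    have b: "b > 1" "b ^ d = R" using R1 d by (auto simp: b_def)
    have le: "b ^ n \<le> real C * real n + 1" for n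
    proof -
      have "(b ^ n) ^ d \<le> (real C * real n + 1) ^ d"
        using bound[of n] b(2) by (metis power_mult mult.commute)
      then show ?thesis using b d by (subst (asm) power_mono_iff) auto
    qed
    have "(\<lambda>n. real C * (real n * (1 / b) ^ n) + (1 / b) ^ n) \<longlonglongrightarrow> real C * 0 + 0"
      using b by (intro tendsto_intros powser_times_n_limit_0 LIMSEQ_realpow_zero) auto
    moreover have "1 \<le> real C * (real n * (1 / b) ^ n) + (1 / b) ^ n" for n
      using le[of n] b by (simp add: field_simps power_divide)
    ultimately have "1 \<le> real C * 0 + 0"
      by (intro LIMSEQ_le_const) auto
    then show False by simp
  qed
qed

section \<open>Free walk paths confined to boxes\<close>

lemma kop_mono_set: "B \<subseteq> E \<Longrightarrow> kop B q f x \<le> kop E q f x"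
  unfolding kop_def
  by (subst (1 2) nn_integral_count_space_indicator) (auto intro!: nn_integral_mono simp: indicator_def)

lemma kop_walk_shift_le:
  assumes "\<And>b. b \<in> B \<Longrightarrow> b + z \<in> E"
  shows "kop B (walk_trans \<mu>) (\<lambda>y. f (y + z)) a \<le> kop E (walk_trans \<mu>) f (a + z)"
proof -
  have "kop B (walk_trans \<mu>) (\<lambda>y. f (y + z)) a
      = (\<integral>\<^sup>+b. ennreal (pmf \<mu> ((b + z) - (a + z))) * f (b + z) \<partial>count_space B)"
    by (simp add: kop_def walk_trans_def)
  also have "\<dots> = kop ((\<lambda>b. b + z) ` B) (walk_trans \<mu>) f (a + z)"
    unfolding kop_def walk_trans_def
    by (rule nn_integral_bij_count_space) (auto simp: bij_betw_def)
  also have "\<dots> \<le> kop E (walk_trans \<mu>) f (a + z)"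
    using assms by (intro kop_mono_set) auto
  finally show ?thesis .
qed

text \<open>A path confined to \<open>B\<close> and translated by z is a path in \<open>E\<close>.
  This serves both to move boxes into the cone and to drop a confinement.\<close>

lemma pow_walk_shift_le:
  assumes "\<And>b. b \<in> B \<Longrightarrow> b + z \<in> E"
  shows "(kop B (walk_trans \<mu>) ^^ n) (\<lambda>y. f (y + z)) a \<le> (kop E (walk_trans \<mu>) ^^ n) f (a + z)"
proof (induction n arbitrary: a)
  case (Suc n)
  have "(kop B (walk_trans \<mu>) ^^ Suc n) (\<lambda>y. f (y + z)) a
      \<le> kop B (walk_trans \<mu>) (\<lambda>y. (kop E (walk_trans \<mu>) ^^ n) f (y + z)) a"
    using Suc by (auto intro!: kop_mono)
  also have "\<dots> \<le> (kop E (walk_trans \<mu>) ^^ Suc n) f (a + z)"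
    using kop_walk_shift_le[OF assms] by simp
  finally show ?case .
qed simp

text \<open>For fixed n, boxes of growing size capture all n-step paths in the limit, by monotone
  convergence at each step.\<close>

lemma pow_cube_SUP:
  "(SUP N. (kop (cube N) q ^^ n) f x) = (kop UNIV q ^^ n) f x"
  "incseq (\<lambda>N. (kop (cube N) q ^^ n) f x)"
proof -
  have ind: "kop (cube N) q g x = kop UNIV q (\<lambda>y. indicator (cube N) y * g y) x" for N g x
    unfolding kop_def by (subst nn_integral_count_space_indicator) (auto simp: mult_ac)
  have inc: "incseq (\<lambda>N. (kop (cube N) q ^^ n) f x)" for n x
  proof (induction n arbitrary: x)
    case (Suc n)
    show ?case
    proof (rule incseq_SucI)
      fix N
      have "(kop (cube N) q ^^ Suc n) f x \<le> kop (cube N) q ((kop (cube (Suc N)) q ^^ n) f) x"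
        using incseq_SucD[OF Suc] by (auto intro!: kop_mono)
      also have "\<dots> \<le> (kop (cube (Suc N)) q ^^ Suc n) f x"
        by (auto intro!: kop_mono_set cube_mono)
      finally show "(kop (cube N) q ^^ Suc n) f x \<le> (kop (cube (Suc N)) q ^^ Suc n) f x" .
    qed
  qed simp
  show "incseq (\<lambda>N. (kop (cube N) q ^^ n) f x)" by (rule inc)
  show "(SUP N. (kop (cube N) q ^^ n) f x) = (kop UNIV q ^^ n) f x"
  proof (induction n arbitrary: x)
    case (Suc n)
    let ?g = "\<lambda>N y. indicator (cube N) y * (kop (cube N) q ^^ n) f y"
    have inc_g: "incseq (\<lambda>N. ?g N y)" for y
      using inc[of n y] unfolding incseq_def
      by (intro allI impI mult_mono) (auto simp: indicator_def intro: subsetD[OF cube_mono])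
    have SUP_g: "(SUP N. ?g N y) = (kop UNIV q ^^ n) f y" for y
    proof -
      obtain M where M: "y \<in> cube M" using ex_mem_cube by blast
      have "(SUP N. ?g N y) = (SUP N. (kop (cube N) q ^^ n) f y)"
      proof (intro antisym SUP_mono)
        fix N
        have "(kop (cube N) q ^^ n) f y \<le> ?g (max M N) y"
          using incseqD[OF inc[of n y], of N "max M N"] M cube_mono[of M "max M N"] by auto
        then show "\<exists>m\<in>UNIV. (kop (cube N) q ^^ n) f y \<le> ?g m y" by blast
      qed (auto simp: indicator_def)
      with Suc show ?thesis by simp
    qed
    have "(SUP N. (kop (cube N) q ^^ Suc n) f x) = (SUP N. kop UNIV q (?g N) x)"
      by (simp add: ind)
    also have "\<dots> = kop UNIV q (\<lambda>y. SUP N. ?g N y) x"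
      by (rule kop_SUP[symmetric]) (rule inc_g)
    finally show ?case by (simp add: SUP_g)
  qed simp
qed

text \<open>Exponential tilting restricted to steps in a cube: the tilted mass after \<open>n\<close> steps sits on
  polynomially many points.\<close>

lemma jump_gf_le_one:
  fixes \<mu> :: "(int ^ 'd) pmf" and \<alpha> :: "real ^ 'd"
  assumes bound: "\<And>n v. (kop UNIV (walk_trans \<mu>) ^^ n) (indicator {v}) 0 \<le> ennreal (exp (- (\<alpha> \<bullet> real_vec v)))"
  shows "jump_gf \<mu> \<alpha> \<le> 1"
proof -
  let ?P = "kop UNIV (walk_trans \<mu>)"
  define e where "e y = ennreal (exp (\<alpha> \<bullet> real_vec y))" for y
  define R where "R A = (\<integral>\<^sup>+s. ennreal (pmf \<mu> s) * e s * indicator (cube A) s \<partial>count_space UNIV)" for A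
  have R_le: "R A \<le> 1" for A
  proof -
    \<comment> \<open>The walk with steps restricted to a box; the exponential \<open>e\<close> is
      an eigenfunction with eigenvalue \<open>R A\<close>.\<close>
    define Q where "Q = kop UNIV (\<lambda>x y. walk_trans \<mu> x y * indicator (cube A) (y - x))"
    have Q_e: "Q (\<lambda>y. c * e y) x = c * R A * e x" for c x
    proof -
      have "Q (\<lambda>y. c * e y) x = c * Q e x" unfolding Q_def by (rule kop_cmult)
      also have "Q e x = (\<integral>\<^sup>+s. walk_trans \<mu> x (s + x) * indicator (cube A) ((s + x) - x) * e (s + x) \<partial>count_space UNIV)"
        unfolding Q_def kop_def
        by (rule nn_integral_bij_count_space[symmetric]) (auto intro!: bij_betwI[where g = "\<lambda>y. y - x"])
      also have "\<dots> = (\<integral>\<^sup>+s. ennreal (pmf \<mu> s) * e s * indicator (cube A) s * e x \<partial>count_space UNIV)"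
        by (intro nn_integral_cong)
           (simp add: walk_trans_def e_def real_vec_add inner_add_right exp_add ennreal_mult mult_ac)
      also have "\<dots> = R A * e x" unfolding R_def by (rule nn_integral_multc) simp
      finally show ?thesis by (simp add: mult_ac)
    qed
    have Q_pow: "(Q ^^ n) e x = R A ^ n * e x" for n x
    proof (induction n arbitrary: x)
      case (Suc n)
      have "(Q ^^ Suc n) e x = Q (\<lambda>y. R A ^ n * e y) x"
        by (simp add: Suc[abs_def])
      then show ?case using Q_e[of "R A ^ n" x] by (simp add: mult_ac)
    qed simp
    \<comment> \<open>Over n restricted steps each coordinate changes by at most
      \<open>n * A\<close>.\<close>
    have Q_le: "(Q ^^ n) f x \<le> (?P ^^ n) (\<lambda>y. f y * indicator (cube (n * A)) (y - x)) x" for n f x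
    proof (induction n arbitrary: x)
      case 0
      show ?case by simp
    next
      case (Suc n)
      have "(Q ^^ Suc n) f x \<le> Q (\<lambda>y. (?P ^^ n) (\<lambda>z. f z * indicator (cube (n * A)) (z - y)) y) x"
        unfolding Q_def using Suc[unfolded Q_def] by (auto intro!: kop_mono)
      also have "\<dots> = ?P (\<lambda>y. indicator (cube A) (y - x) * (?P ^^ n) (\<lambda>z. f z * indicator (cube (n * A)) (z - y)) y) x"
        unfolding Q_def kop_def by (simp add: mult_ac)
      also have "\<dots> \<le> ?P (\<lambda>y. (?P ^^ n) (\<lambda>z. f z * indicator (cube (Suc n * A)) (z - x)) y) x"
      proof (rule kop_mono)
        fix y
        show "indicator (cube A) (y - x) * (?P ^^ n) (\<lambda>z. f z * indicator (cube (n * A)) (z - y)) y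
            \<le> (?P ^^ n) (\<lambda>z. f z * indicator (cube (Suc n * A)) (z - x)) y"
        proof (cases "y - x \<in> cube A")
          case True
          have "z - x \<in> cube (Suc n * A)" if "z - y \<in> cube (n * A)" for z
            using add_mem_cube[OF True that] by simp
          with True show ?thesis
            by (auto intro!: pow_mono simp: indicator_def)
        qed simp
      qed
      finally show ?case by simp
    qed
    \<comment> \<open>By the assumed bound each endpoint contributes at most 1, leaving the number
      of points in the box.\<close>
    have pow_bound: "R A ^ n \<le> of_nat ((2 * (n * A) + 1) ^ CARD('d))" for n
    proof -
      have "R A ^ n = (Q ^^ n) e 0" by (simp add: Q_pow e_def)
      also have "\<dots> \<le> (?P ^^ n) (\<lambda>y. e y * indicator (cube (n * A)) y) 0"
        using Q_le[of n e 0] by simp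
      also have "\<dots> = (\<integral>\<^sup>+z. (?P ^^ n) (indicator {z}) 0 * (e z * indicator (cube (n * A)) z) \<partial>count_space UNIV)"
        by (subst pow_expand) auto
      also have "\<dots> \<le> (\<integral>\<^sup>+z. indicator (cube (n * A)) z \<partial>count_space (UNIV :: (int ^ 'd) set))"
      proof (rule nn_integral_mono)
        fix z :: "int ^ 'd"
        have "(?P ^^ n) (indicator {z}) 0 * e z \<le> ennreal (exp (- (\<alpha> \<bullet> real_vec z))) * e z"
          using bound by (intro mult_right_mono) auto
        also have "\<dots> = 1" by (simp add: e_def flip: ennreal_mult exp_add)
        finally show "(?P ^^ n) (indicator {z}) 0 * (e z * indicator (cube (n * A)) z) \<le> indicator (cube (n * A)) z"
          by (auto simp: indicator_def)
      qed
      also have "\<dots> = of_nat (card (cube (n * A) :: (int ^ 'd) set))"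
        by (simp add: emeasure_count_space_finite finite_cube)
      also have "\<dots> \<le> of_nat ((2 * (n * A) + 1) ^ CARD('d))"
        using card_cube[of "n * A", where 'd = 'd] by (intro of_nat_mono)
      finally show ?thesis .
    qed
    have "R A < \<top>"
      using le_less_trans[OF pow_bound[of 1] of_nat_less_top] by (simp only: power_one_right)
    then obtain r where r: "R A = ennreal r" "r \<ge> 0"
      by (cases "R A") auto
    have "r ^ n \<le> (real (2 * A) * real n + 1) ^ CARD('d)" for n
    proof -
      have "ennreal (r ^ n) \<le> ennreal (real ((2 * (n * A) + 1) ^ CARD('d)))"
        using pow_bound[of n] r by (simp add: ennreal_power ennreal_of_nat_eq_real_of_nat)
      then have "r ^ n \<le> real ((2 * (n * A) + 1) ^ CARD('d))"
        by (subst (asm) ennreal_le_iff) auto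
      then show ?thesis by (simp add: mult_ac add_ac)
    qed
    then have "r \<le> 1" by (rule poly_bounded_pow_le_one) (rule r(2))
    then show ?thesis using r by simp
  qed
  have "jump_gf \<mu> \<alpha> = (\<integral>\<^sup>+s. (SUP A. ennreal (pmf \<mu> s) * e s * indicator (cube A) s) \<partial>count_space UNIV)"
    unfolding jump_gf_def
  proof (intro nn_integral_cong)
    fix s :: "int ^ 'd"
    obtain M where M: "s \<in> cube M" using ex_mem_cube by blast
    have "(SUP A. ennreal (pmf \<mu> s) * e s * indicator (cube A) s) = ennreal (pmf \<mu> s) * e s"
    proof (rule antisym)
      show "(SUP A. ennreal (pmf \<mu> s) * e s * indicator (cube A) s) \<le> ennreal (pmf \<mu> s) * e s"
        by (rule SUP_least) (auto simp: indicator_def)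
      show "ennreal (pmf \<mu> s) * e s \<le> (SUP A. ennreal (pmf \<mu> s) * e s * indicator (cube A) s)"
        using M by (intro SUP_upper2[of M]) auto
    qed
    then show "ennreal (pmf \<mu> s * exp (\<alpha> \<bullet> real_vec s)) = (SUP A. ennreal (pmf \<mu> s) * e s * indicator (cube A) s)"
      by (simp add: e_def ennreal_mult)
  qed
  also have "\<dots> = (SUP A. R A)"
    unfolding R_def
  proof (rule nn_integral_monotone_convergence_SUP)
    show "incseq (\<lambda>A s. ennreal (pmf \<mu> s) * e s * indicator (cube A) s)"
      using cube_mono by (auto simp: incseq_def le_fun_def indicator_def)
  qed simp
  also have "\<dots> \<le> 1" by (intro SUP_least R_le)
  finally show ?thesis .
qed

text \<open>Concatenation of paths with displacements v and w; translation invariance lets the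
  second start at v.\<close>

lemma walk_pow_mult_le:
  fixes \<mu> :: "(int ^ 'd) pmf"
  defines "U n v \<equiv> (kop UNIV (walk_trans \<mu>) ^^ n) (indicator {v}) 0"
  shows "U m v * U n w \<le> U (m + n) (v + w)"
proof -
  let ?P = "kop UNIV (walk_trans \<mu>)"
  let ?f = "(?P ^^ n) (indicator {v + w})"
  have "U n w = (?P ^^ n) (\<lambda>y. indicator {v + w} (y + v)) 0"
    unfolding U_def by (intro pow_cong) (auto simp: indicator_def)
  also have "\<dots> \<le> ?f (0 + v)" by (rule pow_walk_shift_le) simp
  finally have "U m v * U n w \<le> ?f v * U m v"
    by (simp add: mult.commute mult_left_mono)
  also have "\<dots> = (?P ^^ m) (\<lambda>y. ?f v * indicator {v} y) 0"
    unfolding U_def by (rule pow_cmult[symmetric])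
  also have "\<dots> \<le> (?P ^^ m) ?f 0"
    by (intro pow_mono) (auto simp: indicator_def)
  also have "\<dots> = U (m + n) (v + w)"
    unfolding U_def by (rule pow_plus[symmetric])
  finally show ?thesis .
qed

text \<open>Otherwise minus the logarithm of the supremum of the weights over time, a subadditive
  function, would grow linearly along the multiples \<open>2 ^ k\<close> of \<open>v0\<close>. Its
  non-zero linear minorant \<alpha> would force
  \<open>jump_gf \<mu> \<alpha> \<le> 1\<close>.\<close>

lemma walk_pow_lower_bound:
  fixes \<mu> :: "(int ^ 'd) pmf"
  defines "U n v \<equiv> (kop UNIV (walk_trans \<mu>) ^^ n) (indicator {v}) 0"
  assumes jump_gf: "\<And>\<alpha>. \<alpha> \<noteq> 0 \<Longrightarrow> jump_gf \<mu> \<alpha> > 1"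
    and pos: "\<And>v. \<exists>n. U n v > 0" and \<epsilon>: "\<epsilon> > 0"
  shows "\<exists>k n. U n (nmul (2 ^ k) v0) > ennreal (exp (- \<epsilon> * 2 ^ k))"
proof (rule ccontr)
  assume "\<not> ?thesis"
  then have small: "U n (nmul (2 ^ k) v0) \<le> ennreal (exp (- \<epsilon> * 2 ^ k))" for k n
    by (meson not_le)
  \<comment> \<open>Taking the supremum over all times leaves a supermultiplicative function with no
    time index.\<close>
  define W where "W v = (SUP n. U n v)" for v
  have U_le: "U n v \<le> 1" for n v
  proof -
    have "U n v \<le> (kop UNIV (walk_trans \<mu>) ^^ n) (\<lambda>_. 1) 0"
      unfolding U_def by (intro pow_mono) (auto simp: indicator_def)
    also have "\<dots> \<le> 1" by (intro superharmonic_pow_le walk_row_le) simp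
    finally show ?thesis .
  qed
  have W_le: "W v \<le> 1" for v
    unfolding W_def by (intro SUP_least U_le)
  have W_pos: "W v > 0" for v
    using pos[of v] unfolding W_def by (auto simp: less_SUP_iff)
  have U_le_W: "U n v \<le> W v" for n v
    unfolding W_def by (rule SUP_upper) simp
  have W_mult: "W v * W w \<le> W (v + w)" for v w
  proof -
    have "U m v * W w \<le> W (v + w)" for m
      unfolding W_def[of w] SUP_mult_left_ennreal
      using walk_pow_mult_le[where \<mu> = \<mu> and m = m and v = v and w = w, folded U_def] U_le_W by (intro SUP_least) (meson order_trans)
    then have "(SUP m. W w * U m v) \<le> W (v + w)" by (intro SUP_least) (simp add: mult.commute)
    then show ?thesis unfolding W_def[of v] by (simp add: SUP_mult_left_ennreal[symmetric] mult.commute)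
  qed
  define w where "w v = enn2real (W v)" for v
  have W_w: "W v = ennreal (w v)" for v
    unfolding w_def using W_le[of v] by (simp add: ennreal_enn2real le_less_trans)
  have w: "0 < w v" "w v \<le> 1" for v
    using W_pos[of v] W_le[of v] by (auto simp: W_w)
  have w_mult: "w v * w u \<le> w (v + u)" for v u
    using W_mult[of v u] w[of v] w[of u] w[of "v + u"]
    by (simp add: W_w flip: ennreal_mult)
  have w_0: "w 0 = 1"
  proof -
    have "U 0 0 \<le> W 0" by (rule U_le_W)
    then show ?thesis using w[of 0] by (simp add: U_def W_w)
  qed
  have "\<exists>\<alpha>. \<alpha> \<noteq> 0 \<and> (\<forall>v. \<alpha> \<bullet> real_vec v \<le> - ln (w v))"
  proof (rule subadditive_support[OF _ _ _ \<epsilon>])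
    show "- ln (w v) \<ge> 0" for v using w[of v] by simp
    show "- ln (w (v + u)) \<le> - ln (w v) + - ln (w u)" for v u
    proof -
      have "ln (w v * w u) \<le> ln (w (v + u))"
        using w_mult[of v u] w by (subst ln_le_cancel_iff) auto
      then show ?thesis using w[of v] w[of u] by (simp add: ln_mult)
    qed
    show "- ln (w 0) = 0" by (simp add: w_0)
    fix k
    have "W (nmul (2 ^ k) v0) \<le> ennreal (exp (- \<epsilon> * 2 ^ k))"
      unfolding W_def by (intro SUP_least small)
    then have "w (nmul (2 ^ k) v0) \<le> exp (- \<epsilon> * 2 ^ k)" by (simp add: W_w)
    then have "ln (w (nmul (2 ^ k) v0)) \<le> ln (exp (- \<epsilon> * 2 ^ k))"
      using w by (subst ln_le_cancel_iff) auto
    then show "\<epsilon> * 2 ^ k \<le> - ln (w (nmul (2 ^ k) v0))" by simp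
  qed
  then obtain \<alpha> where \<alpha>: "\<alpha> \<noteq> 0" "\<And>v. \<alpha> \<bullet> real_vec v \<le> - ln (w v)" by blast
  have "U n v \<le> ennreal (exp (- (\<alpha> \<bullet> real_vec v)))" for n v
  proof -
    have "w v = exp (ln (w v))" using w[of v] by simp
    also have "\<dots> \<le> exp (- (\<alpha> \<bullet> real_vec v))" using \<alpha>(2)[of v] by simp
    finally show ?thesis using U_le_W[of n v] w[of v]
      by (simp add: W_w) (meson ennreal_leI order_trans)
  qed
  then have "jump_gf \<mu> \<alpha> \<le> 1" unfolding U_def by (rule jump_gf_le_one)
  with jump_gf[OF \<alpha>(1)] show False by simp
qed

section \<open>Transfer from the free walk to the cone\<close>

lemma nmul_nmul: "nmul m (nmul n u) = nmul (n * m) u"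
  by (induction m) (simp_all add: nmul_add[symmetric] add.commute)

lemma nmul_uminus: "nmul n (- u) = - nmul n (u :: 'a :: ab_group_add)"
  by (induction n) auto

lemma sub_potential_le:
  assumes "\<And>x. x \<in> E \<Longrightarrow> f x \<le> g x + kop E q f x" "x \<in> E"
  shows "f x \<le> (\<Sum>n<N. (kop E q ^^ n) g x) + (kop E q ^^ N) f x"
proof (induction N)
  case (Suc N)
  have "(kop E q ^^ N) f x \<le> (kop E q ^^ N) (\<lambda>x. g x + kop E q f x) x"
    using assms by (intro pow_mono) auto
  also have "\<dots> = (kop E q ^^ N) g x + (kop E q ^^ Suc N) f x"
    by (simp add: pow_add pow_Suc_right del: funpow.simps)
  finally have "(\<Sum>n<N. (kop E q ^^ n) g x) + (kop E q ^^ N) f x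
      \<le> (\<Sum>n<N. (kop E q ^^ n) g x) + ((kop E q ^^ N) g x + (kop E q ^^ Suc N) f x)"
    by (rule add_left_mono)
  from order_trans[OF Suc this] show ?case by (simp add: add.assoc del: funpow.simps)
qed simp

text \<open>Adding \<open>t N\<close> to the N-th partial sum gives the next one; if the sum is
  finite, the limit of \<open>t\<close> must vanish.\<close>

lemma suminf_decseq_LIMSEQ_zero:
  fixes t :: "nat \<Rightarrow> ennreal"
  assumes "decseq t" "(\<Sum>n. t n) < \<top>"
  shows "t \<longlonglongrightarrow> 0"
proof -
  have t: "t \<longlonglongrightarrow> (INF n. t n)" by (rule LIMSEQ_INF) fact
  have "(\<lambda>N. (\<Sum>n<N. t n) + t N) \<longlonglongrightarrow> (\<Sum>n. t n) + (INF n. t n)"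
    by (intro tendsto_add t summable_LIMSEQ summableI)
  moreover have "(\<lambda>N. (\<Sum>n<N. t n) + t N) \<longlonglongrightarrow> (\<Sum>n. t n)"
    using LIMSEQ_Suc[OF summable_LIMSEQ[OF summableI], of t] by simp
  ultimately have "(\<Sum>n. t n) + (INF n. t n) = (\<Sum>n. t n) + 0"
    using LIMSEQ_unique by fastforce
  then have "(INF n. t n) = 0"
    using assms(2) by (subst (asm) ennreal_add_left_cancel) auto
  with t show ?thesis by simp
qed

locale cone_walk = semigroup_walk E \<mu> for E :: "(int ^ 'd) set" and \<mu> +
  assumes deep: "\<And>N. \<exists>z. \<forall>b\<in>cube N. b + z \<in> E"
    and connected: "\<And>a b. a \<in> E \<Longrightarrow> b \<in> E \<Longrightarrow> \<exists>c>0. reach (ennreal c) a b"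
    and jump_gf: "\<And>\<alpha>. \<alpha> \<noteq> 0 \<Longrightarrow> jump_gf \<mu> \<alpha> > 1"
begin

lemma reach_mono: "reach c a b \<Longrightarrow> c' \<le> c \<Longrightarrow> reach c' a b"
  unfolding reach_def by (meson order_trans)

text \<open>Far inside \<open>E\<close> there is room for both endpoints, and communication within
  \<open>E\<close> yields a path of the free walk.\<close>

lemma free_walk_irreducible: "\<exists>n. (kop UNIV (walk_trans \<mu>) ^^ n) (indicator {v}) 0 > 0"
proof -
  obtain N where N: "v \<in> cube N" using ex_mem_cube by blast
  obtain z where z: "\<forall>b\<in>cube N. b + z \<in> E" using deep by blast
  have "0 + z \<in> E" "v + z \<in> E" using z[rule_format, OF zero_mem_cube] z[rule_format, OF N] by auto
  then obtain c n where c: "c > 0" and n: "ennreal c \<le> (P ^^ n) (indicator {v + z}) z"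
    using connected[of z "v + z"] by (auto simp: reach_def)
  have "(P ^^ n) (indicator {v + z}) z = (P ^^ n) (\<lambda>y. indicator {v} (y + - z)) z"
    using \<open>0 + z \<in> E\<close> by (intro pow_cong) (auto simp: indicator_def)
  also have "\<dots> \<le> (kop UNIV (walk_trans \<mu>) ^^ n) (indicator {v}) (z + - z)"
    by (rule pow_walk_shift_le) simp
  finally have "ennreal c \<le> (kop UNIV (walk_trans \<mu>) ^^ n) (indicator {v}) 0"
    using n by simp
  moreover have "0 < ennreal c" using c by simp
  ultimately have "0 < (kop UNIV (walk_trans \<mu>) ^^ n) (indicator {v}) 0"
    by (rule less_le_trans[rotated])
  then show ?thesis by (rule exI)
qed

text \<open>The strict bound for the free walk already holds for paths in some box, and this box is
  then moved into \<open>E\<close>.\<close>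

lemma deep_crossing:
  assumes "\<epsilon> > 0"
  shows "\<exists>k z. z \<in> E \<and> reach (ennreal (exp (- \<epsilon> * 2 ^ k))) z (nmul (2 ^ k) v + z)"
proof -
  obtain k n where kn: "(kop UNIV (walk_trans \<mu>) ^^ n) (indicator {nmul (2 ^ k) v}) 0 > ennreal (exp (- \<epsilon> * 2 ^ k))"
    using walk_pow_lower_bound[OF jump_gf free_walk_irreducible assms] by blast
  then obtain N where N: "ennreal (exp (- \<epsilon> * 2 ^ k)) < (kop (cube N) (walk_trans \<mu>) ^^ n) (indicator {nmul (2 ^ k) v}) 0"
    unfolding pow_cube_SUP(1)[symmetric] less_SUP_iff by blast
  obtain z where z: "\<forall>b\<in>cube N. b + z \<in> E" using deep by blast
  have "(kop (cube N) (walk_trans \<mu>) ^^ n) (indicator {nmul (2 ^ k) v}) 0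
      = (kop (cube N) (walk_trans \<mu>) ^^ n) (\<lambda>y. indicator {nmul (2 ^ k) v + z} (y + z)) 0"
    by (intro pow_cong) (auto simp: indicator_def)
  also have "\<dots> \<le> (P ^^ n) (indicator {nmul (2 ^ k) v + z}) (0 + z)"
    using z by (intro pow_walk_shift_le) auto
  finally have "reach (ennreal (exp (- \<epsilon> * 2 ^ k))) z (nmul (2 ^ k) v + z)"
    using N unfolding reach_def by (intro exI[of _ n]) (simp add: order.strict_implies_order order_trans)
  moreover have "0 + z \<in> E" using z zero_mem_cube by blast
  ultimately show ?thesis by auto
qed

text \<open>A fixed factor is absorbed by doubling the rate, once the number \<open>2 ^ l\<close> of
  blocks is large.\<close>

lemma ex_absorb_constant:
  fixes a \<epsilon> :: real
  assumes "a > 0" "\<epsilon> > 0"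
  shows "\<exists>l. exp (- (2 * \<epsilon>) * 2 ^ (k + l)) \<le> a * exp (- \<epsilon> * 2 ^ k) ^ (2 ^ l)"
proof -
  obtain l where l: "- ln a / \<epsilon> < 2 ^ l" using real_arch_pow[of 2] by auto
  have "(2 :: real) ^ l \<le> 2 ^ (k + l)" by simp
  then have "- ln a / \<epsilon> < 2 ^ (k + l)" using l by linarith
  then have "- \<epsilon> * 2 ^ (k + l) \<le> ln a" using assms by (simp add: field_simps)
  then have "exp (- (2 * \<epsilon>) * 2 ^ (k + l)) \<le> exp (ln a + - \<epsilon> * 2 ^ (k + l))"
    by simp
  also have "\<dots> = a * exp (2 ^ l * (- \<epsilon> * 2 ^ k))"
    using assms by (simp only: exp_add exp_ln) (simp add: power_add mult_ac)
  also have "\<dots> = a * exp (- \<epsilon> * 2 ^ k) ^ (2 ^ l)"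
    using exp_of_nat_mult[of "2 ^ l" "- \<epsilon> * 2 ^ k"] by simp
  finally show ?thesis by blast
qed

text \<open>Translated copies of one deep crossing are chained \<open>2 ^ l\<close> times; fixed
  paths between 0 and z join the chain to its endpoints.\<close>

lemma reach_nmul:
  assumes u: "u \<in> E" and \<epsilon>: "\<epsilon> > 0"
  shows "\<exists>k. reach (ennreal (exp (- \<epsilon> * 2 ^ k))) 0 (nmul (2 ^ k) u)"
    and "\<exists>k. reach (ennreal (exp (- \<epsilon> * 2 ^ k))) (nmul (2 ^ k) u) 0"
proof -
  \<comment> \<open>Crossings at rate \<epsilon> / 2 leave the other half for the connecting
    paths.\<close>
  have e2: "\<epsilon> / 2 > 0" using \<epsilon> by simp
  show "\<exists>k. reach (ennreal (exp (- \<epsilon> * 2 ^ k))) 0 (nmul (2 ^ k) u)"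
  proof -
    obtain k z where z: "z \<in> E" and kz: "reach (ennreal (exp (- (\<epsilon> / 2) * 2 ^ k))) z (nmul (2 ^ k) u + z)"
      using deep_crossing[OF e2] by blast
    define c where "c = exp (- (\<epsilon> / 2) * 2 ^ k)"
    define w where "w = nmul (2 ^ k) u"
    have w: "w \<in> E" using u by (simp add: w_def)
    have chain: "reach (ennreal c ^ l) z (nmul l w + z)" for l
    proof (induction l)
      case 0
      show ?case by (auto simp: reach_def intro: exI[of _ 0])
    next
      case (Suc l)
      have "reach (ennreal c) (z + nmul l w) (w + z + nmul l w)"
        using reach_shift[OF kz[folded c_def w_def] z] w by simp
      from reach_trans[OF Suc this[unfolded add.commute[of z]] z] show ?case
        by (simp add: add_ac mult.commute)
    qed
    obtain a b where a: "a > 0" "reach (ennreal a) 0 z" and b: "b > 0" "reach (ennreal b) z 0"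
      using connected z zero_mem by meson
    obtain l where l: "exp (- (2 * (\<epsilon> / 2)) * 2 ^ (k + l)) \<le> (a * b) * exp (- (\<epsilon> / 2) * 2 ^ k) ^ (2 ^ l)"
      using ex_absorb_constant[of "a * b" "\<epsilon> / 2" k] a b e2 by auto
    have "reach (ennreal a * (ennreal c ^ (2 ^ l) * ennreal b)) 0 (0 + nmul (2 ^ l) w)"
      using reach_shift[OF b(2) z, of "nmul (2 ^ l) w"] w z
      by (intro reach_trans[OF a(2)] reach_trans[OF chain]) (auto simp: add.commute)
    moreover have "ennreal a * (ennreal c ^ (2 ^ l) * ennreal b) = ennreal (a * b * c ^ (2 ^ l))"
      using a b by (simp add: ennreal_mult ennreal_power c_def mult_ac)
    ultimately have "reach (ennreal (exp (- \<epsilon> * 2 ^ (k + l)))) 0 (nmul (2 ^ l) w)"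
      using reach_mono[OF _ ennreal_leI[OF l]] by (simp add: c_def)
    then show ?thesis unfolding w_def nmul_nmul power_add[symmetric] by blast
  qed
  show "\<exists>k. reach (ennreal (exp (- \<epsilon> * 2 ^ k))) (nmul (2 ^ k) u) 0"
  proof -
    obtain k z where z: "z \<in> E" and kz: "reach (ennreal (exp (- (\<epsilon> / 2) * 2 ^ k))) z (nmul (2 ^ k) (- u) + z)"
      using deep_crossing[OF e2] by blast
    define c where "c = exp (- (\<epsilon> / 2) * 2 ^ k)"
    define w where "w = nmul (2 ^ k) u"
    have w: "w \<in> E" using u by (simp add: w_def)
    have chain: "reach (ennreal c ^ l) (nmul l w + z) z" for l
    proof (induction l)
      case 0
      show ?case by (auto simp: reach_def intro: exI[of _ 0])
    next
      case (Suc l)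
      \<comment> \<open>The crossing goes in direction - u; translating it by \<open>Suc l\<close>
        copies of w keeps both ends in \<open>E\<close>.\<close>
      have "reach (ennreal c) (z + nmul (Suc l) w) (- w + z + nmul (Suc l) w)"
        using kz w z by (intro reach_shift) (auto simp: c_def w_def nmul_uminus simp del: nmul.simps)
      then have "reach (ennreal c) (nmul (Suc l) w + z) (nmul l w + z)"
        by (simp add: add_ac)
      from reach_trans[OF this Suc] show ?case using w z by (simp del: nmul.simps)
    qed
    obtain a b where a: "a > 0" "reach (ennreal a) 0 z" and b: "b > 0" "reach (ennreal b) z 0"
      using connected z zero_mem by meson
    obtain l where l: "exp (- (2 * (\<epsilon> / 2)) * 2 ^ (k + l)) \<le> (a * b) * exp (- (\<epsilon> / 2) * 2 ^ k) ^ (2 ^ l)"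
      using ex_absorb_constant[of "a * b" "\<epsilon> / 2" k] a b e2 by auto
    have "reach (ennreal a * (ennreal c ^ (2 ^ l) * ennreal b)) (0 + nmul (2 ^ l) w) 0"
      using reach_shift[OF a(2) zero_mem, of "nmul (2 ^ l) w"] w z b(2)
      by (intro reach_trans[OF _ reach_trans[OF chain b(2)]]) (auto simp: add.commute)
    moreover have "ennreal a * (ennreal c ^ (2 ^ l) * ennreal b) = ennreal (a * b * c ^ (2 ^ l))"
      using a b by (simp add: ennreal_mult ennreal_power c_def mult_ac)
    ultimately have "reach (ennreal (exp (- \<epsilon> * 2 ^ (k + l)))) (nmul (2 ^ l) w) 0"
      using reach_mono[OF _ ennreal_leI[OF l]] by (simp add: c_def)
    then show ?thesis unfolding w_def nmul_nmul power_add[symmetric] by blast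
  qed
qed

text \<open>By \<open>shift_minorant_eq\<close>, the harmonic part in the Riesz decomposition of
  f(\<cdot> + u) is \<open>f\<close> itself.\<close>

lemma harm_shift_decomp:
  assumes f: "pos_harmonic f" and u: "u \<in> E" and x: "x \<in> E"
  shows "f (x + u) = f x + (\<Sum>n. (P ^^ n) (outflow u f) x)"
proof -
  obtain c where c: "c > 0" "reach (ennreal c) 0 u" using connected u zero_mem by blast
  have "shift_minorant u f x = f x"
    by (rule shift_minorant_eq[OF f u x c]) (use reach_nmul[OF u] in blast)+
  then show ?thesis using shift_minorant_decomp[OF f u x] by (simp add: add.commute)
qed

lemma harm_ladder: "pos_harmonic f \<Longrightarrow> u \<in> E \<Longrightarrow> f u = f 0 + PH f u"
  using harm_shift_decomp[of f u 0] by (simp add: PH_eq)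

section \<open>The renewal function and the ladder part\<close>

definition V :: "int ^ 'd \<Rightarrow> ennreal" where
  "V x = (\<Sum>n. (PH ^^ n) (\<lambda>_. 1) x)"

lemma V_ge_1: "1 \<le> V x"
  using sum_le_suminf[of "\<lambda>n. (PH ^^ n) (\<lambda>_. 1) x" "{0}"] by (simp add: V_def)

lemma V_LIMSEQ: "(\<lambda>N. \<Sum>n<N. (PH ^^ n) (\<lambda>_. 1) x) \<longlonglongrightarrow> V x"
  unfolding V_def by (rule summable_LIMSEQ) (rule summableI)

lemma sum_PH_const: "(\<Sum>n<N. (PH ^^ n) (\<lambda>_. c) x) = c * (\<Sum>n<N. (PH ^^ n) (\<lambda>_. 1) x)"
  using pow_cmult[where f = "\<lambda>_. 1" and q = "ladder_trans E \<mu>" and E = E and c = c]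
  by (simp add: sum_distrib_left)

definition ladder_part :: "(int ^ 'd \<Rightarrow> ennreal) \<Rightarrow> int ^ 'd \<Rightarrow> ennreal" where
  "ladder_part f x = (INF n. (PH ^^ n) f x)"

lemma harm_PH_le: "pos_harmonic f \<Longrightarrow> x \<in> E \<Longrightarrow> PH f x \<le> f x"
  by (intro PH_superharmonic) (auto simp: pos_harmonic_def)

lemma ladder_part_LIMSEQ:
  assumes "pos_harmonic f" "x \<in> E"
  shows "(\<lambda>n. (PH ^^ n) f x) \<longlonglongrightarrow> ladder_part f x"
  unfolding ladder_part_def
  by (intro LIMSEQ_INF superharmonic_decseq harm_PH_le assms)

lemma ladder_part_le: "ladder_part f x \<le> f x"
  unfolding ladder_part_def by (rule INF_lower2[of 0]) auto

text \<open>Iterating \<open>harm_ladder\<close> collects multiples of \<open>f 0\<close> into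
  \<open>V\<close>, while the remainder decreases to the ladder part.\<close>

lemma harm_decomp:
  assumes f: "pos_harmonic f" and x: "x \<in> E"
  shows "f x = f 0 * V x + ladder_part f x"
proof (rule LIMSEQ_unique)
  have "f x = (\<Sum>n<N. (PH ^^ n) (\<lambda>_. f 0) x) + (PH ^^ N) f x" for N
    by (rule potential_decomp[OF harm_ladder[OF f] x])
  then have eq: "(\<lambda>N. f 0 * (\<Sum>n<N. (PH ^^ n) (\<lambda>_. 1) x) + (PH ^^ N) f x) = (\<lambda>N. f x)"
    unfolding sum_PH_const[where c = "f 0"] by simp
  show "(\<lambda>N. f 0 * (\<Sum>n<N. (PH ^^ n) (\<lambda>_. 1) x) + (PH ^^ N) f x) \<longlonglongrightarrow> f x"
    unfolding eq by simp
  show "(\<lambda>N. f 0 * (\<Sum>n<N. (PH ^^ n) (\<lambda>_. 1) x) + (PH ^^ N) f x) \<longlonglongrightarrow> f 0 * V x + ladder_part f x"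
    by (rule tendsto_add[OF ennreal_tendsto_cmult[OF harm_finite[OF f zero_mem] V_LIMSEQ]
          ladder_part_LIMSEQ[OF f x]])
qed

lemma ladder_trans_finite:
  assumes "x \<in> E" "y \<in> E"
  shows "ladder_trans E \<mu> x y < \<top>"
proof -
  have "ladder_trans E \<mu> x y * 1 \<le> PH (\<lambda>_. 1) x"
    by (rule kop_ge_point[OF assms(2)])
  also have "\<dots> \<le> 1" by (rule ladder.row[OF assms(1)])
  finally show ?thesis by (simp add: le_less_trans)
qed

text \<open>The operator \<open>PH\<close> passes through the decreasing limit because
  \<open>f\<close> is a finite majorant.\<close>

lemma ladder_part_harmonic:
  assumes f: "pos_harmonic f" and x: "x \<in> E"
  shows "PH (ladder_part f) x = ladder_part f x"
proof -
  have "PH (ladder_part f) x = (INF n. PH ((PH ^^ n) f) x)"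
    unfolding ladder_part_def[abs_def]
  proof (rule kop_INF)
    show "PH ((PH ^^ 0) f) x < \<infinity>"
      using harm_PH_le[OF f x] harm_finite[OF f x] by (auto intro: le_less_trans)
  qed (use f x in \<open>auto intro!: superharmonic_decseq harm_PH_le ladder_trans_finite\<close>)
  also have "\<dots> = ladder_part f x"
  proof (rule LIMSEQ_unique)
    have "decseq (\<lambda>n. (PH ^^ Suc n) f x)"
      using superharmonic_decseq[where E = E and f = f and q = "ladder_trans E \<mu>" and x = x] harm_PH_le[OF f] x
      by (simp add: decseq_Suc_iff del: funpow.simps)
    then show "(\<lambda>n. (PH ^^ Suc n) f x) \<longlonglongrightarrow> (INF n. PH ((PH ^^ n) f) x)"
      using LIMSEQ_INF by fastforce
    show "(\<lambda>n. (PH ^^ Suc n) f x) \<longlonglongrightarrow> ladder_part f x"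
      using ladder_part_LIMSEQ[OF f x] by (rule LIMSEQ_Suc)
  qed
  finally show ?thesis .
qed

text \<open>By communication and the Harnack inequality, vanishing or finiteness at one point
  propagates to all of \<open>E\<close>.\<close>

lemma superharmonic_pos:
  assumes f: "\<And>x. x \<in> E \<Longrightarrow> P f x \<le> f x" and x: "x \<in> E" "y \<in> E"
  shows "f x = 0 \<Longrightarrow> f y = 0" and "f x < \<top> \<Longrightarrow> f y < \<top>"
proof -
  obtain c where c: "c > 0" "reach (ennreal c) x y" using connected[OF x] by blast
  have le: "ennreal c * f y \<le> f x"
    by (rule reach_superharmonic[OF c(2) f x(1)])
  show "f x = 0 \<Longrightarrow> f y = 0" using le c(1) by simp
  show "f x < \<top> \<Longrightarrow> f y < \<top>"
    using le c(1) by (metis ennreal_mult_top ennreal_eq_0_iff le_less_trans not_le top.not_eq_extremum)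
qed

section \<open>Truncated lifetimes: \<open>lifetime N x\<close> is the mean of min(\<tau>, N) from
  x\<close>

abbreviation lifetime :: "nat \<Rightarrow> int ^ 'd \<Rightarrow> ennreal" where
  "lifetime N x \<equiv> \<Sum>n<N. (P ^^ n) (\<lambda>_. 1) x"

lemma lifetime_Suc: "lifetime (Suc N) x = 1 + P (lifetime N) x"
  by (simp add: sum.lessThan_Suc_shift kop_sum del: sum.lessThan_Suc)

lemma lifetime_mono: "M \<le> N \<Longrightarrow> lifetime M x \<le> lifetime N x"
  by (intro sum_mono2) auto

lemma P_pow_one_le: "x \<in> E \<Longrightarrow> (P ^^ n) (\<lambda>_. 1) x \<le> 1"
  by (intro superharmonic_pow_le[where f = "\<lambda>_. 1"] row)

lemma lifetime_add_le: "x \<in> E \<Longrightarrow> lifetime (N + M) x \<le> lifetime N x + of_nat M"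
proof (induction M)
  case (Suc M)
  have "lifetime (N + Suc M) x \<le> lifetime (N + M) x + 1"
    using P_pow_one_le[OF Suc.prems] by (simp add: add_left_mono)
  also have "\<dots> \<le> lifetime N x + of_nat M + 1"
    using Suc by (intro add_right_mono)
  finally show ?case by (simp add: add_ac)
qed simp

text \<open>Truncated form of the shift identity: an exit from E + u at step n + 1 leaves a horizon
  of \<open>N - Suc n\<close>.\<close>

lemma lifetime_shift:
  assumes u: "u \<in> E"
  shows "x \<in> E \<Longrightarrow> lifetime N (x + u) = lifetime N x + (\<Sum>n<N. (P ^^ n) (outflow u (lifetime (N - Suc n))) x)"
proof (induction N arbitrary: x)
  case (Suc N)
  let ?D = "\<lambda>N x. \<Sum>n<N. (P ^^ n) (outflow u (lifetime (N - Suc n))) x"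
  have "?D (Suc N) x = outflow u (lifetime N) x + P (?D N) x"
    by (simp add: sum.lessThan_Suc_shift kop_sum del: sum.lessThan_Suc)
  moreover have "P (\<lambda>y. lifetime N (y + u)) x = P (\<lambda>y. lifetime N y + ?D N y) x"
    by (intro kop_cong Suc.IH)
  ultimately show ?case
    unfolding lifetime_Suc P_split[OF u] by (simp add: kop_add add_ac)
qed simp

text \<open>Every remaining horizon is enlarged to N, and the sum is extended to all exit
  times.\<close>

lemma lifetime_upper:
  assumes u: "u \<in> E"
  shows "lifetime N u \<le> lifetime N 0 + PH (lifetime N) u"
proof -
  have "(\<Sum>n<N. (P ^^ n) (outflow u (lifetime (N - Suc n))) 0) \<le> (\<Sum>n<N. (P ^^ n) (outflow u (lifetime N)) 0)"
    by (intro sum_mono pow_mono outflow_mono lifetime_mono) auto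
  also have "\<dots> \<le> PH (lifetime N) u"
    unfolding PH_eq by (intro sum_le_suminf summableI) auto
  finally show ?thesis using lifetime_shift[OF u zero_mem, of N] by (simp add: add_left_mono)
qed

text \<open>Iterating the upper bound K times leaves at most N times the survival probability of the
  ladder chain, which tends to 0 because \<open>V x\<close> is finite.\<close>

lemma lifetime_le_V:
  assumes V: "V x < \<top>" and x: "x \<in> E"
  shows "lifetime N x \<le> lifetime N 0 * V x"
proof (rule LIMSEQ_le_const)
  have 0: "(\<lambda>K. (PH ^^ K) (\<lambda>_. 1) x) \<longlonglongrightarrow> 0"
  proof (rule suminf_decseq_LIMSEQ_zero)
    show "decseq (\<lambda>K. (PH ^^ K) (\<lambda>_. 1) x)"
      by (intro superharmonic_decseq ladder.row x)
  qed (use V in \<open>simp add: V_def\<close>)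
  have fin: "lifetime N 0 < \<top>"
  proof (rule le_less_trans)
    show "lifetime N 0 \<le> of_nat N" using lifetime_add_le[OF zero_mem, of 0 N] by simp
  qed (rule of_nat_less_top)
  have "(\<lambda>K. lifetime N 0 * (\<Sum>n<K. (PH ^^ n) (\<lambda>_. 1) x) + of_nat N * (PH ^^ K) (\<lambda>_. 1) x)
      \<longlonglongrightarrow> lifetime N 0 * V x + of_nat N * 0"
    by (rule tendsto_add[OF ennreal_tendsto_cmult[OF fin V_LIMSEQ]
          ennreal_tendsto_cmult[OF of_nat_less_top 0]])
  then show "(\<lambda>K. lifetime N 0 * (\<Sum>n<K. (PH ^^ n) (\<lambda>_. 1) x) + of_nat N * (PH ^^ K) (\<lambda>_. 1) x)
      \<longlonglongrightarrow> lifetime N 0 * V x" by simp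
  have "lifetime N x \<le> lifetime N 0 * (\<Sum>n<K. (PH ^^ n) (\<lambda>_. 1) x) + of_nat N * (PH ^^ K) (\<lambda>_. 1) x" for K
  proof -
    have "lifetime N x \<le> (\<Sum>n<K. (PH ^^ n) (\<lambda>_. lifetime N 0) x) + (PH ^^ K) (lifetime N) x"
      by (intro sub_potential_le lifetime_upper x)
    also have "(PH ^^ K) (lifetime N) x \<le> (PH ^^ K) (\<lambda>_. of_nat N * 1) x"
      using lifetime_add_le[of _ 0 N] x by (intro pow_mono) auto
    finally show ?thesis unfolding sum_PH_const[where c = "lifetime N 0"] pow_cmult by (simp add: add_left_mono)
  qed
  then show "\<exists>N0. \<forall>K\<ge>N0. lifetime N x \<le> lifetime N 0 * (\<Sum>n<K. (PH ^^ n) (\<lambda>_. 1) x) + of_nat N * (PH ^^ K) (\<lambda>_. 1) x"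
    by blast
qed

text \<open>As \<open>M\<close> grows, \<open>trunc_V M K\<close> increases to the sum of the first \<open>K\<close> terms of \<open>V\<close>.\<close>

primrec trunc_V :: "nat \<Rightarrow> nat \<Rightarrow> int ^ 'd \<Rightarrow> ennreal" where
  "trunc_V M 0 = (\<lambda>_. 0)"
| "trunc_V M (Suc K) = (\<lambda>u. 1 + (\<Sum>n<M. (P ^^ n) (outflow u (trunc_V M K)) 0))"

lemma trunc_V_incseq: "incseq (\<lambda>M. trunc_V M K u)"
proof (induction K arbitrary: u)
  case (Suc K)
  show ?case
  proof (rule incseq_SucI)
    fix M
    have "(\<Sum>n<M. (P ^^ n) (outflow u (trunc_V M K)) 0) \<le> (\<Sum>n<M. (P ^^ n) (outflow u (trunc_V (Suc M) K)) 0)"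
      using incseq_SucD[OF Suc] by (intro sum_mono pow_mono outflow_mono) auto
    also have "\<dots> \<le> (\<Sum>n<Suc M. (P ^^ n) (outflow u (trunc_V (Suc M) K)) 0)"
      by (intro sum_mono2) auto
    finally show "trunc_V M (Suc K) u \<le> trunc_V (Suc M) (Suc K) u" by (simp add: add_left_mono)
  qed
qed simp

lemma outflow_SUP:
  assumes "\<And>y. incseq (\<lambda>M. f M y)"
  shows "outflow u (\<lambda>y. SUP M. f M y) z = (SUP M. outflow u (f M) z)"
proof -
  have "outflow u (\<lambda>y. SUP M. f M y) z = P (\<lambda>y. SUP M. if y \<in> translate E u then 0 else f M y) (z + u)"
    unfolding outflow_def by (intro kop_cong) auto
  also have "\<dots> = (SUP M. outflow u (f M) z)"
    unfolding outflow_def by (rule kop_SUP) (use assms in \<open>auto simp: incseq_def\<close>)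
  finally show ?thesis .
qed

text \<open>One parameter M governs both the number of steps and the inner truncation; the maximum
  of two parameters reconciles them under monotone convergence.\<close>

lemma trunc_V_SUP: "u \<in> E \<Longrightarrow> (\<Sum>k<K. (PH ^^ k) (\<lambda>_. 1) u) \<le> (SUP M. trunc_V M K u)"
proof (induction K arbitrary: u)
  case (Suc K)
  let ?g = "\<lambda>y. SUP M. trunc_V M K y"
  have "PH (\<lambda>y. \<Sum>k<K. (PH ^^ k) (\<lambda>_. 1) y) u \<le> PH ?g u"
    by (intro kop_mono Suc.IH)
  also have "PH ?g u \<le> (SUP M. \<Sum>n<M. (P ^^ n) (outflow u (trunc_V M K)) 0)" (is "_ \<le> (SUP M. ?s M)")
    unfolding PH_eq
  proof (rule suminf_le_const[OF summableI])
    fix N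
    let ?t = "\<lambda>n M. (P ^^ n) (outflow u (trunc_V M K)) 0"
    have inc_out: "incseq (\<lambda>M. outflow u (trunc_V M K) z)" for z
      using trunc_V_incseq by (auto simp: incseq_def intro!: outflow_mono)
    have t: "(P ^^ n) (outflow u ?g) 0 = (SUP M. ?t n M)" for n
      unfolding outflow_SUP[OF trunc_V_incseq] by (rule pow_SUP) (auto intro: inc_out)
    have inc_t: "incseq (?t n)" for n
      using inc_out by (auto simp: incseq_def intro!: pow_mono)
    have "(\<Sum>n<N. (P ^^ n) (outflow u ?g) 0) = (SUP M. \<Sum>n<N. ?t n M)"
      unfolding t using inc_t by (intro ennreal_SUP_sum[symmetric])
    also have "\<dots> \<le> (SUP M. ?s M)"
    proof (rule SUP_mono)
      fix M
      have "(\<Sum>n<N. ?t n M) \<le> (\<Sum>n<N. ?t n (max M N))"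
        using inc_t by (intro sum_mono) (auto simp: incseq_def)
      also have "\<dots> \<le> ?s (max M N)"
        by (intro sum_mono2) auto
      finally show "\<exists>m\<in>UNIV. (\<Sum>n<N. ?t n M) \<le> ?s m" by blast
    qed
    finally show "(\<Sum>n<N. (P ^^ n) (outflow u ?g) 0) \<le> (SUP M. ?s M)" .
  qed
  finally have "1 + PH (\<lambda>y. \<Sum>k<K. (PH ^^ k) (\<lambda>_. 1) y) u \<le> (SUP M. 1 + ?s M)"
    by (subst ennreal_SUP_add_right[symmetric]) (auto intro: add_left_mono)
  then show ?case
    by (simp add: sum.lessThan_Suc_shift kop_sum del: sum.lessThan_Suc)
qed simp

text \<open>Each of the K ladder levels consumes at most M steps, so the horizon
  \<open>L + K * M\<close> leaves at least L at the last one.\<close>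

lemma lifetime_lower:
  assumes "u \<in> E"
  shows "lifetime L 0 * trunc_V M K u \<le> lifetime (L + K * M) u"
  using assms
proof (induction K arbitrary: u)
  case (Suc K)
  let ?N = "L + Suc K * M" and ?c = "lifetime L 0"
  have "?c * (\<Sum>n<M. (P ^^ n) (outflow u (trunc_V M K)) 0) = (\<Sum>n<M. (P ^^ n) (outflow u (\<lambda>y. ?c * trunc_V M K y)) 0)"
  proof -
    have "outflow u (\<lambda>y. ?c * trunc_V M K y) = (\<lambda>z. ?c * outflow u (trunc_V M K) z)"
      unfolding outflow_def kop_cmult[symmetric] by (intro ext kop_cong) auto
    then show ?thesis by (simp only: sum_distrib_left pow_cmult)
  qed
  also have "\<dots> \<le> (\<Sum>n<M. (P ^^ n) (outflow u (lifetime (?N - Suc n))) 0)"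
  proof (intro sum_mono pow_mono outflow_mono)
    fix n y assume "n \<in> {..<M}" "y \<in> E"
    then have "?c * trunc_V M K y \<le> lifetime (L + K * M) y" "L + K * M \<le> ?N - Suc n"
      using Suc.IH by auto
    then show "?c * trunc_V M K y \<le> lifetime (?N - Suc n) y"
      using lifetime_mono order_trans by blast
  qed simp
  also have "\<dots> \<le> (\<Sum>n<?N. (P ^^ n) (outflow u (lifetime (?N - Suc n))) 0)"
    by (intro sum_mono2) auto
  finally have "?c + ?c * (\<Sum>n<M. (P ^^ n) (outflow u (trunc_V M K)) 0)
      \<le> lifetime ?N 0 + (\<Sum>n<?N. (P ^^ n) (outflow u (lifetime (?N - Suc n))) 0)"
    by (intro add_mono lifetime_mono) simp
  also have "\<dots> = lifetime ?N u"
    using lifetime_shift[OF Suc.prems zero_mem, of ?N] by simp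
  finally show ?case by (simp add: distrib_left)
qed simp

end

section \<open>Infinite versus finite mean killing time\<close>

context cone_walk
begin

text \<open>The two lifetime bounds give \<open>lifetime L 0 * trunc_V M K x \<le> 1 + (lifetime L 0
  + K * M) * P V x\<close>. As L grows, \<open>lifetime L 0\<close> is unbounded, and dividing by it
  leaves \<open>trunc_V M K x \<le> P V x\<close>.\<close>

lemma V_le_P_V:
  assumes inf: "(\<Sum>n. (P ^^ n) (\<lambda>_. 1) 0) = \<top>" and V: "\<And>y. y \<in> E \<Longrightarrow> V y < \<top>"
    and x: "x \<in> E" and PV: "P V x < \<top>"
  shows "V x \<le> P V x"
proof -
  have trunc: "trunc_V M K x \<le> P V x" for M K
  proof (rule ccontr)
    assume "\<not> ?thesis"
    then have "P V x < trunc_V M K x" by simp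
    then obtain r where r: "P V x < r" "r < trunc_V M K x" using dense by blast
    obtain p where p: "P V x = ennreal p" "p \<ge> 0" using PV by (cases "P V x") auto
    obtain s where s: "r = ennreal s" "s \<ge> 0" using r(2) by (cases r) auto
    have ps: "p < s" using r(1) p s by (simp add: ennreal_less_iff)
    \<comment> \<open>Obtained by solving \<open>a * s \<le> 1 + (a + K * M) * p\<close> for a; it
      does not depend on L.\<close>
    define B where "B = (1 + real (K * M) * p) / (s - p)"
    have le: "lifetime L 0 \<le> ennreal B" for L
    proof -
      have "lifetime L 0 < \<top>"
      proof (rule le_less_trans)
        show "lifetime L 0 \<le> of_nat L" using lifetime_add_le[OF zero_mem, of 0 L] by simp
      qed (rule of_nat_less_top)
      then obtain a where a: "lifetime L 0 = ennreal a" "a \<ge> 0" by (cases "lifetime L 0") auto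
      have "lifetime L 0 * r \<le> lifetime L 0 * trunc_V M K x"
        using r(2) by (intro mult_left_mono) auto
      also have "\<dots> \<le> lifetime (L + K * M) x" by (rule lifetime_lower[OF x])
      also have "\<dots> \<le> lifetime (Suc (L + K * M)) x" by (rule lifetime_mono) simp
      also have "\<dots> = 1 + P (lifetime (L + K * M)) x" by (rule lifetime_Suc)
      also have "P (lifetime (L + K * M)) x \<le> P (\<lambda>y. lifetime (L + K * M) 0 * V y) x"
        by (intro kop_mono lifetime_le_V V)
      also have "\<dots> = lifetime (L + K * M) 0 * P V x" by (rule kop_cmult)
      also have "\<dots> \<le> (lifetime L 0 + of_nat (K * M)) * P V x"
        by (intro mult_right_mono lifetime_add_le) auto
      finally have "lifetime L 0 * r \<le> 1 + (lifetime L 0 + of_nat (K * M)) * P V x"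
        by (simp add: add_left_mono)
      also have "\<dots> = ennreal (1 + (a + real (K * M)) * p)"
      proof -
        have A: "ennreal a + of_nat (K * M) = ennreal (a + real (K * M))"
          using a(2) by (simp add: ennreal_of_nat_eq_real_of_nat del: of_nat_mult)
        have "1 + ennreal (a + real (K * M)) * ennreal p = ennreal 1 + ennreal ((a + real (K * M)) * p)"
          using a(2) p(2) by (simp add: ennreal_mult del: ennreal_plus of_nat_mult)
        also have "\<dots> = ennreal (1 + (a + real (K * M)) * p)"
          using a(2) p(2) by (intro ennreal_plus[symmetric]) auto
        finally show ?thesis unfolding a p A .
      qed
      finally have "ennreal (a * s) \<le> ennreal (1 + (a + real (K * M)) * p)"
        unfolding a s ennreal_mult[OF a(2) s(2)] .
      then have "a * s \<le> 1 + (a + real (K * M)) * p"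
        using a(2) p(2) by (subst (asm) ennreal_le_iff) auto
      then have "a \<le> B" using ps by (simp add: B_def field_simps)
      then show ?thesis unfolding a by (rule ennreal_leI)
    qed
    have "(\<Sum>n. (P ^^ n) (\<lambda>_. 1) 0) \<le> ennreal B"
      by (rule suminf_le_const[OF summableI le])
    with inf show False by (simp add: top_unique)
  qed
  show ?thesis
    unfolding V_def
  proof (rule suminf_le_const[OF summableI])
    fix K
    have "(\<Sum>k<K. (PH ^^ k) (\<lambda>_. 1) x) \<le> (SUP M. trunc_V M K x)" by (rule trunc_V_SUP[OF x])
    also have "\<dots> \<le> P V x" by (rule SUP_least) (rule trunc)
    finally show "(\<Sum>k<K. (PH ^^ k) (\<lambda>_. 1) x) \<le> P (\<lambda>x. \<Sum>n. (PH ^^ n) (\<lambda>_. 1) x) x"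
      by (simp add: V_def[abs_def])
  qed
qed

lemma V_finite:
  assumes f: "pos_harmonic f" and pos: "f 0 \<noteq> 0" and x: "x \<in> E"
  shows "V x < \<top>"
proof -
  have "f 0 * V x < \<top>"
    using harm_decomp[OF f x] harm_finite[OF f x] by (metis add_top_right_ennreal ennreal_add_less_top)
  then show ?thesis using pos by (auto simp: ennreal_mult_less_top)
qed

text \<open>Since V \<le> P V, subtracting f(0) V from the harmonic \<open>f\<close> leaves a
  superharmonic function. It vanishes at 0, hence everywhere by communication.\<close>

lemma ladder_part_eq_0:
  assumes f: "pos_harmonic f" and pos: "f 0 \<noteq> 0" and x: "x \<in> E"
    and inf: "(\<Sum>n. (P ^^ n) (\<lambda>_. 1) 0) = \<top>"
  shows "ladder_part f x = 0"
proof -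
  let ?t = "ladder_part f"
  have f0: "f 0 < \<top>" by (rule harm_finite[OF f zero_mem])
  have super: "P ?t y \<le> ?t y" if y: "y \<in> E" for y
  proof -
    have "f y = P (\<lambda>z. f 0 * V z + ?t z) y"
      using harm_eq[OF f y] harm_decomp[OF f] by (metis (no_types, lifting) kop_cong)
    then have eq: "f y = f 0 * P V y + P ?t y" by (simp add: kop_add kop_cmult)
    have fin: "f 0 * P V y < \<top>"
      using eq harm_finite[OF f y] by (metis ennreal_add_less_top)
    then have "P V y < \<top>" using pos by (auto simp: ennreal_mult_less_top)
    then have "V y \<le> P V y" by (intro V_le_P_V inf V_finite[OF f pos] y)
    then have "f 0 * V y + P ?t y \<le> f 0 * P V y + P ?t y"
      by (intro add_right_mono mult_left_mono) auto
    also have "\<dots> = f 0 * V y + ?t y" using eq harm_decomp[OF f y] by simp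
    finally show ?thesis
      using f0 V_finite[OF f pos y] by (subst (asm) ennreal_add_left_cancel_le) (auto simp: ennreal_mult_eq_top_iff)
  qed
  \<comment> \<open>The bound \<open>V 0 \<ge> 1\<close> leaves no room for a ladder part at
    0.\<close>
  have "f 0 + ?t 0 \<le> f 0 * V 0 + ?t 0"
    using V_ge_1[of 0] mult_left_mono[of 1 "V 0" "f 0"] by (intro add_right_mono) simp
  also have "\<dots> = f 0 + 0" using harm_decomp[OF f zero_mem] by simp
  finally have "?t 0 = 0"
    using f0 by (subst (asm) ennreal_add_left_cancel_le) auto
  then show ?thesis using superharmonic_pos(1)[OF super zero_mem x] by simp
qed

text \<open>Otherwise f = f(0) V is dominated by a multiple of the mean lifetime \<open>g\<close>.
  As \<open>g\<close> is a finite potential, its iterates under \<open>P\<close> tend to 0, while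
  those of \<open>f\<close> stay constant.\<close>

lemma ladder_part_nonzero:
  assumes f: "pos_harmonic f" and pos: "f 0 \<noteq> 0" and y: "y \<in> E"
    and fin: "(\<Sum>n. (P ^^ n) (\<lambda>_. 1) y) < \<top>"
  shows "\<exists>x\<in>E. ladder_part f x \<noteq> 0"
proof (rule ccontr)
  assume "\<not> ?thesis"
  then have f_V: "f x = f 0 * V x" if "x \<in> E" for x
    using harm_decomp[OF f that] that by simp
  define g where "g x = (\<Sum>n. (P ^^ n) (\<lambda>_. 1) x)" for x
  have g_eq: "g x = 1 + P g x" for x
  proof -
    have "g x = (\<Sum>n<1. (P ^^ n) (\<lambda>_. 1) x) + (\<Sum>n. (P ^^ (n + 1)) (\<lambda>_. 1) x)"
      unfolding g_def by (subst add.commute) (rule suminf_offset[OF summableI])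
    then show ?thesis by (simp add: g_def[abs_def] kop_suminf)
  qed
  have g_super: "P g x \<le> g x" for x
  proof -
    have "P g x \<le> 1 + P g x" by simp
    then show ?thesis by (simp only: g_eq[symmetric])
  qed
  have g_fin: "g x < \<top>" if "x \<in> E" for x
    using superharmonic_pos(2)[OF g_super y that] fin by (simp add: g_def)
  \<comment> \<open>The source of g(\<cdot> + u) is 1 plus the outflow: the first part sums to
    \<open>g 0\<close>, the second to \<open>PH g u\<close>.\<close>
  have g_ladder: "g 0 + PH g u \<le> g u" if u: "u \<in> E" for u
  proof -
    have "(\<Sum>n. (P ^^ n) (\<lambda>z. 1 + outflow u g z) 0) \<le> g (0 + u)"
    proof (rule potential_le[where f = "\<lambda>z. g (z + u)"])
      show "1 + outflow u g z + P (\<lambda>y. g (y + u)) z \<le> g (z + u)" for z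
        using g_eq[of "z + u"] P_split[OF u, of g z] by (simp add: add.assoc)
    qed simp
    moreover have "(\<Sum>n. (P ^^ n) (\<lambda>z. 1 + outflow u g z) 0) = g 0 + PH g u"
      unfolding pow_add PH_eq g_def[of 0] by (intro suminf_add[symmetric] summableI)
    ultimately show ?thesis by simp
  qed
  have g_V: "g 0 * V x \<le> g x" if "x \<in> E" for x
  proof -
    have "(\<Sum>n. (PH ^^ n) (\<lambda>_. g 0 * 1) x) \<le> g x"
      using g_ladder that by (intro potential_le) auto
    then show ?thesis unfolding pow_cmult V_def by simp
  qed
  have le: "g 0 * f x \<le> f 0 * g x" if "x \<in> E" for x
    using mult_left_mono[OF g_V[OF that], of "f 0"] f_V[OF that] by (simp add: mult_ac)
  \<comment> \<open>The finite value \<open>g 0\<close> is the limit of its partial sums, so the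
    remainder \<open>(P ^^ N) g 0\<close> tends to 0.\<close>
  have lim: "(\<lambda>N. (P ^^ N) g 0) \<longlonglongrightarrow> (INF N. (P ^^ N) g 0)"
    by (intro LIMSEQ_INF superharmonic_decseq g_super zero_mem)
  have "(\<lambda>N. (\<Sum>n<N. (P ^^ n) (\<lambda>_. 1) 0) + (P ^^ N) g 0) \<longlonglongrightarrow> g 0 + (INF N. (P ^^ N) g 0)"
    unfolding g_def[of 0] by (rule tendsto_add[OF summable_LIMSEQ[OF summableI] lim])
  moreover have "(\<Sum>n<N. (P ^^ n) (\<lambda>_. 1) 0) + (P ^^ N) g 0 = g 0" for N
    by (rule potential_decomp[symmetric, OF g_eq zero_mem])
  ultimately have "(\<lambda>N :: nat. g 0) \<longlonglongrightarrow> g 0 + (INF N. (P ^^ N) g 0)" by simp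
  then have "g 0 + 0 = g 0 + (INF N. (P ^^ N) g 0)"
    using LIMSEQ_unique[OF tendsto_const] by fastforce
  then have INF_0: "(INF N. (P ^^ N) g 0) = 0"
    using g_fin[OF zero_mem] by (subst (asm) ennreal_add_left_cancel) auto
  have "g 0 * f 0 \<le> f 0 * (P ^^ N) g 0" for N
  proof -
    have "g 0 * f 0 = (P ^^ N) (\<lambda>x. g 0 * f x) 0"
      using harmonic_pow[OF harm_eq[OF f] zero_mem] by (simp add: pow_cmult)
    also have "\<dots> \<le> (P ^^ N) (\<lambda>x. f 0 * g x) 0"
      by (intro pow_mono le zero_mem)
    finally show ?thesis by (simp add: pow_cmult)
  qed
  moreover have "(\<lambda>N. f 0 * (P ^^ N) g 0) \<longlonglongrightarrow> f 0 * 0"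
    using lim INF_0 by (intro ennreal_tendsto_cmult harm_finite[OF f zero_mem]) simp
  ultimately have "g 0 * f 0 \<le> f 0 * 0"
    by (intro LIMSEQ_le_const) auto
  moreover have "g 0 \<noteq> 0" using g_eq[of 0] by (metis add_eq_0_iff_both_eq_0 zero_neq_one)
  ultimately show False using pos by simp
qed

end

section \<open>Lattice points of an open convex cone\<close>

lemma cone_closure_add:
  assumes C: "open_convex_cone C" and x: "x \<in> closure C" and y: "y \<in> closure C"
  shows "x + y \<in> closure C"
proof -
  have add: "a + b \<in> C" if "a \<in> C" "b \<in> C" for a b
  proof -
    have "(1 / 2) *\<^sub>R a + (1 / 2) *\<^sub>R b \<in> C"
      using C that by (intro convexD) (auto simp: open_convex_cone_def)
    then have "2 *\<^sub>R ((1 / 2) *\<^sub>R a + (1 / 2) *\<^sub>R b) \<in> C"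
      using C unfolding open_convex_cone_def by (meson zero_less_numeral)
    then show ?thesis by (simp add: scaleR_add_right)
  qed
  obtain a b where "\<And>n. a n \<in> C" "a \<longlonglongrightarrow> x" "\<And>n. b n \<in> C" "b \<longlonglongrightarrow> y"
    using x y unfolding closure_sequential by blast
  then show ?thesis
    unfolding closure_sequential
    by (intro exI[of _ "\<lambda>n. a n + b n"]) (auto intro: add tendsto_add)
qed

lemma cone_zero_mem_closure:
  assumes C: "open_convex_cone C" and c: "c \<in> C"
  shows "0 \<in> closure C"
  unfolding closure_sequential
proof (intro exI conjI allI)
  show "(1 / real (Suc n)) *\<^sub>R c \<in> C" for n
    using C c unfolding open_convex_cone_def by simp
  have "(\<lambda>n. (1 / real (Suc n)) *\<^sub>R c) \<longlonglongrightarrow> 0 *\<^sub>R c"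
    by (intro tendsto_scaleR tendsto_const LIMSEQ_Suc[OF lim_1_over_n])
  then show "(\<lambda>n. (1 / real (Suc n)) *\<^sub>R c) \<longlonglongrightarrow> 0" by simp
qed

text \<open>Scaling up a ball inside \<open>C\<close> makes room for any box around the rounded
  centre.\<close>

lemma lattice_cone_deep:
  fixes C :: "(real ^ 'd) set"
  assumes C: "open_convex_cone C" and c: "c \<in> C"
  shows "\<exists>z. \<forall>b\<in>cube N. b + z \<in> lattice_cone C"
proof -
  obtain r where r: "r > 0" "ball c r \<subseteq> C"
    using C c unfolding open_convex_cone_def open_contains_ball by blast
  \<comment> \<open>The scaled radius \<open>t * r\<close> exceeds the l1 bound on the error: N from
    the box and 1 from rounding, in each coordinate.\<close>
  define t where "t = (real CARD('d) * (real N + 1) + 1) / r"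
  have t: "t > 0" "t * r = real CARD('d) * (real N + 1) + 1"
    using r by (auto simp: t_def add_nonneg_pos)
  define z :: "int ^ 'd" where "z = (\<chi> i. \<lfloor>t * c $ i\<rfloor>)"
  have "b + z \<in> lattice_cone C" if b: "b \<in> cube N" for b
  proof -
    let ?y = "real_vec (b + z)"
    have "norm (t *\<^sub>R c - ?y) \<le> (\<Sum>i\<in>UNIV. \<bar>(t *\<^sub>R c - ?y) $ i\<bar>)"
      by (rule norm_le_l1_cart)
    also have "\<dots> \<le> (\<Sum>i\<in>(UNIV :: 'd set). real N + 1)"
    proof (rule sum_mono)
      fix i :: 'd
      have "\<bar>b $ i\<bar> \<le> int N" using b by (simp add: cube_def)
      then have "\<bar>real_of_int (b $ i)\<bar> \<le> real N" by linarith
      moreover have "\<bar>t * c $ i - real_of_int \<lfloor>t * c $ i\<rfloor>\<bar> \<le> 1" by linarith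
      moreover have "(t *\<^sub>R c - ?y) $ i = (t * c $ i - real_of_int \<lfloor>t * c $ i\<rfloor>) - real_of_int (b $ i)"
        by (simp add: real_vec_def z_def)
      ultimately show "\<bar>(t *\<^sub>R c - ?y) $ i\<bar> \<le> real N + 1" by linarith
    qed
    also have "\<dots> < t * r" unfolding t(2) by simp
    finally have "dist (t *\<^sub>R c) ?y < t * r" by (simp add: dist_norm)
    moreover have "dist (t *\<^sub>R c) ?y = t * dist c ((1 / t) *\<^sub>R ?y)"
    proof -
      have "t *\<^sub>R c - ?y = t *\<^sub>R (c - (1 / t) *\<^sub>R ?y)" using t(1) by (simp add: scaleR_diff_right)
      then show ?thesis using t(1) by (simp add: dist_norm)
    qed
    ultimately have "(1 / t) *\<^sub>R ?y \<in> C" using r(2) t(1) by (auto simp: subset_iff)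
    then have "t *\<^sub>R ((1 / t) *\<^sub>R ?y) \<in> C"
      using C t(1) unfolding open_convex_cone_def by blast
    then have "?y \<in> C" using t(1) by simp
    then show ?thesis using closure_subset by (auto simp: lattice_cone_def)
  qed
  then show ?thesis by blast
qed

text \<open>The product of the one-step probabilities along a communicating path is a positive
  constant.\<close>

lemma (in semigroup_walk) communication_reach:
  assumes comm: "communication_condition E \<mu>" and a: "a \<in> E" and b: "b \<in> E"
  shows "\<exists>c>0. reach (ennreal c) a b"
proof (cases "a = b")
  case True
  then have "reach (ennreal 1) a b" by (auto simp: reach_def intro!: exI[of _ 0])
  then show ?thesis by (intro exI[of _ 1]) simp
next
  case False
  obtain \<kappa> E0 where E0: "\<forall>x\<in>E0. pmf \<mu> x > 0"
    and path: "\<forall>x\<in>E. \<forall>y\<in>E. x \<noteq> y \<longrightarrow>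
      (\<exists>n w. w 0 = x \<and> w n = y \<and> (\<forall>j\<le>n. w j \<in> E) \<and>
        real n \<le> \<kappa> * norm (real_vec (y - x)) \<and> (\<forall>j\<in>{1..n}. w j - w (j - 1) \<in> E0))"
    using comm unfolding communication_condition_def by metis
  from path[THEN bspec, OF a, THEN bspec, OF b, THEN mp, OF False]
  show ?thesis
  proof (elim exE conjE)
    fix n :: nat and w assume w: "w 0 = a" "w n = b" "\<forall>j\<le>n. w j \<in> E" "\<forall>j\<in>{1..n}. w j - w (j - 1) \<in> E0"
    have "j \<le> n \<Longrightarrow> \<exists>c>0. reach (ennreal c) a (w j)" for j
    proof (induction j)
      case 0
      have "reach (ennreal 1) a (w 0)" using w(1) by (auto simp: reach_def intro!: exI[of _ 0])
      then show ?case by (intro exI[of _ 1]) simp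
    next
      case (Suc j)
      then obtain c where c: "c > 0" "reach (ennreal c) a (w j)" by auto
      let ?p = "pmf \<mu> (w (Suc j) - w j)"
      have p: "?p > 0" using w(4) E0 Suc.prems by (auto dest!: bspec[of _ _ "Suc j"])
      have "walk_trans \<mu> (w j) (w (Suc j)) * indicator {w (Suc j)} (w (Suc j)) \<le> P (indicator {w (Suc j)}) (w j)"
        using w(3) Suc.prems by (intro kop_ge_point) auto
      then have "reach (ennreal ?p) (w j) (w (Suc j))"
        by (auto simp: reach_def walk_trans_def intro!: exI[of _ 1])
      from reach_trans[OF c(2) this a] have "reach (ennreal (c * ?p)) a (w (Suc j))"
        using c by (simp add: ennreal_mult)
      then show ?case using c p by (intro exI[of _ "c * ?p"]) simp
    qed
    with w(2) show ?thesis by auto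
  qed
qed

section \<open>Decomposition and dichotomy for a harmonic function on the cone\<close>

theorem corollary4p2:
  fixes \<mu> :: "(int ^ 'd) pmf" and C :: "(real ^ 'd) set" and E :: "(int ^ 'd) set"
    and h :: "int ^ 'd \<Rightarrow> real"
  assumes cone: "open_convex_cone C"
    and E: "E = lattice_cone C"
    and transient: "transient_on E \<mu>"
    and communication: "communication_condition E \<mu>"
    and jump_gf_0: "jump_gf \<mu> 0 = 1"
    and jump_gf_min: "\<And>\<alpha>. \<alpha> \<noteq> 0 \<Longrightarrow> jump_gf \<mu> \<alpha> > jump_gf \<mu> 0"
    and harmonic: "harmonic_on E \<mu> h"
  shows "(\<forall>x\<in>E. ladder_op E \<mu> h x \<le> ennreal (h x)) \<and>
    (\<forall>x\<in>E. \<forall>u\<in>E. ennreal (h (x + u)) =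
        ennreal (h x) + (\<integral>\<^sup>+X. value_at h X (exit_time E u X) \<partial>walk_law E \<mu> (x + u))) \<and>
    (\<exists>h' :: int ^ 'd \<Rightarrow> real.
       (\<forall>x\<in>E. h' x \<ge> 0) \<and>
       (\<forall>x\<in>E. (\<lambda>n. \<integral>\<^sup>+X. value_at h X (ladder_time E X n) \<partial>walk_law E \<mu> x)
                  \<longlonglongrightarrow> ennreal (h' x)) \<and>
       (\<forall>x\<in>E. ennreal (h x) = ennreal (h 0) * ladder_V E \<mu> x + ennreal (h' x)) \<and>
       (\<forall>x\<in>E. ladder_op E \<mu> h' x = ennreal (h' x)) \<and>
       ((\<forall>x\<in>E. mean_killing_time E \<mu> x = \<infinity>) \<longrightarrow>
          (\<forall>x\<in>E. h' x = 0) \<and>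
          (\<exists>c>0. \<forall>x\<in>E. ennreal (h x) = ennreal c * ladder_V E \<mu> x)) \<and>
       (\<not> (\<forall>x\<in>E. mean_killing_time E \<mu> x = \<infinity>) \<longrightarrow> (\<exists>x\<in>E. h' x \<noteq> 0)))"
proof -
  have h_nonneg: "\<And>x. x \<in> E \<Longrightarrow> h x \<ge> 0" and h_nonzero: "\<exists>x\<in>E. h x \<noteq> 0"
    and h_eq: "\<And>x. x \<in> E \<Longrightarrow> kop E (walk_trans \<mu>) (\<lambda>y. ennreal (h y)) x = ennreal (h x)"
    using harmonic by (auto simp: harmonic_on_def kop_def)
  \<comment> \<open>A non-zero \<open>h\<close> needs a point of \<open>E\<close>, so the cone is
    non-empty.\<close>
  then have "closure C \<noteq> {}" by (auto simp: E lattice_cone_def)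
  then obtain c where c: "c \<in> C" by auto
  interpret semigroup_walk E \<mu>
  proof
    show "0 \<in> E" using cone_zero_mem_closure[OF cone c] by (simp add: E lattice_cone_def)
    show "x + y \<in> E" if "x \<in> E" "y \<in> E" for x y
      using that cone_closure_add[OF cone] by (simp add: E lattice_cone_def real_vec_add)
  qed
  interpret cone_walk E \<mu>
  proof
    show "\<exists>z. \<forall>b\<in>cube N. b + z \<in> E" for N
      unfolding E by (rule lattice_cone_deep[OF cone c])
    show "\<exists>c>0. reach (ennreal c) a b" if "a \<in> E" "b \<in> E" for a b
      by (rule communication_reach[OF communication that])
    show "jump_gf \<mu> \<alpha> > 1" if "\<alpha> \<noteq> 0" for \<alpha>
      using jump_gf_min[OF that] jump_gf_0 by simp
  qed
  define f where "f y = ennreal (h y)" for y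
  have f: "pos_harmonic f" using h_eq by (simp add: pos_harmonic_def f_def[abs_def])
  obtain y where y: "y \<in> E" "f y \<noteq> 0"
    using h_nonzero h_nonneg by (auto simp: f_def)
  \<comment> \<open>Vanishing at 0 would propagate to all of \<open>E\<close>, against the
    non-triviality of \<open>h\<close>.\<close>
  have f0: "f 0 \<noteq> 0"
    using superharmonic_pos(1)[of f 0 y] harm_eq[OF f] y by auto
  then have h0: "h 0 > 0" by (simp add: f_def ennreal_eq_0_iff)
  \<comment> \<open>On \<open>E\<close> the ladder part is at most \<open>f\<close>, hence finite,
    and passing to reals loses nothing.\<close>
  define h' where "h' x = enn2real (ladder_part f x)" for x
  have h'_eq: "ennreal (h' x) = ladder_part f x" if x: "x \<in> E" for x
    unfolding h'_def using le_less_trans[OF ladder_part_le[of f x] harm_finite[OF f x]] by (simp add: ennreal_enn2real)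
  have V_eq: "ladder_V E \<mu> x = V x" if "x \<in> E" for x
    using ladder_V_eq[OF that] by (simp add: V_def)
  have decomp: "ennreal (h x) = ennreal (h 0) * ladder_V E \<mu> x + ennreal (h' x)" if "x \<in> E" for x
    using harm_decomp[OF f that] V_eq[OF that] h'_eq[OF that] by (simp add: f_def)
  have ladder_le: "ladder_op E \<mu> h x \<le> ennreal (h x)" if "x \<in> E" for x
    using harm_PH_le[OF f that] by (simp add: ladder_op_eq f_def[abs_def])
  have exit: "ennreal (h (x + u)) = ennreal (h x) + (\<integral>\<^sup>+X. value_at h X (exit_time E u X) \<partial>walk_law E \<mu> (x + u))"
    if "x \<in> E" "u \<in> E" for x u
    using harm_shift_decomp[OF f that(2,1)] nn_integral_exit_time[OF that(2,1), of h] by (simp add: f_def[abs_def])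
  have lim: "(\<lambda>n. \<integral>\<^sup>+X. value_at h X (ladder_time E X n) \<partial>walk_law E \<mu> x) \<longlonglongrightarrow> ennreal (h' x)" if x: "x \<in> E" for x
    using ladder_part_LIMSEQ[OF f x] nn_integral_ladder_value(1)[OF x, of h]
    by (simp add: h'_eq[OF x] f_def[abs_def] walk_law_def ladder_value_def)
  have harm_h': "ladder_op E \<mu> h' x = ennreal (h' x)" if x: "x \<in> E" for x
  proof -
    have "ladder_op E \<mu> h' x = PH (ladder_part f) x"
      unfolding ladder_op_eq by (intro kop_cong h'_eq)
    then show ?thesis using ladder_part_harmonic[OF f x] h'_eq[OF x] by simp
  qed
  have zero: "h' x = 0" if inf: "\<forall>x\<in>E. mean_killing_time E \<mu> x = \<infinity>" and x: "x \<in> E" for x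
  proof -
    have "(\<Sum>n. (P ^^ n) (\<lambda>_. 1) 0) = \<top>"
      using bspec[OF inf zero_mem] unfolding mean_killing_time_eq[OF zero_mem] by simp
    from ladder_part_eq_0[OF f f0 x this] show ?thesis by (simp add: h'_def)
  qed
  have nonzero: "\<exists>x\<in>E. h' x \<noteq> 0" if fin: "\<not> (\<forall>x\<in>E. mean_killing_time E \<mu> x = \<infinity>)"
  proof -
    obtain z where z: "z \<in> E" "mean_killing_time E \<mu> z \<noteq> \<infinity>" using fin by blast
    then have "(\<Sum>n. (P ^^ n) (\<lambda>_. 1) z) < \<top>"
      unfolding mean_killing_time_eq[OF z(1)] infinity_ennreal_def top.not_eq_extremum by blast
    from ladder_part_nonzero[OF f f0 z(1) this] obtain x where "x \<in> E" "ladder_part f x \<noteq> 0" by blast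
    then show ?thesis using h'_eq by (metis ennreal_0)
  qed
  have proportional: "\<exists>c>0. \<forall>x\<in>E. ennreal (h x) = ennreal c * ladder_V E \<mu> x"
    if "\<forall>x\<in>E. mean_killing_time E \<mu> x = \<infinity>"
  proof (intro exI[of _ "h 0"] conjI ballI h0)
    fix x assume "x \<in> E"
    from decomp[OF this] zero[OF that this] show "ennreal (h x) = ennreal (h 0) * ladder_V E \<mu> x" by simp
  qed
  have h'_nonneg: "h' x \<ge> 0" for x by (simp add: h'_def)
  show ?thesis
    by (intro conjI exI[of _ h'] ballI impI;
        (rule ladder_le exit h'_nonneg lim decomp harm_h' zero proportional nonzero; assumption))
qed

end
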